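(* Let $T=\begin{pmatrix}A&B\\C&-A^*\end{pmatrix}$ be a diagonally dominant, nonnegative Hamiltonian operator matrix on $H\times H$ with $\varrho(T)\cap i\mathbb R\neq\varnothing$ and a finitely spectral Riesz basis of subspaces $(V_k)_{k\in\mathbb N}$. Suppose that (a) $B$ is positive, or (b) there is a connected component $M$ of $\varrho(A)$ such that $M\cap\varrho(T)\cap i\mathbb R\neq\varnothing$ and $\operatorname{span}\{(A-z)^{-1}B^*u\,|\,z\in M,\ u\in\mathcal D(B^* )\}$ is dense in $H$. Consider the Riccati equation $$X(Au+BXu)=Cu-A^*Xu,\qquad u\in\mathcal D(A)\cap X^{-1}\mathcal D(A^* ).\qquad(R)$$ Then $\sigma_p(T)\cap i\mathbb R=\varnothing$ if and only if $$\ker(A-it)\cap\ker C=\{0\}\quad\text{for all } t\in\mathbb R.$$ In this case, for every sc-set $\sigma\subset\sigma_p(T)$ the associated compatible subspace $U_\sigma=\overline{\sum_{\lambda\in\sigma}\mathcal L(\lambda)}$ is hypermaximal $J_1$-neutral and thus $U_\sigma=\Gamma(X_\sigma)$ with a selfadjoint solution $X_\sigma$ of $(R)$. The solutions $X_+$ and $X_-$ corresponding to $\sigma=\sigma_p^+(T)$ and $\sigma=\sigma_p^-(T)$ are nonnegative and nonpositive, respectively. If $C$ is even positive, then every $X_\sigma$ is injective. In addition, $X_+$ (respectively $X_-$) is the uniquely determined nonnegative (respectively nonpositive) selfadjoint solution of $(R)$ whose graph is compatible with $(V_k)_{k\in\mathbb N}$.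
   Context: $H$ is a complex separable Hilbert space with scalar product $(\cdot|\cdot)$, linear in the first argument. $\varrho$ denotes the resolvent set. Hamiltonian operator matrix: a block operator matrix $T=\begin{pmatrix}A&B\\C&-A^*\end{pmatrix}$ on $H\times H$ with domain $\mathcal D(T)=(\mathcal D(A)\cap\mathcal D(C))\times(\mathcal D(A^* )\cap\mathcal D(B))$, where $A,B,C$ are densely defined linear operators on $H$, $B$ and $C$ are symmetric, and $T$ is densely defined. $T$ is nonnegative if $B,C$ are nonnegative. An operator $B$ is positive if $(Bv|v)>0$ for all $v\in\mathcal D(B)\setminus\{0\}$. $T$ is diagonally dominant if $C$ is relatively bounded to $A$ and $B$ is relatively bounded to $A^*$, i.e. $\mathcal D(A)\subset\mathcal D(C)$, $\mathcal D(A^* )\subset\mathcal D(B)$, and there are constants $a,b\ge 0$ with $\|Cu\|\le a\|u\|+b\|Au\|$ for $u\in\mathcal D(A)$ and $\|Bv\|\le a\|v\|+b\|A^*v\|$ for $v\in\mathcal D(A^* )$. $J_1=\begin{pmatrix}0&-iI\\ iI&0\end{pmatrix}$, $\langle x|y\rangle=(J_1x|y)$ on $H\times H$; $U$ is hypermaximal $J_1$-neutral if $U=U^{\langle\perp\rangle}:=\{x:\langle x|y\rangle=0\ \forall y\in U\}$. Riesz basis of subspaces of a separable Hilbert space $V$: a sequence $(V_k)_{k\in\mathbb N}$ of closed subspaces (possibly some equal to $\{0\}$) such that for some isomorphism $\Phi:V\to V$ the subspaces $\Phi(V_k)$ are pairwise orthogonal with dense linear span. For closed subspaces $U_k\subset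 V_k$ write $\bigoplus^2_kU_k=\overline{\sum_kU_k}$; a subspace $U$ is compatible with $(V_k)$ if $U=\bigoplus^2_kU_k$ for some closed $U_k\subset V_k$. The Riesz basis $(V_k)$ (here $V=H\times H$) is finitely spectral for a closed operator $T$ if each $V_k$ is finite-dimensional, $V_k\subset\mathcal D(T)$, $V_k$ is $T$-invariant, the sets $\sigma(T|_{V_k})$ are pairwise disjoint, and $\sum_kV_k$ is a core for $T$ (for every $x\in\mathcal D(T)$ there are $x_n\in\sum_kV_k$ with $x_n\to x$, $Tx_n\to Tx$). Having a finitely spectral Riesz basis of subspaces includes that $T$ is closed. $\mathcal L(\lambda)=\bigcup_k\ker(T-\lambda)^k$; $\sigma_p^\pm(T)$ are the sets of eigenvalues of $T$ in the open right/left half-plane. For such $T$, $\sigma_p(T)$ is symmetric with respect to $i\mathbb R$. A subset $\sigma\subset\sigma_p(T)\setminus i\mathbb R$ is an sc-set if (i) $\lambda\in\sigma\Rightarrow-\overline\lambda\notin\sigma$, and (ii) $\lambda\in\sigma_p(T)\setminus i\mathbb R\Rightarrow\lambda\in\sigma$ or $-\overline\lambda\in\sigma$. $\Gamma(X)=\{(u,Xu):u\in\mathcal D(X)\}$, and $X^{-1}\mathcal D(A^* )=\{u\in\mathcal D(X):Xu\in\mathcal D(A^* )\}$. The Riccati equation $(R)$ includes the assertion that $Au+BXu\in\mathcal D(X)$ for all the indicated $u$. *)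

theory Defs
  imports "HOL-Analysis.Analysis" "HOL-Library.Complex_Order"
begin

section \<open>Complex Hilbert spaces\<close>

text \<open>
  The scalar product is linear in the first argument.  The last assumption comprises
  positive definiteness and says that the norm is the one induced by the scalar product;
  completeness comes from the class \<open>banach\<close>.
\<close>

class complex_hilbert = banach +
  fixes scaleC :: "complex \<Rightarrow> 'a \<Rightarrow> 'a"  (infixr "*\<^sub>C" 75)
    and cinner :: "'a \<Rightarrow> 'a \<Rightarrow> complex"
  assumes scaleC_add_right: "c *\<^sub>C (x + y) = c *\<^sub>C x + c *\<^sub>C y"
    and scaleC_add_left: "(c + d) *\<^sub>C x = c *\<^sub>C x + d *\<^sub>C x"
    and scaleC_scaleC: "c *\<^sub>C d *\<^sub>C x = (c * d) *\<^sub>C x"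
    and scaleC_of_real: "complex_of_real r *\<^sub>C x = scaleR r x"
    and cinner_commute: "cinner x y = cnj (cinner y x)"
    and cinner_add_left: "cinner (x + y) z = cinner x z + cinner y z"
    and cinner_scaleC_left: "cinner (c *\<^sub>C x) y = c * cinner x y"
    and cinner_self: "cinner x x = complex_of_real ((norm x)\<^sup>2)"

lemma scaleC_one: "1 *\<^sub>C (x::'a::complex_hilbert) = x"
  using scaleC_of_real[of 1 x] by simp

global_interpretation cvec: vector_space "scaleC :: complex \<Rightarrow> 'a \<Rightarrow> 'a::complex_hilbert"
  by unfold_locales
    (simp_all add: scaleC_add_right scaleC_add_left scaleC_scaleC scaleC_one)

instantiation prod :: (complex_hilbert, complex_hilbert) complex_hilbert
begin

definition scaleC_prod :: "complex \<Rightarrow> 'a \<times> 'b \<Rightarrow> 'a \<times> 'b" where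
  "scaleC_prod c x = (c *\<^sub>C fst x, c *\<^sub>C snd x)"

definition cinner_prod :: "'a \<times> 'b \<Rightarrow> 'a \<times> 'b \<Rightarrow> complex" where
  "cinner_prod x y = cinner (fst x) (fst y) + cinner (snd x) (snd y)"

instance
proof
  fix x y z :: "'a \<times> 'b" and c d :: complex and r :: real
  show "c *\<^sub>C (x + y) = c *\<^sub>C x + c *\<^sub>C y"
    by (simp add: scaleC_prod_def scaleC_add_right)
  show "(c + d) *\<^sub>C x = c *\<^sub>C x + d *\<^sub>C x"
    by (simp add: scaleC_prod_def scaleC_add_left)
  show "c *\<^sub>C d *\<^sub>C x = (c * d) *\<^sub>C x"
    by (simp add: scaleC_prod_def scaleC_scaleC)
  show "complex_of_real r *\<^sub>C x = r *\<^sub>R x"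
    by (simp add: scaleC_prod_def scaleC_of_real scaleR_prod_def)
  show "cinner x y = cnj (cinner y x)"
    unfolding cinner_prod_def
    by (simp add: cinner_commute[of "fst x" "fst y"] cinner_commute[of "snd x" "snd y"])
  show "cinner (x + y) z = cinner x z + cinner y z"
    by (simp add: cinner_prod_def cinner_add_left)
  show "cinner (c *\<^sub>C x) y = c * cinner x y"
    by (simp add: cinner_prod_def scaleC_prod_def cinner_scaleC_left distrib_left)
  show "cinner x x = complex_of_real ((norm x)\<^sup>2)"
    by (simp add: cinner_prod_def cinner_self norm_prod_def)
qed

end


section \<open>Unbounded operators\<close>

text \<open>
  An operator is a partial function: \<open>dom T\<close> is its domain, \<open>Map.graph T\<close> its graph and
  \<open>T |` W\<close> its restriction to \<open>W\<close>.  Hence equality of operators includes equality of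
  their domains.
\<close>

type_synonym ('a, 'b) operator = "'a \<rightharpoonup> 'b"

abbreviation app :: "('a, 'b) operator \<Rightarrow> 'a \<Rightarrow> 'b"  (infixl "\<cdot>" 90) where
  "T \<cdot> x \<equiv> the (T x)"

definition linear_op :: "('a::complex_hilbert, 'b::complex_hilbert) operator \<Rightarrow> bool" where
  "linear_op T \<longleftrightarrow> cvec.subspace (dom T)
     \<and> (\<forall>x\<in>dom T. \<forall>y\<in>dom T. T \<cdot> (x + y) = T \<cdot> x + T \<cdot> y)
     \<and> (\<forall>c. \<forall>x\<in>dom T. T \<cdot> (c *\<^sub>C x) = c *\<^sub>C (T \<cdot> x))"

definition densely_defined :: "('a::complex_hilbert, 'b) operator \<Rightarrow> bool" where
  "densely_defined T \<longleftrightarrow> closure (dom T) = UNIV"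

definition closed_op :: "('a::complex_hilbert, 'b::complex_hilbert) operator \<Rightarrow> bool" where
  "closed_op T \<longleftrightarrow> closed (Map.graph T)"

text \<open>The adjoint, meant for densely defined operators: only then is \<open>w\<close> unique.\<close>

definition adj ::
  "('a::complex_hilbert, 'b::complex_hilbert) operator \<Rightarrow> ('b, 'a) operator" where
  "adj T = (\<lambda>v. if \<exists>w. \<forall>u\<in>dom T. cinner (T \<cdot> u) v = cinner u w
                then Some (THE w. \<forall>u\<in>dom T. cinner (T \<cdot> u) v = cinner u w) else None)"

definition symmetric_op :: "('a::complex_hilbert, 'a) operator \<Rightarrow> bool" where
  "symmetric_op B \<longleftrightarrow> (\<forall>u\<in>dom B. \<forall>v\<in>dom B. cinner (B \<cdot> u) v = cinner u (B \<cdot> v))"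

definition selfadjoint :: "('a::complex_hilbert, 'a) operator \<Rightarrow> bool" where
  "selfadjoint X \<longleftrightarrow> linear_op X \<and> densely_defined X \<and> adj X = X"

text \<open>
  The order on the complex numbers is that of \<open>Complex_Order\<close>: comparability with \<open>0\<close>
  includes being real.
\<close>

definition nonnegative_op :: "('a::complex_hilbert, 'a) operator \<Rightarrow> bool" where
  "nonnegative_op B \<longleftrightarrow> (\<forall>v\<in>dom B. cinner (B \<cdot> v) v \<ge> 0)"

definition nonpositive_op :: "('a::complex_hilbert, 'a) operator \<Rightarrow> bool" where
  "nonpositive_op B \<longleftrightarrow> (\<forall>v\<in>dom B. cinner (B \<cdot> v) v \<le> 0)"

definition positive_op :: "('a::complex_hilbert, 'a) operator \<Rightarrow> bool" where
  "positive_op B \<longleftrightarrow> (\<forall>v\<in>dom B - {0}. cinner (B \<cdot> v) v > 0)"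

definition relatively_bounded ::
  "('a::complex_hilbert, 'c::complex_hilbert) operator
   \<Rightarrow> ('a, 'b::complex_hilbert) operator \<Rightarrow> bool" where
  "relatively_bounded S T \<longleftrightarrow> dom T \<subseteq> dom S
     \<and> (\<exists>a\<ge>0. \<exists>b\<ge>0. \<forall>u\<in>dom T. norm (S \<cdot> u) \<le> a * norm u + b * norm (T \<cdot> u))"

definition injective_op :: "('a, 'b) operator \<Rightarrow> bool" where
  "injective_op T \<longleftrightarrow> inj_on (\<lambda>x. T \<cdot> x) (dom T)"

definition inverse_op :: "('a, 'b) operator \<Rightarrow> ('b, 'a) operator" where
  "inverse_op T = (\<lambda>y. if y \<in> ran T then Some (THE x. T x = Some y) else None)"

definition op_kernel :: "('a, 'b::zero) operator \<Rightarrow> 'a set" where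
  "op_kernel T = {x. T x = Some 0}"

text \<open>\<open>shift T z\<close> is \<open>T - z\<close>, with the same domain as \<open>T\<close>.\<close>

definition shift :: "('a::complex_hilbert, 'a) operator \<Rightarrow> complex \<Rightarrow> ('a, 'a) operator" where
  "shift T z = (\<lambda>x. map_option (\<lambda>y. y - z *\<^sub>C x) (T x))"

text \<open>Powers carry their maximal domains, since \<open>\<circ>\<^sub>m\<close> is composition of partial functions.\<close>

primrec op_power :: "('a, 'a) operator \<Rightarrow> nat \<Rightarrow> ('a, 'a) operator" where
  "op_power T 0 = Some"
| "op_power T (Suc n) = T \<circ>\<^sub>m op_power T n"


section \<open>Spectral notions\<close>

text \<open>
  In the next two definitions \<open>T\<close> is regarded as an operator in the closed subspace \<open>W\<close>,
  i.e. \<open>dom T \<subseteq> W\<close> and \<open>ran T \<subseteq> W\<close> are understood.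
\<close>

definition resolvent_set_in ::
  "'a::complex_hilbert set \<Rightarrow> ('a, 'a) operator \<Rightarrow> complex set" where
  "resolvent_set_in W T = {z. injective_op (shift T z) \<and> ran (shift T z) = W
     \<and> (\<exists>c. \<forall>y\<in>W. norm (inverse_op (shift T z) \<cdot> y) \<le> c * norm y)}"

definition spectrum_in ::
  "'a::complex_hilbert set \<Rightarrow> ('a, 'a) operator \<Rightarrow> complex set" where
  "spectrum_in W T = - resolvent_set_in W T"

definition resolvent_set :: "('a::complex_hilbert, 'a) operator \<Rightarrow> complex set" where
  "resolvent_set T = resolvent_set_in UNIV T"

definition point_spectrum :: "('a::complex_hilbert, 'a) operator \<Rightarrow> complex set" where
  "point_spectrum T = {z. \<exists>x\<in>op_kernel (shift T z). x \<noteq> 0}"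

definition point_spectrum_right :: "('a::complex_hilbert, 'a) operator \<Rightarrow> complex set" where
  "point_spectrum_right T = {z \<in> point_spectrum T. Re z > 0}"

definition point_spectrum_left :: "('a::complex_hilbert, 'a) operator \<Rightarrow> complex set" where
  "point_spectrum_left T = {z \<in> point_spectrum T. Re z < 0}"

definition imaginary_axis :: "complex set" where
  "imaginary_axis = {z. Re z = 0}"

definition root_subspace :: "('a::complex_hilbert, 'a) operator \<Rightarrow> complex \<Rightarrow> 'a set" where
  "root_subspace T z = (\<Union>k. op_kernel (op_power (shift T z) k))"

definition sc_set :: "('a::complex_hilbert, 'a) operator \<Rightarrow> complex set \<Rightarrow> bool" where
  "sc_set T \<sigma> \<longleftrightarrow> \<sigma> \<subseteq> point_spectrum T - imaginary_axis
     \<and> (\<forall>z\<in>\<sigma>. - cnj z \<notin> \<sigma>)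
     \<and> (\<forall>z\<in>point_spectrum T - imaginary_axis. z \<in> \<sigma> \<or> - cnj z \<in> \<sigma>)"


section \<open>Riesz bases of subspaces\<close>

text \<open>
  For subspaces \<open>V k\<close>, the algebraic sum of all \<open>V k\<close> is the span of their union; its
  closure is \<open>hilbert_sum UNIV V\<close>.
\<close>

definition algebraic_sum :: "'i set \<Rightarrow> ('i \<Rightarrow> 'a::complex_hilbert set) \<Rightarrow> 'a set" where
  "algebraic_sum I V = cvec.span (\<Union>i\<in>I. V i)"

definition hilbert_sum :: "'i set \<Rightarrow> ('i \<Rightarrow> 'a::complex_hilbert set) \<Rightarrow> 'a set" where
  "hilbert_sum I V = closure (algebraic_sum I V)"

definition closed_subspace :: "'a::complex_hilbert set \<Rightarrow> bool" where
  "closed_subspace U \<longleftrightarrow> cvec.subspace U \<and> closed U"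

definition isomorphism :: "('a::complex_hilbert \<Rightarrow> 'a) \<Rightarrow> bool" where
  "isomorphism \<Phi> \<longleftrightarrow> Vector_Spaces.linear scaleC scaleC \<Phi> \<and> bij \<Phi>
     \<and> bounded_linear \<Phi> \<and> bounded_linear (inv \<Phi>)"

definition riesz_basis :: "(nat \<Rightarrow> 'a::complex_hilbert set) \<Rightarrow> bool" where
  "riesz_basis V \<longleftrightarrow> (\<forall>k. closed_subspace (V k))
     \<and> (\<exists>\<Phi>. isomorphism \<Phi>
          \<and> (\<forall>j k. j \<noteq> k \<longrightarrow> (\<forall>x\<in>\<Phi> ` V j. \<forall>y\<in>\<Phi> ` V k. cinner x y = 0))
          \<and> closure (algebraic_sum UNIV (\<lambda>k. \<Phi> ` V k)) = UNIV)"

definition compatible :: "(nat \<Rightarrow> 'a::complex_hilbert set) \<Rightarrow> 'a set \<Rightarrow> bool" where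
  "compatible V U \<longleftrightarrow>
     (\<exists>W. (\<forall>k. closed_subspace (W k) \<and> W k \<subseteq> V k) \<and> U = hilbert_sum UNIV W)"

definition is_core :: "'a::complex_hilbert set \<Rightarrow> ('a, 'a) operator \<Rightarrow> bool" where
  "is_core D T \<longleftrightarrow> D \<subseteq> dom T
     \<and> (\<forall>x\<in>dom T. \<exists>s. (\<forall>n. s n \<in> D) \<and> s \<longlonglongrightarrow> x \<and> (\<lambda>n. T \<cdot> s n) \<longlonglongrightarrow> T \<cdot> x)"

definition finitely_spectral ::
  "('a::complex_hilbert, 'a) operator \<Rightarrow> (nat \<Rightarrow> 'a set) \<Rightarrow> bool" where
  "finitely_spectral T V \<longleftrightarrow> closed_op T \<and> riesz_basis V
     \<and> (\<forall>k. (\<exists>E. finite E \<and> V k = cvec.span E) \<and> V k \<subseteq> dom T \<and> (\<forall>x\<in>V k. T \<cdot> x \<in> V k))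
     \<and> (\<forall>j k. j \<noteq> k \<longrightarrow>
          spectrum_in (V j) (T |` V j) \<inter> spectrum_in (V k) (T |` V k) = {})
     \<and> is_core (algebraic_sum UNIV V) T"

definition spectral_subspace ::
  "('a::complex_hilbert, 'a) operator \<Rightarrow> complex set \<Rightarrow> 'a set" where
  "spectral_subspace T \<sigma> = hilbert_sum \<sigma> (root_subspace T)"


section \<open>Hamiltonian operator matrices\<close>

definition ham_matrix ::
  "('h::complex_hilbert, 'h) operator \<Rightarrow> ('h, 'h) operator \<Rightarrow> ('h, 'h) operator
   \<Rightarrow> ('h \<times> 'h, 'h \<times> 'h) operator" where
  "ham_matrix A B C = (\<lambda>(u, v).
     if u \<in> dom A \<inter> dom C \<and> v \<in> dom (adj A) \<inter> dom B
     then Some (A \<cdot> u + B \<cdot> v, C \<cdot> u - adj A \<cdot> v) else None)"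

definition hamiltonian ::
  "('h::complex_hilbert, 'h) operator \<Rightarrow> ('h, 'h) operator \<Rightarrow> ('h, 'h) operator \<Rightarrow> bool" where
  "hamiltonian A B C \<longleftrightarrow>
     linear_op A \<and> densely_defined A
     \<and> linear_op B \<and> densely_defined B \<and> symmetric_op B
     \<and> linear_op C \<and> densely_defined C \<and> symmetric_op C
     \<and> densely_defined (ham_matrix A B C)"

definition diagonally_dominant ::
  "('h::complex_hilbert, 'h) operator \<Rightarrow> ('h, 'h) operator \<Rightarrow> ('h, 'h) operator \<Rightarrow> bool" where
  "diagonally_dominant A B C \<longleftrightarrow> relatively_bounded C A \<and> relatively_bounded B (adj A)"

definition J1 :: "'h::complex_hilbert \<times> 'h \<Rightarrow> 'h \<times> 'h" where
  "J1 x = (- (\<i> *\<^sub>C snd x), \<i> *\<^sub>C fst x)"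

definition hypermaximal_J1_neutral :: "('h::complex_hilbert \<times> 'h) set \<Rightarrow> bool" where
  "hypermaximal_J1_neutral U \<longleftrightarrow> U = {x. \<forall>y\<in>U. cinner (J1 x) y = 0}"

definition riccati_solution ::
  "('h::complex_hilbert, 'h) operator \<Rightarrow> ('h, 'h) operator \<Rightarrow> ('h, 'h) operator
   \<Rightarrow> ('h, 'h) operator \<Rightarrow> bool" where
  "riccati_solution A B C X \<longleftrightarrow>
     (\<forall>u\<in>dom A \<inter> {u \<in> dom X. X \<cdot> u \<in> dom (adj A)}.
        A \<cdot> u + B \<cdot> (X \<cdot> u) \<in> dom X
        \<and> X \<cdot> (A \<cdot> u + B \<cdot> (X \<cdot> u)) = C \<cdot> u - adj A \<cdot> (X \<cdot> u))"

end

theory Submission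
  imports Defs
    "HOL-Computational_Algebra.Fundamental_Theorem_Algebra"
    "HOL-Complex_Analysis.Conformal_Mappings"
begin

text \<open>
  \<open>T\<close> is skew-symmetric for \<open>\<langle>x|y\<rangle> = (J\<^sub>1 x|y)\<close> and satisfies \<open>Re [T x|x] \<ge> 0\<close> for the second
  indefinite product \<open>[x|y] = (x\<^sub>1|y\<^sub>2) + (x\<^sub>2|y\<^sub>1)\<close>.  By skew-symmetry the root subspaces of \<open>z\<close> and
  \<open>w\<close> are \<open>J\<^sub>1\<close>-orthogonal unless \<open>z = - cnj w\<close>, so \<open>U\<^sub>\<sigma>\<close> is neutral; completeness of the root
  subspaces and the projections of the Riesz basis make it hypermaximal neutral.  Applying
  \<open>(T - it)\<^sup>-\<^sup>1\<close>, which leaves \<open>U\<^sub>\<sigma>\<close> invariant, to an element \<open>(0, v)\<close> of \<open>U\<^sub>\<sigma>\<close> and evaluating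
  \<open>Re [T x|x]\<close> on the result gives \<open>v = 0\<close>, so \<open>U\<^sub>\<sigma>\<close> is a graph.  The sign of \<open>X\<^sub>\<plusminus>\<close> comes from the
  monotonicity of \<open>[x(t)|x(t)]\<close> along the solutions of \<open>x' = T x\<close> in \<open>U\<^sub>\<plusminus>\<close>, which decay in one
  time direction; conversely, a signed solution with compatible graph can only contain
  eigenvectors of \<open>T\<close> for eigenvalues in the matching half-plane.
\<close>

section \<open>The geometry of complex Hilbert spaces\<close>

text \<open>General elements of U_\<sigma> lie outside \<open>dom T\<close>, so properties of
  U_\<sigma> are tested on root vectors and carried over by density and closedness; where an
  operator has to act on an arbitrary element, the bounded resolvent is used. The main obstacle is
  hypermaximality: the projections \<open>P k\<close> of the Riesz basis have no evident relation to
  \<open>J1\<close>, so it is not clear what \<open>P k x\<close> inherits from an \<open>x\<close>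
  that is \<open>J1\<close>-orthogonal to U_\<sigma>. The link is that each root subspace lies in a
  single \<open>V j\<close>. For a root vector \<open>y\<close> of \<open>w\<close>, the number
  \<open>cinner (J1 (P k x)) y\<close> is \<open>cinner (J1 x) y\<close> or 0 for all
  \<open>x\<close> alike, depending on whether the summand holding the root subspace of
  \<open>- cnj w\<close> is \<open>V k\<close>. For the graph property, vanishing of the form leaves
  \<open>v = - (adj A b + it b)\<close> with \<open>B b = 0\<close>; positivity of \<open>B\<close>
  gives \<open>b = 0\<close>, whereas under (b) it is essential that \<open>v\<close> stays fixed
  while \<open>t\<close> varies over an interval. In the uniqueness proof strict positivity of
  \<open>C\<close> rules out the borderline case in the comparison of signs.\<close>

lemma cinner_add_right: "cinner x (y + z) = cinner x y + cinner x (z::'a::complex_hilbert)"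
  using cinner_add_left[of y z x] by (metis cinner_commute complex_cnj_add)

lemma cinner_scaleC_right: "cinner x (c *\<^sub>C y) = cnj c * cinner x (y::'a::complex_hilbert)"
  using cinner_scaleC_left[of c y x] by (metis cinner_commute complex_cnj_mult)

lemma scaleC_minus_one: "(- 1) *\<^sub>C x = - (x::'a::complex_hilbert)"
  using cvec.scale_minus_left[of 1 x] by (simp add: scaleC_one)

lemma cinner_minus_left: "cinner (- x) y = - cinner x (y::'a::complex_hilbert)"
  using cinner_scaleC_left[of "- 1" x y] by (simp add: scaleC_minus_one)

lemma cinner_minus_right: "cinner x (- y) = - cinner x (y::'a::complex_hilbert)"
  using cinner_scaleC_right[of x "- 1" y] by (simp add: scaleC_minus_one)

lemma cinner_diff_left: "cinner (x - y) z = cinner x z - cinner y (z::'a::complex_hilbert)"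
  using cinner_add_left[of x "- y" z] by (simp add: cinner_minus_left)

lemma cinner_diff_right: "cinner x (y - z) = cinner x y - cinner x (z::'a::complex_hilbert)"
  using cinner_add_right[of x y "- z"] by (simp add: cinner_minus_right)

lemma cinner_zero_left [simp]: "cinner 0 (y::'a::complex_hilbert) = 0"
  using cinner_diff_left[of 0 0 y] by simp

lemma cinner_zero_right [simp]: "cinner (x::'a::complex_hilbert) 0 = 0"
  using cinner_diff_right[of x 0 0] by simp

lemmas cinner_algebra =
  cinner_add_left cinner_add_right cinner_diff_left cinner_diff_right
  cinner_minus_left cinner_minus_right cinner_scaleC_left cinner_scaleC_right

lemma cinner_self_eq_zero_iff: "cinner x x = 0 \<longleftrightarrow> (x::'a::complex_hilbert) = 0"
  by (simp add: cinner_self)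

lemma cinner_eq_zero_commute: "cinner x y = 0 \<longleftrightarrow> cinner y (x::'a::complex_hilbert) = 0"
  by (metis cinner_commute complex_cnj_zero)

lemma norm_scaleC: "norm (c *\<^sub>C (x::'a::complex_hilbert)) = cmod c * norm x"
proof -
  have "complex_of_real ((norm (c *\<^sub>C x))\<^sup>2) = complex_of_real ((cmod c * norm x)\<^sup>2)"
    unfolding cinner_self[symmetric] cinner_scaleC_left cinner_scaleC_right
    by (simp add: cinner_self power_mult_distrib complex_norm_square[symmetric] ac_simps)
  then have "(norm (c *\<^sub>C x))\<^sup>2 = (cmod c * norm x)\<^sup>2"
    using of_real_eq_iff by blast
  then show ?thesis
    by (simp add: power2_eq_iff_nonneg)
qed

text \<open>This expansion serves three purposes: the Cauchy-Schwarz inequality, the first variation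
  of the distance to a subspace, and the theorem of Pythagoras.\<close>

lemma norm_diff_scaleC_square:
  "(norm (x - c *\<^sub>C y))\<^sup>2 =
     (norm x)\<^sup>2 - 2 * Re (cnj c * cinner x y) + (cmod c)\<^sup>2 * (norm (y::'a::complex_hilbert))\<^sup>2"
proof -
  have "complex_of_real ((norm (x - c *\<^sub>C y))\<^sup>2) =
      cinner x x - cnj c * cinner x y - (c * cinner y x - cnj c * (c * cinner y y))"
    unfolding cinner_self[symmetric] by (simp add: cinner_algebra algebra_simps)
  also have "c * cinner y x = cnj (cnj c * cinner x y)"
    by (simp add: cinner_commute[of y x])
  finally have eq: "Re (complex_of_real ((norm (x - c *\<^sub>C y))\<^sup>2)) =
      Re (cinner x x) - Re (cnj c * cinner x y)
      - (Re (cnj (cnj c * cinner x y)) - Re (cnj c * (c * cinner y y)))"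
    by simp
  have "cnj c * (c * cinner y y) = complex_of_real ((cmod c)\<^sup>2 * (norm y)\<^sup>2)"
    by (simp add: cinner_self complex_norm_square[symmetric] mult_ac)
  then have "Re (cnj c * (c * cinner y y)) = (cmod c)\<^sup>2 * (norm y)\<^sup>2"
    by (simp only: Re_complex_of_real)
  with eq show ?thesis
    by (simp only: cinner_self Re_complex_of_real complex_cnj) simp
qed

lemma cinner_Cauchy_Schwarz: "cmod (cinner x y) \<le> norm x * norm (y::'a::complex_hilbert)"
proof (cases "y = 0")
  case False
  \<comment> \<open>\<open>c *\<^sub>C y\<close> is the component of \<open>x\<close> along
    \<open>y\<close>, the choice that minimises the norm of the difference.\<close>
  define c where "c = cinner x y / complex_of_real ((norm y)\<^sup>2)"
  have ny: "norm y > 0" using False by simp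
  have 1: "cnj c * cinner x y = complex_of_real ((cmod (cinner x y))\<^sup>2 / (norm y)\<^sup>2)"
    by (simp add: c_def complex_norm_square[symmetric] ac_simps)
  have "cmod c = cmod (cinner x y) / (norm y)\<^sup>2"
    by (simp add: c_def norm_divide norm_power)
  then have 2: "(cmod c)\<^sup>2 * (norm y)\<^sup>2 = (cmod (cinner x y))\<^sup>2 / (norm y)\<^sup>2"
    using ny by (simp add: power2_eq_square)
  have "0 \<le> (norm (x - c *\<^sub>C y))\<^sup>2" by simp
  then have "(cmod (cinner x y))\<^sup>2 / (norm y)\<^sup>2 \<le> (norm x)\<^sup>2"
    unfolding norm_diff_scaleC_square 1 2 by simp
  then have "(cmod (cinner x y))\<^sup>2 \<le> (norm x * norm y)\<^sup>2"
    using ny by (simp add: field_simps power_mult_distrib)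
  then show ?thesis
    by (rule power2_le_imp_le) simp
qed simp

lemma bounded_bilinear_cinner:
  "bounded_bilinear (cinner :: 'a::complex_hilbert \<Rightarrow> 'a \<Rightarrow> complex)"
proof
  fix a a' b b' :: 'a and r :: real
  show "cinner (a + a') b = cinner a b + cinner a' b" by (rule cinner_add_left)
  show "cinner a (b + b') = cinner a b + cinner a b'" by (rule cinner_add_right)
  show "cinner (r *\<^sub>R a) b = r *\<^sub>R cinner a b"
    unfolding scaleC_of_real[symmetric] cinner_scaleC_left by (simp add: scaleR_conv_of_real)
  show "cinner a (r *\<^sub>R b) = r *\<^sub>R cinner a b"
    unfolding scaleC_of_real[symmetric] cinner_scaleC_right by (simp add: scaleR_conv_of_real)
  show "\<exists>K. \<forall>a b :: 'a. norm (cinner a b) \<le> norm a * norm b * K"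
    by (rule exI[of _ 1]) (simp add: cinner_Cauchy_Schwarz)
qed

lemmas tendsto_cinner [tendsto_intros] = bounded_bilinear.tendsto[OF bounded_bilinear_cinner]
lemmas continuous_on_cinner [continuous_intros] =
  bounded_bilinear.continuous_on[OF bounded_bilinear_cinner]

lemma bounded_linear_scaleC: "bounded_linear (\<lambda>x::'a::complex_hilbert. c *\<^sub>C x)"
proof (rule bounded_linear_intro[where K = "cmod c"])
  fix r and x :: 'a
  show "c *\<^sub>C (r *\<^sub>R x) = r *\<^sub>R (c *\<^sub>C x)"
    by (simp only: scaleC_of_real[symmetric] scaleC_scaleC mult.commute)
qed (simp_all add: scaleC_add_right norm_scaleC mult.commute)

lemmas tendsto_scaleC [tendsto_intros] = bounded_linear.tendsto[OF bounded_linear_scaleC]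
lemmas continuous_on_scaleC [continuous_intros] =
  bounded_linear.continuous_on[OF bounded_linear_scaleC]

lemma subspace_closure:
  assumes "cvec.subspace (S :: 'a::complex_hilbert set)"
  shows "cvec.subspace (closure S)"
  unfolding cvec.subspace_def
proof (intro conjI allI ballI)
  show "0 \<in> closure S"
    using cvec.subspace_0[OF assms] closure_subset by blast
  fix x c assume x: "x \<in> closure S"
  then obtain f where f: "\<And>n. f n \<in> S" "f \<longlonglongrightarrow> x"
    unfolding closure_sequential by blast
  show "c *\<^sub>C x \<in> closure S"
    unfolding closure_sequential
    by (intro exI[of _ "\<lambda>n. c *\<^sub>C f n"] conjI allI tendsto_scaleC f
        cvec.subspace_scale[OF assms])
  fix y assume "y \<in> closure S"
  then obtain g where g: "\<And>n. g n \<in> S" "g \<longlonglongrightarrow> y"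
    unfolding closure_sequential by blast
  show "x + y \<in> closure S"
    unfolding closure_sequential
    by (intro exI[of _ "\<lambda>n. f n + g n"] conjI allI tendsto_add f g
        cvec.subspace_add[OF assms])
qed

lemma orthogonal_closure:
  assumes "\<And>y. y \<in> S \<Longrightarrow> cinner x y = 0" "y \<in> closure S"
  shows "cinner (x::'a::complex_hilbert) y = 0"
proof -
  have "continuous_on (closure S) (cinner x)"
    by (intro continuous_intros)
  then show ?thesis
    using continuous_constant_on_closure assms by blast
qed

lemma orthogonal_dense:
  assumes "\<And>y. y \<in> S \<Longrightarrow> cinner x y = 0" "closure S = UNIV"
  shows "(x::'a::complex_hilbert) = 0"
  using orthogonal_closure[of S x x] assms by (simp add: cinner_self_eq_zero_iff)

lemma orthogonal_span:
  assumes "\<And>y. y \<in> S \<Longrightarrow> cinner x y = 0" "y \<in> cvec.span S"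
  shows "cinner (x::'a::complex_hilbert) y = 0"
  using assms(2)
  by (induction rule: cvec.span_induct_alt) (simp_all add: cinner_algebra assms(1))

lemma parallelogram:
  "(norm (x - y))\<^sup>2 + (norm (x + y))\<^sup>2 = 2 * (norm x)\<^sup>2 + 2 * (norm (y::'a::complex_hilbert))\<^sup>2"
proof -
  have "complex_of_real ((norm (x - y))\<^sup>2 + (norm (x + y))\<^sup>2) =
        complex_of_real (2 * (norm x)\<^sup>2 + 2 * (norm y)\<^sup>2)"
    unfolding of_real_add of_real_mult cinner_self[symmetric] by (simp add: cinner_algebra)
  then show ?thesis using of_real_eq_iff by blast
qed

text \<open>A minimising sequence for the distance from \<open>y\<close> to \<open>U\<close> is
  Cauchy by the parallelogram law, because midpoints stay in \<open>U\<close>; the first variation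
  at its limit vanishes.\<close>

lemma orthogonal_projection_exists:
  fixes y :: "'a::complex_hilbert"
  assumes "closed_subspace U"
  shows "\<exists>p\<in>U. \<forall>u\<in>U. cinner (y - p) u = 0"
proof -
  have sub: "cvec.subspace U" and cl: "closed U"
    using assms by (auto simp: closed_subspace_def)
  have ne: "U \<noteq> {}" using cvec.subspace_0[OF sub] by blast
  define d where "d = infdist y U"
  have d0: "d \<ge> 0" by (simp add: d_def infdist_nonneg)
  have dle: "d \<le> norm (y - u)" if "u \<in> U" for u
    using infdist_le[OF that, of y] by (simp add: d_def dist_norm)
  have "\<exists>p\<in>U. dist y p < d + 1 / (real n + 1)" for n
  proof -
    have "(INF u\<in>U. dist y u) < d + 1 / (real n + 1)"
      using ne by (simp add: d_def infdist_def)
    then show ?thesis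
      by (subst (asm) cINF_less_iff) (use ne in \<open>auto intro: bdd_belowI[of _ 0]\<close>)
  qed
  then obtain p where pU: "\<And>n. p n \<in> U" and pd: "\<And>n. dist y (p n) < d + 1 / (real n + 1)"
    by metis
  have bound: "(norm (y - p n))\<^sup>2 \<le> d\<^sup>2 + (2 * d + 1) / (real n + 1)" for n
  proof -
    \<comment> \<open>Since \<open>e \<le> 1\<close>, the term \<open>e\<^sup>2\<close> is absorbed
      into \<open>e\<close>, which makes the excess over \<open>d\<^sup>2\<close> linear in
      \<open>e\<close>.\<close>
    define e where "e = 1 / (real n + 1)"
    have e: "0 \<le> e" "e \<le> 1" by (auto simp: e_def)
    have "norm (y - p n) \<le> d + e"
      using pd[of n] by (simp add: e_def dist_norm less_imp_le)
    then have "(norm (y - p n))\<^sup>2 \<le> (d + e)\<^sup>2"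
      by (intro power_mono) auto
    also have "\<dots> \<le> d\<^sup>2 + (2 * d + 1) * e"
      using e mult_left_le[of e e] by (simp add: power2_eq_square algebra_simps)
    finally show ?thesis by (simp add: e_def)
  qed
  have diff: "(norm (p m - p n))\<^sup>2 \<le> 2 * ((2 * d + 1) / (real m + 1) + (2 * d + 1) / (real n + 1))"
    for m n
  proof -
    have mid: "(1/2) *\<^sub>C (p m + p n) \<in> U"
      by (intro cvec.subspace_scale[OF sub] cvec.subspace_add[OF sub] pU)
    have eq: "(y - p n) + (y - p m) = 2 *\<^sub>C (y - (1/2) *\<^sub>C (p m + p n))"
      using scaleC_add_left[of 1 1 y]
      by (simp add: cvec.scale_right_diff_distrib scaleC_scaleC scaleC_one)
    have "4 * d\<^sup>2 \<le> (norm ((y - p n) + (y - p m)))\<^sup>2"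
      using power_mono[OF dle[OF mid] d0, of 2] unfolding eq norm_scaleC
      by (simp add: power_mult_distrib)
    moreover have "(norm (p m - p n))\<^sup>2 + (norm ((y - p n) + (y - p m)))\<^sup>2 =
        2 * (norm (y - p n))\<^sup>2 + 2 * (norm (y - p m))\<^sup>2"
      using parallelogram[of "y - p n" "y - p m"] by simp
    moreover have "a \<le> 2 * (e1 + e2)"
      if "4 * q \<le> b" "a + b = 2 * s + 2 * t" "s \<le> q + e2" "t \<le> q + e1" for a b q s t e1 e2 :: real
      using that by argo
    ultimately show ?thesis
      using bound by blast
  qed
  have "Cauchy p"
  proof (rule CauchyI')
    fix e :: real assume e: "e > 0"
    obtain N :: nat where N: "real N > 4 * (2 * d + 1) / e\<^sup>2"
      using reals_Archimedean2 by blast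
    have small: "(2 * d + 1) / (real n + 1) < e\<^sup>2 / 4" if "n \<ge> N" for n
    proof -
      have "4 * (2 * d + 1) / e\<^sup>2 < real n + 1"
        using N that by linarith
      then show ?thesis
        using e by (simp add: field_simps)
    qed
    show "\<exists>M. \<forall>m\<ge>M. \<forall>n>m. dist (p m) (p n) < e"
    proof (intro exI[of _ N] allI impI)
      fix m n assume "m \<ge> N" "n > m"
      then have "(2 * d + 1) / (real m + 1) < e\<^sup>2 / 4" "(2 * d + 1) / (real n + 1) < e\<^sup>2 / 4"
        using small[of m] small[of n] \<open>m \<ge> N\<close> \<open>n > m\<close> by linarith+
      then have "(norm (p m - p n))\<^sup>2 < e\<^sup>2"
        using diff[of m n] by argo
      then show "dist (p m) (p n) < e"
        using e power_less_imp_less_base by (fastforce simp: dist_norm)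
    qed
  qed
  then obtain q where q: "p \<longlonglongrightarrow> q"
    using Cauchy_convergent convergent_def by blast
  have qU: "q \<in> U"
    using closed_sequentially[OF cl _ q] pU by blast
  have lim: "(\<lambda>n. d + 1 / (real n + 1)) \<longlonglongrightarrow> d + 0"
    using LIMSEQ_inverse_real_of_nat by (intro tendsto_intros) (simp add: inverse_eq_divide add.commute)
  have nq: "norm (y - q) \<le> d"
  proof (rule LIMSEQ_le)
    show "(\<lambda>n. norm (y - p n)) \<longlonglongrightarrow> norm (y - q)"
      by (intro tendsto_intros q)
    show "(\<lambda>n. d + 1 / (real n + 1)) \<longlonglongrightarrow> d" using lim by simp
    show "\<exists>N. \<forall>n\<ge>N. norm (y - p n) \<le> d + 1 / (real n + 1)"
      using pd by (auto simp: dist_norm less_imp_le)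
  qed
  have "cinner (y - q) u = 0" if u: "u \<in> U" for u
  proof (rule ccontr)
    define c where "c = cinner (y - q) u"
    assume "cinner (y - q) u \<noteq> 0"
    then have c: "c \<noteq> 0" by (simp add: c_def)
    \<comment> \<open>A step of length \<open>r\<close> in the direction
      \<open>c *\<^sub>C u\<close> would bring \<open>q\<close> closer to \<open>y\<close> as soon
      as \<open>r * (norm u)\<^sup>2 < 2\<close>; this \<open>r\<close> keeps that product at most
      1, and the summand 1 makes \<open>r\<close> positive for every \<open>u\<close>.\<close>
    define r where "r = 1 / ((norm u)\<^sup>2 + 1)"
    have r0: "r > 0" by (simp add: r_def add_nonneg_pos)
    have "q + (complex_of_real r * c) *\<^sub>C u \<in> U"
      by (intro cvec.subspace_add[OF sub] cvec.subspace_scale[OF sub] qU u)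
    from dle[OF this] nq have "norm (y - q) \<le> norm ((y - q) - (complex_of_real r * c) *\<^sub>C u)"
      by (simp add: algebra_simps)
    then have "(norm (y - q))\<^sup>2 \<le> (norm ((y - q) - (complex_of_real r * c) *\<^sub>C u))\<^sup>2"
      by (intro power_mono) auto
    moreover have "cnj (complex_of_real r * c) * cinner (y - q) u = complex_of_real (r * (cmod c)\<^sup>2)"
      by (simp add: c_def[symmetric] complex_norm_square[symmetric] ac_simps)
    moreover have "cmod (complex_of_real r * c) = r * cmod c"
      using r0 by (simp add: norm_mult)
    ultimately have "2 * (r * (cmod c)\<^sup>2) \<le> (r * cmod c)\<^sup>2 * (norm u)\<^sup>2"
      unfolding norm_diff_scaleC_square by (simp only: Re_complex_of_real)
    then have "2 * (r * (cmod c)\<^sup>2) \<le> (r * (cmod c)\<^sup>2) * (r * (norm u)\<^sup>2)"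
      by (simp add: power2_eq_square ac_simps)
    then have "2 \<le> r * (norm u)\<^sup>2"
      using r0 c by (simp add: mult.commute[of _ 2] mult_le_cancel_left)
    moreover have "r * (norm u)\<^sup>2 \<le> 1"
      by (simp add: r_def divide_le_eq add_nonneg_pos)
    ultimately show False by linarith
  qed
  with qU show ?thesis by blast
qed

lemma dense_if_orthogonal_trivial:
  fixes S :: "'a::complex_hilbert set"
  assumes "cvec.subspace S" "\<And>x. \<forall>y\<in>S. cinner x y = 0 \<Longrightarrow> x = 0"
  shows "closure S = UNIV"
proof -
  have "closed_subspace (closure S)"
    by (simp add: closed_subspace_def subspace_closure assms(1))
  then have "y \<in> closure S" for y
    using orthogonal_projection_exists[of "closure S" y] assms(2) closure_subset[of S]
    by (metis eq_iff_diff_eq_0 subsetD)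
  then show ?thesis by blast
qed

section \<open>Operators and adjoints\<close>

lemma mem_graph_iff: "(x, y) \<in> Map.graph T \<longleftrightarrow> x \<in> dom T \<and> T \<cdot> x = y"
  by (auto simp: Map.graph_def)

lemma linear_op_subspace: "linear_op T \<Longrightarrow> cvec.subspace (dom T)"
  by (simp add: linear_op_def)

lemma linear_op_add:
  "linear_op T \<Longrightarrow> x \<in> dom T \<Longrightarrow> y \<in> dom T \<Longrightarrow> x + y \<in> dom T \<and> T \<cdot> (x + y) = T \<cdot> x + T \<cdot> y"
  by (simp add: linear_op_def cvec.subspace_add)

lemma linear_op_scale:
  "linear_op T \<Longrightarrow> x \<in> dom T \<Longrightarrow> c *\<^sub>C x \<in> dom T \<and> T \<cdot> (c *\<^sub>C x) = c *\<^sub>C (T \<cdot> x)"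
  by (simp add: linear_op_def cvec.subspace_scale)

lemma linear_op_zero: "linear_op T \<Longrightarrow> 0 \<in> dom T \<and> T \<cdot> 0 = 0"
  by (metis linear_op_def cvec.subspace_0 cvec.scale_zero_left)

lemma linear_op_diff:
  assumes "linear_op T" "x \<in> dom T" "y \<in> dom T"
  shows "x - y \<in> dom T \<and> T \<cdot> (x - y) = T \<cdot> x - T \<cdot> y"
  using linear_op_add[OF assms(1,2), of "(- 1) *\<^sub>C y"] linear_op_scale[OF assms(1,3), of "- 1"]
  by (simp add: scaleC_minus_one)

lemma linear_op_graph_subspace:
  assumes "linear_op T"
  shows "cvec.subspace (Map.graph T)"
  unfolding cvec.subspace_def
proof (intro conjI allI ballI)
  show "0 \<in> Map.graph T"
    using linear_op_zero[OF assms] by (simp add: zero_prod_def mem_graph_iff)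
  fix x c assume x: "x \<in> Map.graph T"
  show "c *\<^sub>C x \<in> Map.graph T"
    using x linear_op_scale[OF assms, of "fst x" c]
    by (cases x) (simp add: mem_graph_iff scaleC_prod_def)
  fix y assume "y \<in> Map.graph T"
  then show "x + y \<in> Map.graph T"
    using x linear_op_add[OF assms, of "fst x" "fst y"]
    by (cases x, cases y) (simp add: mem_graph_iff)
qed

text \<open>Density of \<open>dom T\<close> makes the representing vector unique, so the definite
  description inside \<open>adj\<close> evaluates to it.\<close>

lemma adj_eq_SomeI:
  assumes "densely_defined T" "\<And>u. u \<in> dom T \<Longrightarrow> cinner (T \<cdot> u) v = cinner u w"
  shows "adj T v = Some w"
proof -
  have "w' = w" if "\<forall>u\<in>dom T. cinner (T \<cdot> u) v = cinner u w'" for w'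
  proof -
    have "cinner (w' - w) u = 0" if u: "u \<in> dom T" for u
      using assms(2)[OF u] that u \<open>\<forall>u\<in>dom T. cinner (T \<cdot> u) v = cinner u w'\<close>
      by (subst cinner_eq_zero_commute) (simp add: cinner_diff_right)
    then have "w' - w = 0"
      using orthogonal_dense assms(1) unfolding densely_defined_def by blast
    then show ?thesis by simp
  qed
  then have "(THE w. \<forall>u\<in>dom T. cinner (T \<cdot> u) v = cinner u w) = w"
    using assms(2) by (intro the_equality) blast+
  then show ?thesis
    using assms(2) by (auto simp: adj_def)
qed

lemma adj_cinner:
  assumes "densely_defined T" "v \<in> dom (adj T)" "u \<in> dom T"
  shows "cinner (T \<cdot> u) v = cinner u (adj T \<cdot> v)"
proof -
  obtain w where w: "\<And>u. u \<in> dom T \<Longrightarrow> cinner (T \<cdot> u) v = cinner u w"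
    using assms(2) by (auto simp: adj_def dom_def split: if_splits)
  with assms adj_eq_SomeI[OF assms(1) w] show ?thesis by simp
qed

lemma adj_cinner_swap:
  assumes "densely_defined T" "v \<in> dom (adj T)" "u \<in> dom T"
  shows "cinner (adj T \<cdot> v) u = cinner v (T \<cdot> u)"
  using adj_cinner[OF assms] by (metis cinner_commute)

lemma linear_op_adj:
  assumes "densely_defined T"
  shows "linear_op (adj T)"
proof -
  note adj = adj_cinner[OF assms]
  have zero: "0 \<in> dom (adj T)"
    using adj_eq_SomeI[OF assms, of 0 0] by (simp add: domI)
  have add: "adj T (x + y) = Some (adj T \<cdot> x + adj T \<cdot> y)"
    if "x \<in> dom (adj T)" "y \<in> dom (adj T)" for x y
    using that by (intro adj_eq_SomeI[OF assms]) (simp add: cinner_add_right adj)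
  have scale: "adj T (c *\<^sub>C x) = Some (c *\<^sub>C (adj T \<cdot> x))" if "x \<in> dom (adj T)" for c x
    using that by (intro adj_eq_SomeI[OF assms]) (simp add: cinner_scaleC_right adj)
  show ?thesis
    unfolding linear_op_def cvec.subspace_def
    using zero add scale by (auto simp: domI)
qed

lemma shift_app: "x \<in> dom T \<Longrightarrow> shift T z x = Some (T \<cdot> x - z *\<^sub>C x)"
  by (auto simp: shift_def)

lemma dom_shift [simp]: "dom (shift T z) = dom T"
  by (auto simp: shift_def dom_def)

lemma op_kernel_iff: "x \<in> op_kernel T \<longleftrightarrow> x \<in> dom T \<and> T \<cdot> x = 0"
  by (auto simp: op_kernel_def)

lemma op_kernel_shift_iff: "x \<in> op_kernel (shift T z) \<longleftrightarrow> x \<in> dom T \<and> T \<cdot> x = z *\<^sub>C x"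
  by (metis dom_shift eq_iff_diff_eq_0 op_kernel_iff option.sel shift_app)

lemma point_spectrum_iff:
  "z \<in> point_spectrum T \<longleftrightarrow> (\<exists>x\<in>dom T. x \<noteq> 0 \<and> T \<cdot> x = z *\<^sub>C x)"
  unfolding point_spectrum_def Bex_def op_kernel_shift_iff by blast

text \<open>
  By the Cauchy--Schwarz argument for the semidefinite form of \<open>B\<close>, \<open>B u\<close> is orthogonal to the
  dense domain of \<open>B\<close>.
\<close>

lemma nonnegative_op_zero:
  assumes lin: "linear_op B" and dense: "densely_defined B"
    and sym: "symmetric_op B" and nonneg: "nonnegative_op B"
    and u: "u \<in> dom B" and zero: "Re (cinner (B \<cdot> u) u) = 0"
  shows "B \<cdot> u = 0"
proof -
  have zero': "cinner (B \<cdot> u) u = 0"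
    using zero nonneg u by (simp add: nonnegative_op_def complex_eq_iff less_eq_complex_def)
  have "cinner (B \<cdot> u) w = 0" if w: "w \<in> dom B" for w
  proof (rule ccontr)
    define a where "a = cinner (B \<cdot> u) w"
    assume "cinner (B \<cdot> u) w \<noteq> 0"
    then have a: "(cmod a)\<^sup>2 > 0" by (simp add: a_def)
    define m where "m = Re (cinner (B \<cdot> w) w)"
    \<comment> \<open>With this \<open>r\<close> the form of \<open>B\<close> at
      \<open>s *\<^sub>C u + w\<close> has real part
      \<open>m - 2 * r * (cmod a)\<^sup>2 = -1\<close>, against nonnegativity.\<close>
    define r where "r = (m + 1) / (2 * (cmod a)\<^sup>2)"
    define s where "s = - (complex_of_real r * cnj a)"
    have Bwu: "cinner (B \<cdot> w) u = cnj a"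
      using sym u w unfolding symmetric_op_def a_def by (metis cinner_commute)
    have su: "s *\<^sub>C u \<in> dom B" "B \<cdot> (s *\<^sub>C u) = s *\<^sub>C (B \<cdot> u)"
      using linear_op_scale[OF lin u] by auto
    have "0 \<le> Re (cinner (B \<cdot> (s *\<^sub>C u + w)) (s *\<^sub>C u + w))"
      using nonneg linear_op_add[OF lin su(1) w]
      by (metis less_eq_complex_def nonnegative_op_def zero_complex.sel(1))
    also have "cinner (B \<cdot> (s *\<^sub>C u + w)) (s *\<^sub>C u + w) =
        s * a + cnj (s * a) + cinner (B \<cdot> w) w"
      using linear_op_add[OF lin su(1) w] su(2) zero' Bwu
      by (simp add: cinner_algebra a_def)
    also have "s * a = complex_of_real (- (r * (cmod a)\<^sup>2))"
      unfolding of_real_minus of_real_mult complex_norm_square s_def by simp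
    finally have "2 * (r * (cmod a)\<^sup>2) \<le> m"
      by (simp add: m_def)
    moreover have "2 * (r * (cmod a)\<^sup>2) = m + 1"
      using a by (simp add: r_def)
    ultimately show False by linarith
  qed
  then show ?thesis
    using orthogonal_dense dense unfolding densely_defined_def by blast
qed

section \<open>Root subspaces\<close>

text \<open>The kernel of the \<open>k\<close>-th power of \<open>T - z\<close>, unfolded from the
  inside: \<open>op_power\<close> adds the new factor on the outside, while inductions along a root
  chain apply \<open>T - z\<close> to the vector first.\<close>

primrec root_space :: "('a::complex_hilbert, 'a) operator \<Rightarrow> complex \<Rightarrow> nat \<Rightarrow> 'a set" where
  "root_space T z 0 = {0}"
| "root_space T z (Suc k) = {x \<in> dom T. T \<cdot> x - z *\<^sub>C x \<in> root_space T z k}"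

lemma op_power_Suc_right: "op_power T (Suc k) = op_power T k \<circ>\<^sub>m T"
  by (induction k) (auto simp: map_comp_def fun_eq_iff split: option.splits)

lemma op_kernel_power_shift: "op_kernel (op_power (shift T z) k) = root_space T z k"
proof (induction k)
  case 0
  show ?case by (auto simp: op_kernel_def)
next
  case (Suc k)
  have "x \<in> op_kernel (op_power (shift T z) (Suc k)) \<longleftrightarrow>
      x \<in> dom T \<and> T \<cdot> x - z *\<^sub>C x \<in> op_kernel (op_power (shift T z) k)" for x
    unfolding op_power_Suc_right op_kernel_def
    by (cases "T x") (auto simp: map_comp_def shift_def)
  with Suc.IH show ?case by auto
qed

lemma root_subspace_eq: "root_subspace T z = (\<Union>k. root_space T z k)"
  by (simp add: root_subspace_def op_kernel_power_shift)

lemma root_space_mono_Suc: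
  assumes "linear_op T"
  shows "root_space T z k \<subseteq> root_space T z (Suc k)"
  by (induction k) (use linear_op_zero[OF assms] in auto)

lemma root_space_mono:
  assumes "linear_op T" "k \<le> m"
  shows "root_space T z k \<subseteq> root_space T z m"
  using lift_Suc_mono_le[of "root_space T z"] root_space_mono_Suc[OF assms(1)] assms(2) by blast

lemma subspace_root_space:
  assumes T: "linear_op T"
  shows "cvec.subspace (root_space T z k)"
proof (induction k)
  case (Suc k)
  show ?case
    unfolding cvec.subspace_def
  proof (intro conjI allI ballI)
    show "0 \<in> root_space T z (Suc k)"
      using linear_op_zero[OF T] cvec.subspace_0[OF Suc] by simp
    fix x c assume x: "x \<in> root_space T z (Suc k)"
    show "c *\<^sub>C x \<in> root_space T z (Suc k)"
      using x cvec.subspace_scale[OF Suc, of "T \<cdot> x - z *\<^sub>C x" c] linear_op_scale[OF T, of x c]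
      by (simp add: cvec.scale_right_diff_distrib scaleC_scaleC mult.commute)
    fix y assume "y \<in> root_space T z (Suc k)"
    then show "x + y \<in> root_space T z (Suc k)"
      using x cvec.subspace_add[OF Suc, of "T \<cdot> x - z *\<^sub>C x" "T \<cdot> y - z *\<^sub>C y"]
        linear_op_add[OF T, of x y]
      by (simp add: scaleC_add_right algebra_simps)
  qed
qed simp

lemma subspace_root_subspace:
  assumes T: "linear_op T"
  shows "cvec.subspace (root_subspace T z)"
  unfolding cvec.subspace_def root_subspace_eq
proof (intro conjI allI ballI)
  note sub = subspace_root_space[OF T]
  show "0 \<in> (\<Union>k. root_space T z k)"
    using cvec.subspace_0[OF sub] by blast
  fix x c assume "x \<in> (\<Union>k. root_space T z k)"
  then obtain k where x: "x \<in> root_space T z k" by blast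
  then show "c *\<^sub>C x \<in> (\<Union>k. root_space T z k)"
    using cvec.subspace_scale[OF sub] by blast
  fix y assume "y \<in> (\<Union>k. root_space T z k)"
  then obtain m where "y \<in> root_space T z m" by blast
  then have "x \<in> root_space T z (max k m)" "y \<in> root_space T z (max k m)"
    using x root_space_mono[OF T, of _ "max k m" z] by (meson max.cobounded1 max.cobounded2 subsetD)+
  then show "x + y \<in> (\<Union>k. root_space T z k)"
    using cvec.subspace_add[OF sub] by blast
qed

lemma root_subspace_dom:
  assumes "linear_op T"
  shows "root_subspace T z \<subseteq> dom T"
proof -
  have "root_space T z k \<subseteq> dom T" for k
    using root_space_mono_Suc[OF assms, of z k] by auto
  then show ?thesis by (auto simp: root_subspace_eq)
qed

lemma root_subspace_step_iff:
  assumes "linear_op T" "x \<in> dom T"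
  shows "T \<cdot> x - z *\<^sub>C x \<in> root_subspace T z \<longleftrightarrow> x \<in> root_subspace T z"
proof
  assume "T \<cdot> x - z *\<^sub>C x \<in> root_subspace T z"
  then obtain k where "x \<in> root_space T z (Suc k)"
    using assms(2) by (auto simp: root_subspace_eq)
  then show "x \<in> root_subspace T z" unfolding root_subspace_eq by blast
next
  assume "x \<in> root_subspace T z"
  then obtain k where "x \<in> root_space T z k" by (auto simp: root_subspace_eq)
  then have "x \<in> root_space T z (Suc k)" using root_space_mono_Suc[OF assms(1)] by blast
  then show "T \<cdot> x - z *\<^sub>C x \<in> root_subspace T z" by (auto simp: root_subspace_eq)
qed

lemma root_subspace_invariant:
  assumes "linear_op T" "x \<in> root_subspace T z"
  shows "T \<cdot> x \<in> root_subspace T z"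
proof -
  have "x \<in> dom T" using assms root_subspace_dom by blast
  then have "T \<cdot> x - z *\<^sub>C x \<in> root_subspace T z"
    using root_subspace_step_iff assms by blast
  moreover have "z *\<^sub>C x \<in> root_subspace T z"
    using cvec.subspace_scale[OF subspace_root_subspace] assms by blast
  ultimately show ?thesis
    using cvec.subspace_add[OF subspace_root_subspace[OF assms(1)]] by fastforce
qed

definition invariant_subspace :: "('a::complex_hilbert, 'a) operator \<Rightarrow> 'a set \<Rightarrow> bool" where
  "invariant_subspace T W \<longleftrightarrow> cvec.subspace W \<and> W \<subseteq> dom T \<and> (\<forall>x\<in>W. T \<cdot> x \<in> W)"

lemma invariant_subspace_root_subspace:
  "linear_op T \<Longrightarrow> invariant_subspace T (root_subspace T z)"
  unfolding invariant_subspace_def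
  by (simp add: subspace_root_subspace root_subspace_dom root_subspace_invariant)

text \<open>On root vectors of \<open>z\<close>, \<open>T - a\<close> is the nonzero scalar
  \<open>z - a\<close> plus a locally nilpotent part, hence onto. In the induction, if
  \<open>(T - a) y = (T - z) x\<close>, then \<open>(x - y) / (z - a)\<close> is a preimage of
  \<open>x\<close>. The subspace \<open>W\<close> is carried along so that preimages stay inside a
  given summand.\<close>

lemma root_subspace_surj:
  assumes T: "linear_op T" and W: "invariant_subspace T W"
    and x: "x \<in> root_subspace T z" "x \<in> W" and ne: "a \<noteq> z"
  shows "\<exists>y\<in>root_subspace T z \<inter> W. T \<cdot> y - a *\<^sub>C y = x"
proof -
  have sub: "cvec.subspace (root_subspace T z \<inter> W)"
    using W subspace_root_subspace[OF T] by (simp add: invariant_subspace_def cvec.subspace_inter)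
  have "x \<in> root_space T z k \<Longrightarrow> x \<in> W \<Longrightarrow> \<exists>y\<in>root_subspace T z \<inter> W. T \<cdot> y - a *\<^sub>C y = x" for k
  proof (induction k arbitrary: x)
    case 0
    then show ?case
      using cvec.subspace_0[OF sub] linear_op_zero[OF T] by (intro bexI[of _ 0]) auto
  next
    case (Suc k)
    define w where "w = T \<cdot> x - z *\<^sub>C x"
    have xr: "x \<in> root_subspace T z" using Suc.prems(1) unfolding root_subspace_eq by blast
    have xd: "x \<in> dom T" using Suc.prems by auto
    have "w \<in> W"
      using W Suc.prems(2) unfolding w_def invariant_subspace_def
      by (intro cvec.subspace_diff cvec.subspace_scale) auto
    then obtain y where y: "y \<in> root_subspace T z \<inter> W" "T \<cdot> y - a *\<^sub>C y = w"
      using Suc.IH[of w] Suc.prems by (auto simp: w_def)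
    have yd: "y \<in> dom T" using y root_subspace_dom[OF T] by blast
    define c where "c = inverse (z - a)"
    have c: "c * (z - a) = 1" using ne by (simp add: c_def)
    show ?case
    proof (intro bexI[of _ "c *\<^sub>C (x - y)"])
      show "c *\<^sub>C (x - y) \<in> root_subspace T z \<inter> W"
        using xr Suc.prems y by (intro cvec.subspace_scale[OF sub] cvec.subspace_diff[OF sub]) auto
      have "T \<cdot> (c *\<^sub>C (x - y)) = c *\<^sub>C (T \<cdot> x - T \<cdot> y)"
        using linear_op_diff[OF T xd yd] linear_op_scale[OF T, of "x - y" c] by simp
      also have "T \<cdot> x = w + z *\<^sub>C x" by (simp add: w_def)
      also have "T \<cdot> y = w + a *\<^sub>C y" using y(2) by (simp add: algebra_simps)
      finally have "T \<cdot> (c *\<^sub>C (x - y)) - a *\<^sub>C c *\<^sub>C (x - y) = (c * (z - a)) *\<^sub>C x"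
        by (simp add: cvec.scale_right_diff_distrib cvec.scale_left_diff_distrib
            scaleC_scaleC right_diff_distrib mult.commute)
      then show "T \<cdot> (c *\<^sub>C (x - y)) - a *\<^sub>C c *\<^sub>C (x - y) = x"
        by (simp add: c scaleC_one)
    qed
  qed
  then show ?thesis using x by (auto simp: root_subspace_eq)
qed

text \<open>The last nonzero vector of the chain \<open>x\<close>, \<open>(T - z) x\<close>, ... is
  an eigenvector, and the chain never leaves \<open>W\<close>.\<close>

lemma root_subspace_eigenvector:
  assumes T: "linear_op T" and W: "invariant_subspace T W"
    and x: "x \<in> root_subspace T z" "x \<in> W" "x \<noteq> 0"
  shows "\<exists>y\<in>W. y \<noteq> 0 \<and> T \<cdot> y = z *\<^sub>C y"
proof -
  have "x \<in> root_space T z k \<Longrightarrow> x \<in> W \<Longrightarrow> x \<noteq> 0 \<Longrightarrow> \<exists>y\<in>W. y \<noteq> 0 \<and> T \<cdot> y = z *\<^sub>C y" for k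
  proof (induction k arbitrary: x)
    case (Suc k)
    have "T \<cdot> x - z *\<^sub>C x \<in> W"
      using W Suc.prems(2) unfolding invariant_subspace_def
      by (intro cvec.subspace_diff cvec.subspace_scale) auto
    then show ?case
      using Suc.IH[of "T \<cdot> x - z *\<^sub>C x"] Suc.prems by (cases "T \<cdot> x - z *\<^sub>C x = 0") auto
  qed simp
  then show ?thesis using x by (auto simp: root_subspace_eq)
qed

lemma root_subspace_trivial:
  assumes "linear_op T" "z \<notin> point_spectrum T"
  shows "root_subspace T z = {0}"
proof -
  have "x = 0" if "x \<in> root_subspace T z" for x
    using root_subspace_eigenvector[OF assms(1) invariant_subspace_root_subspace[OF assms(1)] that that]
      assms(2) root_subspace_dom[OF assms(1)] unfolding point_spectrum_iff by blast
  then show ?thesis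
    using cvec.subspace_0[OF subspace_root_subspace[OF assms(1)]] by blast
qed

section \<open>Polynomials in an operator and root decompositions of finite-dimensional invariant
  subspaces\<close>

text \<open>A Horner scheme that treats \<open>T\<close> as a total function; it is
  \<open>p(T)\<close> only at vectors whose orbit stays in \<open>dom T\<close>, and the lemmas that
  need this work inside an invariant subspace.\<close>

definition poly_op :: "complex poly \<Rightarrow> ('a::complex_hilbert, 'a) operator \<Rightarrow> 'a \<Rightarrow> 'a" where
  "poly_op p T = fold_coeffs (\<lambda>a f x. a *\<^sub>C x + f (T \<cdot> x)) p (\<lambda>x. 0)"

lemma poly_op_0 [simp]: "poly_op 0 T x = 0"
  by (simp add: poly_op_def)

lemma poly_op_pCons:
  assumes "linear_op T" shows "poly_op (pCons a p) T x = a *\<^sub>C x + poly_op p T (T \<cdot> x)"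
  by (cases "p = 0 \<and> a = 0") (auto simp: poly_op_def)

lemma poly_op_diff:
  assumes T: "linear_op T"
  shows "poly_op (p - q) T x = poly_op p T x - poly_op q T x"
  by (induction p q arbitrary: x rule: poly_induct2)
    (simp_all add: poly_op_pCons[OF T] cvec.scale_left_diff_distrib)

lemma poly_op_smult:
  assumes T: "linear_op T"
  shows "poly_op (smult c p) T x = c *\<^sub>C poly_op p T x"
  by (induction p arbitrary: x) (simp_all add: poly_op_pCons[OF T] scaleC_add_right scaleC_scaleC)

lemma poly_op_arg_diff:
  assumes T: "linear_op T" and W: "invariant_subspace T W" and xy: "x \<in> W" "y \<in> W"
  shows "poly_op p T (x - c *\<^sub>C y) = poly_op p T x - c *\<^sub>C poly_op p T y"
  using xy
proof (induction p arbitrary: x y)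
  case (pCons a p)
  have "x \<in> dom T" "y \<in> dom T" using W pCons.prems by (auto simp: invariant_subspace_def)
  then have "T \<cdot> (x - c *\<^sub>C y) = T \<cdot> x - c *\<^sub>C (T \<cdot> y)"
    using linear_op_diff[OF T, of x "c *\<^sub>C y"] linear_op_scale[OF T, of y c] by simp
  then show ?case
    using pCons W by (simp add: poly_op_pCons[OF T] invariant_subspace_def
        cvec.scale_right_diff_distrib scaleC_add_right scaleC_scaleC mult.commute)
qed simp

lemma poly_op_root_factor:
  assumes T: "linear_op T" and W: "invariant_subspace T W" and x: "x \<in> W"
  shows "poly_op ([:- a, 1:] * q) T x = poly_op q T (T \<cdot> x - a *\<^sub>C x)"
proof -
  have "[:- a, 1:] * q = pCons 0 q - smult a q" by simp
  then have "poly_op ([:- a, 1:] * q) T x = poly_op q T (T \<cdot> x) - a *\<^sub>C poly_op q T x"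
    by (simp only: poly_op_diff[OF T] poly_op_smult[OF T] poly_op_pCons[OF T]) simp
  moreover have "T \<cdot> x \<in> W" using W x by (simp add: invariant_subspace_def)
  ultimately show ?thesis using poly_op_arg_diff[OF T W _ x] by simp
qed

text \<open>The equation \<open>(T - a) y = w\<close> is solved modulo the root subspace of
  \<open>a\<close>: components of \<open>w\<close> for \<open>z \<noteq> a\<close> have exact
  preimages, and a component for \<open>a\<close> itself is answered by 0 and left as the
  error.\<close>

lemma root_span_preimage:
  assumes T: "linear_op T" and W: "invariant_subspace T W"
    and w: "w \<in> cvec.span (\<Union>z. root_subspace T z \<inter> W)"
  shows "\<exists>y\<in>cvec.span (\<Union>z. root_subspace T z \<inter> W). T \<cdot> y - a *\<^sub>C y - w \<in> root_subspace T a"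
  using w
proof (induction rule: cvec.span_induct_alt)
  case base
  show ?case
    using linear_op_zero[OF T] cvec.subspace_0[OF subspace_root_subspace[OF T]]
    by (intro bexI[of _ 0]) (auto simp: cvec.span_zero)
next
  case (step c x w)
  let ?S = "\<Union>z. root_subspace T z \<inter> W"
  have Sd: "cvec.span ?S \<subseteq> dom T"
    using root_subspace_dom[OF T] linear_op_subspace[OF T] by (intro cvec.span_minimal) auto
  obtain y where y: "y \<in> cvec.span ?S" "T \<cdot> y - a *\<^sub>C y - w \<in> root_subspace T a"
    using step by blast
  obtain z where z: "x \<in> root_subspace T z" "x \<in> W" using step by blast
  have "\<exists>v\<in>cvec.span ?S. T \<cdot> v - a *\<^sub>C v - x \<in> root_subspace T a"
  proof (cases "z = a")
    case True
    then have "T \<cdot> 0 - a *\<^sub>C 0 - x \<in> root_subspace T a"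
      using linear_op_zero[OF T] z cvec.subspace_neg[OF subspace_root_subspace[OF T]] by simp
    then show ?thesis using cvec.span_zero by blast
  next
    case False
    then obtain v where "v \<in> root_subspace T z \<inter> W" "T \<cdot> v - a *\<^sub>C v = x"
      using root_subspace_surj[OF T W z, of a] by blast
    then show ?thesis
      using cvec.subspace_0[OF subspace_root_subspace[OF T]]
      by (intro bexI[of _ v]) (auto intro: cvec.span_base)
  qed
  then obtain v where v: "v \<in> cvec.span ?S" "T \<cdot> v - a *\<^sub>C v - x \<in> root_subspace T a" by blast
  have d: "v \<in> dom T" "y \<in> dom T" "c *\<^sub>C v \<in> dom T"
    using v y Sd linear_op_scale[OF T] by blast+
  have "T \<cdot> (c *\<^sub>C v + y) - a *\<^sub>C (c *\<^sub>C v + y) - (c *\<^sub>C x + w) =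
      c *\<^sub>C (T \<cdot> v - a *\<^sub>C v - x) + (T \<cdot> y - a *\<^sub>C y - w)"
    using linear_op_add[OF T d(3,2)] linear_op_scale[OF T d(1), of c]
    by (simp add: cvec.scale_right_diff_distrib scaleC_add_right scaleC_scaleC mult.commute)
  moreover have "\<dots> \<in> root_subspace T a"
    using v y by (intro cvec.subspace_add cvec.subspace_scale subspace_root_subspace[OF T])
  moreover have "c *\<^sub>C v + y \<in> cvec.span ?S"
    using v y by (intro cvec.span_add cvec.span_scale)
  ultimately show ?case by metis
qed

text \<open>Induction on the degree, splitting off a linear factor with root \<open>a\<close>. The
  vector \<open>(T - a) x\<close> is killed by the cofactor, so it is a sum of root vectors; a
  preimage \<open>y\<close> of it modulo the root subspace of \<open>a\<close> differs from
  \<open>x\<close> only by a root vector of \<open>a\<close>.\<close>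

lemma poly_op_kernel_root_span:
  assumes T: "linear_op T" and W: "invariant_subspace T W"
  shows "p \<noteq> 0 \<Longrightarrow> x \<in> W \<Longrightarrow> poly_op p T x = 0 \<Longrightarrow>
    x \<in> cvec.span (\<Union>z. root_subspace T z \<inter> W)"
proof (induction "degree p" arbitrary: p x)
  case 0
  then obtain c where "p = [:c:]" "c \<noteq> 0"
    by (metis degree_eq_zeroE pCons_0_0)
  with 0 show ?case
    by (simp add: poly_op_pCons[OF T] cvec.span_zero)
next
  case (Suc n)
  let ?S = "\<Union>z. root_subspace T z \<inter> W"
  obtain a where "poly p a = 0"
    using Fundamental_Theorem_Algebra.fundamental_theorem_of_algebra[of p] Suc.hyps(2)
    by (metis constant_degree nat.distinct(1))
  then obtain q where q: "p = [:- a, 1:] * q" by (auto simp: poly_eq_0_iff_dvd)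
  with Suc.prems have q0: "q \<noteq> 0" by auto
  have dq: "degree q = n"
    using Suc.hyps(2) degree_mult_eq[of "[:- a, 1:]" q] q0 q by simp
  have W': "cvec.subspace W" "x \<in> dom T" "T \<cdot> x \<in> W"
    using W Suc.prems by (auto simp: invariant_subspace_def)
  have xW: "T \<cdot> x - a *\<^sub>C x \<in> W"
    using W' Suc.prems by (intro cvec.subspace_diff cvec.subspace_scale)
  have "T \<cdot> x - a *\<^sub>C x \<in> cvec.span ?S"
    using Suc.hyps(1)[OF dq[symmetric] q0 xW] Suc.prems poly_op_root_factor[OF T W] q by simp
  then obtain y where y: "y \<in> cvec.span ?S"
      "T \<cdot> y - a *\<^sub>C y - (T \<cdot> x - a *\<^sub>C x) \<in> root_subspace T a"
    using root_span_preimage[OF T W] by blast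
  have "?S \<subseteq> W" by blast
  then have yW: "y \<in> W" using y(1) cvec.span_minimal[OF _ W'(1)] by blast
  then have yd: "y \<in> dom T" using W by (auto simp: invariant_subspace_def)
  have "T \<cdot> (y - x) = T \<cdot> y - T \<cdot> x"
    using linear_op_diff[OF T yd W'(2)] by blast
  then have "T \<cdot> (y - x) - a *\<^sub>C (y - x) = T \<cdot> y - a *\<^sub>C y - (T \<cdot> x - a *\<^sub>C x)"
    by (simp add: cvec.scale_right_diff_distrib)
  then have "T \<cdot> (y - x) - a *\<^sub>C (y - x) \<in> root_subspace T a"
    using y(2) by metis
  then have "y - x \<in> root_subspace T a"
    using root_subspace_step_iff[OF T] linear_op_diff[OF T yd W'(2)] by blast
  then have "y - x \<in> cvec.span ?S"
    using yW Suc.prems cvec.subspace_diff[OF W'(1)] by (blast intro: cvec.span_base)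
  then have "y - (y - x) \<in> cvec.span ?S" using y(1) cvec.span_diff by blast
  then show ?case by simp
qed

text \<open>The vectors \<open>x\<close>, \<open>T x\<close>, ... up to the power
  \<open>card E\<close> are one more than the dimension allows; the coefficients of a linear
  relation among them form the polynomial.\<close>

lemma exists_annihilating_poly:
  assumes T: "linear_op T" and W: "invariant_subspace T W" and x: "x \<in> W"
    and E: "finite E" "W \<subseteq> cvec.span E"
  shows "\<exists>p. p \<noteq> 0 \<and> poly_op p T x = 0"
proof -
  define f where "f k = ((\<lambda>y. T \<cdot> y) ^^ k) x" for k
  have fW: "f k \<in> W" for k
    by (induction k) (use x W in \<open>auto simp: f_def invariant_subspace_def\<close>)
  have monom: "poly_op (monom c k) T x = c *\<^sub>C f k" for c k
  proof -
    have "poly_op (monom c k) T y = c *\<^sub>C ((\<lambda>y. T \<cdot> y) ^^ k) y" for y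
      by (induction k arbitrary: y)
        (simp_all add: monom_0 monom_Suc poly_op_pCons[OF T] funpow_swap1[of "\<lambda>y. T \<cdot> y"])
    then show ?thesis by (simp add: f_def)
  qed
  show ?thesis
  \<comment> \<open>Dependence is a property of sets, so a repetition in the orbit would go
    unnoticed by the dimension count; it is turned directly into the difference of two
    monomials.\<close>
  proof (cases "inj_on f {..card E}")
    case False
    then obtain i j where ij: "i \<noteq> j" "f i = f j" by (auto simp: inj_on_def)
    have "coeff (monom 1 i - monom (1::complex) j) i \<noteq> 0" using ij by simp
    then have "monom 1 i - monom (1::complex) j \<noteq> 0" by (metis coeff_0)
    moreover have "poly_op (monom 1 i - monom 1 j) T x = 0"
      by (simp add: poly_op_diff[OF T] monom ij)
    ultimately show ?thesis by blast
  next
    case True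
    let ?F = "f ` {..card E}"
    have "card ?F = Suc (card E)" using card_image[OF True] by simp
    then have "cvec.dependent ?F"
      using cvec.independent_span_bound[OF E(1), of ?F] fW E(2) by auto
    then obtain u v where u: "v \<in> ?F" "u v \<noteq> 0" "(\<Sum>v\<in>?F. u v *\<^sub>C v) = 0"
      using cvec.dependent_finite[of ?F] by auto
    define p where "p = (\<Sum>k\<le>card E. monom (u (f k)) k)"
    have sum: "poly_op (\<Sum>k\<le>n. monom (c k) k) T x = (\<Sum>k\<le>n. c k *\<^sub>C f k)" for c n
    proof (induction n)
      case (Suc n)
      have "poly_op (a + b) T x = poly_op a T x + poly_op b T x" for a b
        using poly_op_diff[OF T, of "a + b" b x] by (simp add: algebra_simps)
      with Suc show ?case by (simp add: monom)
    qed (simp add: monom)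
    obtain i where i: "i \<le> card E" "v = f i" using u(1) by blast
    have "coeff p i = u v" using i by (simp add: p_def coeff_sum)
    then have "p \<noteq> 0" using u(2) by auto
    moreover have "poly_op p T x = 0"
      using u(3) by (simp add: p_def sum sum.reindex[OF True])
    ultimately show ?thesis by blast
  qed
qed

lemma invariant_subspace_root_span:
  assumes "linear_op T" "invariant_subspace T W" "finite E" "W \<subseteq> cvec.span E"
  shows "W \<subseteq> cvec.span (\<Union>z. root_subspace T z \<inter> W)"
  using exists_annihilating_poly[OF assms(1,2) _ assms(3,4)] poly_op_kernel_root_span[OF assms(1,2)]
  by blast

section \<open>Projections of a Riesz basis of subspaces\<close>

definition orth_proj :: "'a::complex_hilbert set \<Rightarrow> 'a \<Rightarrow> 'a" where
  "orth_proj U y = (SOME p. p \<in> U \<and> (\<forall>u\<in>U. cinner (y - p) u = 0))"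

lemma orth_proj:
  assumes "closed_subspace U"
  shows "orth_proj U y \<in> U" "u \<in> U \<Longrightarrow> cinner (y - orth_proj U y) u = 0"
  using someI_ex[of "\<lambda>p. p \<in> U \<and> (\<forall>u\<in>U. cinner (y - p) u = 0)"]
    orthogonal_projection_exists[OF assms, of y]
  unfolding orth_proj_def by blast+

lemma orth_proj_eqI:
  assumes U: "closed_subspace U" and p: "p \<in> U" "\<And>u. u \<in> U \<Longrightarrow> cinner (y - p) u = 0"
  shows "orth_proj U y = p"
proof -
  let ?q = "orth_proj U y"
  have "?q - p \<in> U"
    using U p orth_proj(1)[OF U] by (simp add: closed_subspace_def cvec.subspace_diff)
  then have "cinner (y - p) (?q - p) = 0" "cinner (y - ?q) (?q - p) = 0"
    using p(2) orth_proj(2)[OF U] by blast+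
  then have "cinner ((y - p) - (y - ?q)) (?q - p) = 0"
    by (simp only: cinner_diff_left) simp
  then have "cinner (?q - p) (?q - p) = 0" by simp
  then show ?thesis by (simp add: cinner_self_eq_zero_iff)
qed

lemma pythagoras:
  assumes "cinner x y = 0"
  shows "(norm (x + y))\<^sup>2 = (norm x)\<^sup>2 + (norm (y::'a::complex_hilbert))\<^sup>2"
  using norm_diff_scaleC_square[of x "- 1" y] assms by (simp add: scaleC_minus_one)

lemma norm_orth_proj:
  assumes "closed_subspace U"
  shows "norm (orth_proj U y) \<le> norm y"
proof -
  have "(norm y)\<^sup>2 = (norm (y - orth_proj U y))\<^sup>2 + (norm (orth_proj U y))\<^sup>2"
    using pythagoras[of "y - orth_proj U y" "orth_proj U y"] orth_proj[OF assms] by simp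
  then have "(norm (orth_proj U y))\<^sup>2 \<le> (norm y)\<^sup>2" by simp
  then show ?thesis by (rule power2_le_imp_le) simp
qed

lemma orth_proj_add:
  assumes U: "closed_subspace U"
  shows "orth_proj U (x + y) = orth_proj U x + orth_proj U y"
proof (rule orth_proj_eqI[OF U])
  show "orth_proj U x + orth_proj U y \<in> U"
    using U by (simp add: closed_subspace_def cvec.subspace_add orth_proj[OF U])
  show "cinner (x + y - (orth_proj U x + orth_proj U y)) u = 0" if "u \<in> U" for u
    using orth_proj(2)[OF U that, of x] orth_proj(2)[OF U that, of y] by (simp add: cinner_algebra)
qed

lemma orth_proj_scaleC:
  assumes U: "closed_subspace U"
  shows "orth_proj U (c *\<^sub>C x) = c *\<^sub>C orth_proj U x"
proof (rule orth_proj_eqI[OF U])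
  show "c *\<^sub>C orth_proj U x \<in> U"
    using U by (simp add: closed_subspace_def cvec.subspace_scale orth_proj[OF U])
  show "cinner (c *\<^sub>C x - c *\<^sub>C orth_proj U x) u = 0" if "u \<in> U" for u
    using orth_proj(2)[OF U that, of x] by (simp add: cinner_algebra)
qed

lemma orth_proj_id: "closed_subspace U \<Longrightarrow> x \<in> U \<Longrightarrow> orth_proj U x = x"
  by (rule orth_proj_eqI) simp_all

lemma orth_proj_orthogonal:
  "closed_subspace U \<Longrightarrow> (\<And>u. u \<in> U \<Longrightarrow> cinner x u = 0) \<Longrightarrow> orth_proj U x = 0"
  by (rule orth_proj_eqI) (simp_all add: closed_subspace_def cvec.subspace_0)

text \<open>
  The orthogonal projection onto finitely many summands is a best approximation, so it is at
  least as close to \<open>y\<close> as any given element of the algebraic sum.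
\<close>

lemma closure_span_orth_proj:
  fixes E :: "nat \<Rightarrow> 'a::complex_hilbert set"
  assumes E: "\<And>k. closed_subspace (E k)"
    and orth: "\<And>j k x y. j \<noteq> k \<Longrightarrow> x \<in> E j \<Longrightarrow> y \<in> E k \<Longrightarrow> cinner x y = 0"
    and dense: "closure (algebraic_sum UNIV E) = UNIV"
  shows "y \<in> closure (cvec.span (range (\<lambda>k. orth_proj (E k) y)))"
  unfolding closure_approachable
proof (intro allI impI)
  fix e :: real assume "e > 0"
  then obtain z where z: "z \<in> algebraic_sum UNIV E" "dist z y < e"
    using dense closure_approachable by blast
  have "\<exists>n. z \<in> cvec.span (\<Union>k<n. E k)"
    using z(1) unfolding algebraic_sum_def
  proof (induction rule: cvec.span_induct_alt)
    case base
    then show ?case by (auto intro: cvec.span_zero)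
  next
    case (step c x w)
    then obtain k n where "x \<in> E k" "w \<in> cvec.span (\<Union>k<n. E k)" by blast
    moreover have "E k \<subseteq> (\<Union>j<max n (Suc k). E j)" "(\<Union>k<n. E k) \<subseteq> (\<Union>j<max n (Suc k). E j)"
      by (rule UN_upper, simp, rule UN_mono) auto
    ultimately have "x \<in> cvec.span (\<Union>j<max n (Suc k). E j)" "w \<in> cvec.span (\<Union>j<max n (Suc k). E j)"
      using cvec.span_mono cvec.span_base by blast+
    then show ?case by (blast intro: cvec.span_add cvec.span_scale)
  qed
  then obtain n where n: "z \<in> cvec.span (\<Union>k<n. E k)" ..
  define p where "p = (\<Sum>k<n. orth_proj (E k) y)"
  have sum_orth: "cinner (\<Sum>k\<in>F. orth_proj (E k) y) u = (if j \<in> F then cinner (orth_proj (E j) y) u else 0)"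
    if "u \<in> E j" "finite F" for F j u
    using that(2)
  proof (induction F rule: finite_induct)
    case (insert i F)
    then show ?case
      using orth[OF _ orth_proj(1)[OF E] that(1), of i] by (auto simp: cinner_add_left)
  qed simp
  have yp: "cinner (y - p) u = 0" if "u \<in> cvec.span (\<Union>k<n. E k)" for u
  proof (rule orthogonal_span[OF _ that])
    fix u assume "u \<in> (\<Union>k<n. E k)"
    then obtain j where "j < n" "u \<in> E j" by blast
    then show "cinner (y - p) u = 0"
      using orth_proj(2)[OF E, of u j y] sum_orth[of u j "{..<n}"]
      by (simp add: p_def cinner_diff_left)
  qed
  have pspan: "p \<in> cvec.span (\<Union>k<n. E k)"
    unfolding p_def using orth_proj(1)[OF E] by (intro cvec.span_sum cvec.span_base) blast
  have "(norm ((y - p) + (p - z)))\<^sup>2 = (norm (y - p))\<^sup>2 + (norm (p - z))\<^sup>2"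
    by (rule pythagoras) (rule yp, intro cvec.span_diff pspan n)
  then have "(norm (y - p))\<^sup>2 \<le> (norm (y - z))\<^sup>2" by simp
  then have "norm (y - p) \<le> norm (y - z)" by (rule power2_le_imp_le) simp
  then have "dist p y < e" using z(2) by (simp add: dist_norm norm_minus_commute)
  moreover have "p \<in> cvec.span (range (\<lambda>k. orth_proj (E k) y))"
    unfolding p_def by (intro cvec.span_sum cvec.span_base) blast
  ultimately show "\<exists>p\<in>cvec.span (range (\<lambda>k. orth_proj (E k) y)). dist p y < e" by blast
qed

text \<open>The oblique projections belonging to the decomposition. The last conjunct is a weak form
  of the expansion of \<open>x\<close> into the sum of all \<open>P k x\<close>: it says just enough
  to place \<open>x\<close> in every closed subspace that contains all its components.\<close>

definition riesz_projections ::
  "(nat \<Rightarrow> 'a::complex_hilbert set) \<Rightarrow> (nat \<Rightarrow> 'a \<Rightarrow> 'a) \<Rightarrow> bool" where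
  "riesz_projections V P \<longleftrightarrow>
     (\<forall>k. closed_subspace (V k) \<and> bounded_linear (P k) \<and> range (P k) \<subseteq> V k)
     \<and> (\<forall>k c x. P k (c *\<^sub>C x) = c *\<^sub>C P k x)
     \<and> (\<forall>k. \<forall>x\<in>V k. P k x = x)
     \<and> (\<forall>j k. j \<noteq> k \<longrightarrow> (\<forall>x\<in>V j. P k x = 0))
     \<and> (\<forall>x. x \<in> closure (cvec.span (range (\<lambda>k. P k x))))"

text \<open>Conjugating the orthogonal projections onto the images of the \<open>V k\<close> by the
  isomorphism; continuity of the inverse transports the approximation from the orthogonal
  picture.\<close>

lemma exists_riesz_projections:
  fixes V :: "nat \<Rightarrow> 'a::complex_hilbert set"
  assumes "riesz_basis V"
  shows "\<exists>P. riesz_projections V P"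
proof -
  have V: "closed_subspace (V k)" for k
    using assms by (simp add: riesz_basis_def)
  obtain \<Phi> where \<Phi>: "isomorphism \<Phi>"
    and orth': "\<forall>j k. j \<noteq> k \<longrightarrow> (\<forall>x\<in>\<Phi> ` V j. \<forall>y\<in>\<Phi> ` V k. cinner x y = 0)"
    and dense: "closure (algebraic_sum UNIV (\<lambda>k. \<Phi> ` V k)) = UNIV"
    using assms unfolding riesz_basis_def by (elim conjE exE) (rule that)
  have orth: "cinner x y = 0" if "j \<noteq> k" "x \<in> \<Phi> ` V j" "y \<in> \<Phi> ` V k" for j k x y
    using orth' that by blast
  define \<Psi> where "\<Psi> = inv \<Phi>"
  have lin: "Vector_Spaces.linear scaleC scaleC \<Phi>" and bij: "bij \<Phi>"
    and bl: "bounded_linear \<Phi>" and bl': "bounded_linear \<Psi>"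
    using \<Phi> by (auto simp: isomorphism_def \<Psi>_def)
  have \<Psi>\<Phi> [simp]: "\<Psi> (\<Phi> x) = x" and \<Phi>\<Psi> [simp]: "\<Phi> (\<Psi> x) = x" for x
    using bij by (simp_all add: \<Psi>_def bij_is_inj bij_is_surj surj_f_inv_f)
  have add: "\<Phi> (x + y) = \<Phi> x + \<Phi> y" and scale: "\<Phi> (c *\<^sub>C x) = c *\<^sub>C \<Phi> x" for x y c
    using lin by (simp_all add: Vector_Spaces.linear_iff)
  have scale': "\<Psi> (c *\<^sub>C x) = c *\<^sub>C \<Psi> x" for x c
    by (metis scale \<Phi>\<Psi> \<Psi>\<Phi>)
  \<comment> \<open>Written as preimages under the continuous inverse, the images are visibly closed
    subspaces.\<close>
  have img: "\<Phi> ` S = \<Psi> -` S" for S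
    by (metis \<Phi>\<Psi> \<Psi>\<Phi> bij bij_vimage_eq_inv_image \<Psi>_def inv_inv_eq bij_imp_bij_inv)
  have E: "closed_subspace (\<Phi> ` V k)" for k
    unfolding closed_subspace_def
  proof
    show "closed (\<Phi> ` V k)"
      unfolding img using V[of k] bl'
      by (intro closed_vimage) (auto simp: closed_subspace_def linear_continuous_on)
    show "cvec.subspace (\<Phi> ` V k)"
      unfolding img using V[of k] scale' linear_0 linear_add bounded_linear.linear[OF bl']
      by (auto simp: closed_subspace_def cvec.subspace_def bounded_linear.linear[OF bl'] linear_0 linear_add)
  qed
  define P where "P k x = \<Psi> (orth_proj (\<Phi> ` V k) (\<Phi> x))" for k x
  show ?thesis
  proof (rule exI[of _ P], unfold riesz_projections_def, intro conjI allI ballI impI)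
    fix k j c x
    show "closed_subspace (V k)" by (rule V)
    have "bounded_linear (orth_proj (\<Phi> ` V k))"
    proof (rule bounded_linear_intro[where K = 1])
      show "orth_proj (\<Phi> ` V k) (r *\<^sub>R x) = r *\<^sub>R orth_proj (\<Phi> ` V k) x" for r x
        using orth_proj_scaleC[OF E, of k "complex_of_real r" x] by (simp add: scaleC_of_real)
    qed (simp_all add: orth_proj_add[OF E] norm_orth_proj[OF E])
    then show "bounded_linear (P k)"
      unfolding P_def using bl bl' bounded_linear_compose by blast
    show "range (P k) \<subseteq> V k"
      using orth_proj(1)[OF E] by (auto simp: P_def img)
    show "P k (c *\<^sub>C x) = c *\<^sub>C P k x"
      by (simp add: P_def scale orth_proj_scaleC[OF E] scale')
    show "P k x = x" if "x \<in> V k"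
      using that by (simp add: P_def orth_proj_id[OF E])
    show "P k x = 0" if "j \<noteq> k" "x \<in> V j"
      using orth_proj_orthogonal[OF E[of k], of "\<Phi> x"] orth[of j k] that linear_0[OF bounded_linear.linear[OF bl']]
      by (simp add: P_def)
    let ?Q = "range (\<lambda>k. orth_proj (\<Phi> ` V k) (\<Phi> x))"
    have "\<Phi> x \<in> closure (cvec.span ?Q)"
      by (rule closure_span_orth_proj[OF E orth dense])
    then have "\<Psi> (\<Phi> x) \<in> \<Psi> ` closure (cvec.span ?Q)"
      by blast
    also have "\<dots> \<subseteq> closure (\<Psi> ` cvec.span ?Q)"
      by (intro continuous_image_closure_subset linear_continuous_on[OF bl']) auto
    finally have "x \<in> closure (\<Psi> ` cvec.span ?Q)" by simp
    moreover have "\<Psi> ` cvec.span ?Q \<subseteq> cvec.span (range (\<lambda>k. P k x))"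
    proof
      fix y assume "y \<in> \<Psi> ` cvec.span ?Q"
      then obtain s where s: "s \<in> cvec.span ?Q" "y = \<Psi> s"
        by blast
      have "\<Psi> s \<in> cvec.span (range (\<lambda>k. P k x))"
        using s(1)
      proof (induction rule: cvec.span_induct_alt)
        case base
        then show ?case using linear_0[OF bounded_linear.linear[OF bl']] by (simp add: cvec.span_zero)
      next
        case (step c a b)
        then show ?case
          using linear_add[OF bounded_linear.linear[OF bl']]
          by (auto simp: scale' P_def intro!: cvec.span_add cvec.span_scale intro: cvec.span_base)
      qed
      then show "y \<in> cvec.span (range (\<lambda>k. P k x))" using s(2) by simp
    qed
    ultimately show "x \<in> closure (cvec.span (range (\<lambda>k. P k x)))"
      using closure_mono by blast
  qed
qed

lemma riesz_projections_expand:
  assumes P: "riesz_projections V P" and U: "closed_subspace U" and "\<And>k. P k x \<in> U"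
  shows "x \<in> U"
proof -
  have "range (\<lambda>k. P k x) \<subseteq> U" using assms(3) by blast
  then have "closure (cvec.span (range (\<lambda>k. P k x))) \<subseteq> U"
    using U unfolding closed_subspace_def by (intro closure_minimal cvec.span_minimal) auto
  then show ?thesis using P by (auto simp: riesz_projections_def)
qed

lemma riesz_projections_linear: "riesz_projections V P \<Longrightarrow> linear (P k)"
  unfolding riesz_projections_def by (simp add: bounded_linear.linear)

lemma riesz_projections_in: "riesz_projections V P \<Longrightarrow> P k x \<in> V k"
  unfolding riesz_projections_def by blast

lemma riesz_projections_on_summand:
  "riesz_projections V P \<Longrightarrow> x \<in> V k \<Longrightarrow> P j x = (if j = k then x else 0)"
  unfolding riesz_projections_def by metis

section \<open>Projections and root subspaces for a finitely spectral basis\<close>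

lemma finitely_spectral_projections: "finitely_spectral T V \<Longrightarrow> \<exists>P. riesz_projections V P"
  unfolding finitely_spectral_def by (simp add: exists_riesz_projections)

text \<open>Invariance of the summands gives the identity on the algebraic sum. As this sum is a
  core, any \<open>x\<close> in the domain is approximated in the graph norm, and closedness of
  \<open>T\<close> passes to the limit.\<close>

lemma finitely_spectral_commute:
  assumes T: "linear_op T" and fs: "finitely_spectral T V" and P: "riesz_projections V P"
    and x: "x \<in> dom T"
  shows "T \<cdot> (P k x) = P k (T \<cdot> x)"
proof -
  have sub: "cvec.subspace (V k)" "V k \<subseteq> dom T" "\<And>x. x \<in> V k \<Longrightarrow> T \<cdot> x \<in> V k" for k
    using fs P by (auto simp: finitely_spectral_def riesz_projections_def closed_subspace_def)
  have bl: "bounded_linear (P k)" and PV: "P k y \<in> V k" for y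
    using P by (auto simp: riesz_projections_def)
  have sum: "s \<in> dom T \<and> P k (T \<cdot> s) = T \<cdot> (P k s)" if "s \<in> algebraic_sum UNIV V" for s
    using that unfolding algebraic_sum_def
  proof (induction rule: cvec.span_induct_alt)
    case base
    then show ?case
      using linear_op_zero[OF T] linear_0[OF bounded_linear.linear[OF bl]] by simp
  next
    case (step c a b)
    then obtain j where j: "a \<in> V j" by blast
    have a: "a \<in> dom T" "P k (T \<cdot> a) = T \<cdot> (P k a)"
      using sub(2)[of j] j riesz_projections_on_summand[OF P j, of k]
        riesz_projections_on_summand[OF P sub(3)[OF j], of k] linear_op_zero[OF T] by auto
    have "P k a \<in> dom T" "P k b \<in> dom T" using PV sub(2) by blast+
    then show ?case
      using a step.IH linear_op_scale[OF T] linear_op_add[OF T]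
        linear_add[OF bounded_linear.linear[OF bl]] P
      by (simp add: riesz_projections_def)
  qed
  obtain s where s: "\<And>n. s n \<in> algebraic_sum UNIV V" "s \<longlonglongrightarrow> x" "(\<lambda>n. T \<cdot> s n) \<longlonglongrightarrow> T \<cdot> x"
    using fs x unfolding finitely_spectral_def is_core_def by blast
  have "closed (Map.graph T)" using fs by (simp add: finitely_spectral_def closed_op_def)
  moreover have "(P k (s n), P k (T \<cdot> s n)) \<in> Map.graph T" for n
    using sum[OF s(1)] PV sub(2) unfolding mem_graph_iff by (metis subsetD)
  moreover have "(\<lambda>n. (P k (s n), P k (T \<cdot> s n))) \<longlonglongrightarrow> (P k x, P k (T \<cdot> x))"
    by (intro tendsto_Pair bounded_linear.tendsto[OF bl] s)
  ultimately have "(P k x, P k (T \<cdot> x)) \<in> Map.graph T"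
    by (rule closed_sequentially)
  then show ?thesis by (simp add: mem_graph_iff)
qed

lemma finitely_spectral_invariant:
  "finitely_spectral T V \<Longrightarrow> invariant_subspace T (V k)"
  by (auto simp: finitely_spectral_def invariant_subspace_def riesz_basis_def closed_subspace_def)

text \<open>An eigenvector in \<open>V i\<close> makes the shifted restriction non-injective, so the
  eigenvalue belongs to the spectrum of that restriction, and these spectra are disjoint.\<close>

lemma finitely_spectral_eigenvalue_unique:
  assumes T: "linear_op T" and fs: "finitely_spectral T V"
    and x: "x \<in> V j" "x \<noteq> 0" "T \<cdot> x = z *\<^sub>C x" and y: "y \<in> V k" "y \<noteq> 0" "T \<cdot> y = z *\<^sub>C y"
  shows "j = k"
proof -
  have "z \<in> spectrum_in (V i) (T |` V i)" if v: "v \<in> V i" "v \<noteq> 0" "T \<cdot> v = z *\<^sub>C v" for v i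
  proof -
    have inv: "invariant_subspace T (V i)" by (rule finitely_spectral_invariant[OF fs])
    then have d: "v \<in> dom (T |` V i)" "0 \<in> dom (T |` V i)"
      using v linear_op_zero[OF T] by (auto simp: invariant_subspace_def cvec.subspace_0)
    then have app: "(T |` V i) \<cdot> v = T \<cdot> v" "(T |` V i) \<cdot> 0 = 0"
      using linear_op_zero[OF T] by (auto simp: restrict_map_def split: if_splits)
    then have "shift (T |` V i) z \<cdot> v = shift (T |` V i) z \<cdot> 0"
      using shift_app[OF d(1)] shift_app[OF d(2)] v by simp
    then have "\<not> injective_op (shift (T |` V i) z)"
      using d v(2) unfolding injective_op_def inj_on_def dom_shift by blast
    then show ?thesis by (simp add: spectrum_in_def resolvent_set_in_def)
  qed
  then show ?thesis using x y fs unfolding finitely_spectral_def by blast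
qed

lemma root_subspace_projection:
  assumes T: "linear_op T" and fs: "finitely_spectral T V" and P: "riesz_projections V P"
    and x: "x \<in> root_subspace T z"
  shows "P k x \<in> root_subspace T z"
proof -
  have "x \<in> root_space T z n \<Longrightarrow> P k x \<in> root_space T z n" for n
  proof (induction n arbitrary: x)
    case 0
    then show ?case
      using linear_0[OF riesz_projections_linear[OF P]] by simp
  next
    case (Suc n)
    have lin: "linear (P k)" by (rule riesz_projections_linear[OF P])
    have "P k x \<in> dom T"
      using finitely_spectral_invariant[OF fs, of k] riesz_projections_in[OF P]
      unfolding invariant_subspace_def by blast
    moreover have "T \<cdot> (P k x) - z *\<^sub>C P k x = P k (T \<cdot> x - z *\<^sub>C x)"
      using Suc.prems finitely_spectral_commute[OF T fs P] P
      by (simp add: linear_diff[OF lin] riesz_projections_def)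
    ultimately show ?case using Suc.IH[of "T \<cdot> x - z *\<^sub>C x"] Suc.prems by simp
  qed
  then show ?thesis using x by (auto simp: root_subspace_eq)
qed

text \<open>A nonzero projection \<open>P k x\<close> of a root vector is again a root vector, so
  \<open>V k\<close> contains an eigenvector for \<open>z\<close>. Only one index admits this; all
  other components of all root vectors for \<open>z\<close> vanish.\<close>

lemma root_subspace_subset_summand:
  assumes T: "linear_op T" and fs: "finitely_spectral T V"
  shows "\<exists>k. root_subspace T z \<subseteq> V k"
proof (rule ccontr)
  assume none: "\<nexists>k. root_subspace T z \<subseteq> V k"
  obtain P where P: "riesz_projections V P"
    using finitely_spectral_projections[OF fs] by blast
  have PV: "P k x \<in> V k" for k x using P by (auto simp: riesz_projections_def)
  have eig: "\<exists>y\<in>V k. y \<noteq> 0 \<and> T \<cdot> y = z *\<^sub>C y" if "x \<in> root_subspace T z" "P k x \<noteq> 0" for x k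
    using root_subspace_eigenvector[OF T finitely_spectral_invariant[OF fs]
        root_subspace_projection[OF T fs P that(1)] PV that(2)] .
  \<comment> \<open>The index 0 is arbitrary: a vector outside \<open>V 0\<close> cannot have all
    its components equal to 0.\<close>
  obtain x where x: "x \<in> root_subspace T z" "x \<notin> V 0" using none by blast
  have Vk: "closed_subspace (V k)" for k using P by (simp add: riesz_projections_def)
  obtain k where k: "P k x \<noteq> 0"
    using x(2) riesz_projections_expand[OF P Vk, of x 0] Vk[of 0]
    by (metis closed_subspace_def cvec.subspace_0)
  obtain y where y: "y \<in> root_subspace T z" "y \<notin> V k" using none by blast
  have "P j y \<in> V k" for j
  proof (cases "j = k")
    case False
    then have "P j y = 0"
      using eig[OF x(1) k] eig[OF y(1), of j] finitely_spectral_eigenvalue_unique[OF T fs] by metis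
    then show ?thesis using Vk[of k] by (simp add: closed_subspace_def cvec.subspace_0)
  qed (simp add: PV)
  then have "y \<in> V k" using riesz_projections_expand[OF P Vk] by blast
  with y show False by blast
qed

lemma finitely_spectral_root_span:
  assumes "linear_op T" "finitely_spectral T V"
    and W: "invariant_subspace T W" "W \<subseteq> V k"
  shows "W \<subseteq> cvec.span (\<Union>z. root_subspace T z \<inter> W)"
proof -
  obtain E where "finite E" "V k = cvec.span E"
    using assms(2) unfolding finitely_spectral_def by blast
  then show ?thesis using invariant_subspace_root_span[OF assms(1) W(1)] W(2) by blast
qed

text \<open>Each summand is spanned by root vectors, because a finite-dimensional invariant space is
  the sum of its root parts.\<close>

lemma root_subspaces_dense:
  assumes T: "linear_op T" and fs: "finitely_spectral T V"
  shows "closure (cvec.span (\<Union>z. root_subspace T z)) = UNIV"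
proof -
  obtain P where P: "riesz_projections V P"
    using finitely_spectral_projections[OF fs] by blast
  let ?S = "cvec.span (\<Union>z. root_subspace T z)"
  have V: "V k \<subseteq> ?S" for k
    using finitely_spectral_root_span[OF T fs finitely_spectral_invariant[OF fs], of k k]
      cvec.span_mono[of "\<Union>z. root_subspace T z \<inter> V k" "\<Union>z. root_subspace T z"] by blast
  have "x \<in> closure ?S" for x
  proof (rule riesz_projections_expand[OF P])
    show "closed_subspace (closure ?S)"
      by (simp add: closed_subspace_def subspace_closure cvec.subspace_span)
    show "P k x \<in> closure ?S" for k
      using V[of k] P closure_subset[of ?S] unfolding riesz_projections_def by blast
  qed
  then show ?thesis by blast
qed

section \<open>Closed sums and compatible subspaces\<close>

lemma closed_subspace_hilbert_sum: "closed_subspace (hilbert_sum I V)"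
  by (simp add: closed_subspace_def hilbert_sum_def algebraic_sum_def subspace_closure
      cvec.subspace_span)

lemma hilbert_sum_upper: "i \<in> I \<Longrightarrow> V i \<subseteq> hilbert_sum I V"
  unfolding hilbert_sum_def algebraic_sum_def
  using closure_subset cvec.span_superset[of "\<Union>i\<in>I. V i"] by blast

lemma hilbert_sum_minimal:
  "closed_subspace U \<Longrightarrow> (\<And>i. i \<in> I \<Longrightarrow> V i \<subseteq> U) \<Longrightarrow> hilbert_sum I V \<subseteq> U"
  unfolding hilbert_sum_def algebraic_sum_def closed_subspace_def
  by (intro closure_minimal cvec.span_minimal) auto

lemma closed_subspace_inter:
  "closed_subspace U \<Longrightarrow> closed_subspace W \<Longrightarrow> closed_subspace (U \<inter> W)"
  by (auto simp: closed_subspace_def cvec.subspace_inter)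

text \<open>The pieces are the intersections with the \<open>V k\<close>; they exhaust the whole
  subspace because no root subspace is spread over several summands.\<close>

lemma spectral_subspace_compatible:
  assumes T: "linear_op T" and fs: "finitely_spectral T V"
  shows "compatible V (spectral_subspace T \<sigma>)"
  unfolding compatible_def spectral_subspace_def
proof (intro exI conjI allI)
  let ?U = "hilbert_sum \<sigma> (root_subspace T)"
  fix k
  have "closed_subspace (V k)" for k
    using fs by (simp add: finitely_spectral_def riesz_basis_def)
  then show "closed_subspace (V k \<inter> ?U)"
    by (simp add: closed_subspace_inter closed_subspace_hilbert_sum)
  show "V k \<inter> ?U \<subseteq> V k" by blast
  show "?U = hilbert_sum UNIV (\<lambda>k. V k \<inter> ?U)"
  proof
    show "hilbert_sum UNIV (\<lambda>k. V k \<inter> ?U) \<subseteq> ?U"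
      by (intro hilbert_sum_minimal closed_subspace_hilbert_sum) blast
    show "?U \<subseteq> hilbert_sum UNIV (\<lambda>k. V k \<inter> ?U)"
    proof (intro hilbert_sum_minimal closed_subspace_hilbert_sum)
      fix z assume z: "z \<in> \<sigma>"
      obtain k where "root_subspace T z \<subseteq> V k" using root_subspace_subset_summand[OF T fs] by blast
      then have "root_subspace T z \<subseteq> V k \<inter> ?U" using hilbert_sum_upper[OF z] by blast
      then show "root_subspace T z \<subseteq> hilbert_sum UNIV (\<lambda>k. V k \<inter> ?U)"
        using hilbert_sum_upper[of k UNIV "\<lambda>k. V k \<inter> ?U"] by blast
    qed
  qed
qed

text \<open>The intersections \<open>V k \<inter> U\<close> contain any admissible choice of pieces,
  so the existential witness may be replaced by this canonical one.\<close>

lemma compatible_eq: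
  assumes "compatible V U"
  shows "U = hilbert_sum UNIV (\<lambda>k. V k \<inter> U)"
proof
  obtain W where W: "\<And>k. closed_subspace (W k)" "\<And>k. W k \<subseteq> V k" "U = hilbert_sum UNIV W"
    using assms by (auto simp: compatible_def)
  have U: "closed_subspace U" using W(3) closed_subspace_hilbert_sum by blast
  show "hilbert_sum UNIV (\<lambda>k. V k \<inter> U) \<subseteq> U"
    by (intro hilbert_sum_minimal U) blast
  have "W k \<subseteq> V k \<inter> U" for k using W hilbert_sum_upper[of k UNIV W] by blast
  then have "W k \<subseteq> hilbert_sum UNIV (\<lambda>k. V k \<inter> U)" for k
    using hilbert_sum_upper[of k UNIV "\<lambda>k. V k \<inter> U"] by blast
  then show "U \<subseteq> hilbert_sum UNIV (\<lambda>k. V k \<inter> U)"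
    unfolding W(3) by (intro hilbert_sum_minimal closed_subspace_hilbert_sum)
qed

section \<open>Resolvents\<close>

definition resolvent_op :: "('a::complex_hilbert, 'a) operator \<Rightarrow> complex \<Rightarrow> 'a \<Rightarrow> 'a" where
  "resolvent_op T z y = inverse_op (shift T z) \<cdot> y"

lemma injective_opD:
  assumes "injective_op S" "S x = Some y" "S x' = Some y"
  shows "x = x'"
  using assms(1) unfolding injective_op_def
  by (rule inj_onD) (use assms(2,3) in auto)

lemma resolvent_op_eqI:
  assumes z: "z \<in> resolvent_set T" and x: "x \<in> dom T" "T \<cdot> x - z *\<^sub>C x = y"
  shows "resolvent_op T z y = x"
proof -
  have sx: "shift T z x = Some y" using shift_app[OF x(1), of z] x(2) by simp
  have "injective_op (shift T z)"
    using z by (simp add: resolvent_set_def resolvent_set_in_def)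
  then have uniq: "x' = x" if "shift T z x' = Some y" for x'
    using that sx by (rule injective_opD)
  have "(THE x. shift T z x = Some y) = x" using sx uniq by (rule the_equality)
  moreover have "y \<in> ran (shift T z)" using sx by (rule ranI)
  ultimately show ?thesis by (simp add: resolvent_op_def inverse_op_def)
qed

lemma resolvent_op:
  assumes z: "z \<in> resolvent_set T"
  shows "resolvent_op T z y \<in> dom T" "T \<cdot> (resolvent_op T z y) - z *\<^sub>C resolvent_op T z y = y"
proof -
  have "y \<in> ran (shift T z)" using z by (simp add: resolvent_set_def resolvent_set_in_def)
  then obtain x where sx: "shift T z x = Some y" by (auto simp: ran_def)
  have x: "x \<in> dom T" using domI[of "shift T z", OF sx] by simp
  then have y: "T \<cdot> x - z *\<^sub>C x = y" using sx shift_app[OF x, of z] by simp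
  show "resolvent_op T z y \<in> dom T" "T \<cdot> (resolvent_op T z y) - z *\<^sub>C resolvent_op T z y = y"
    using resolvent_op_eqI[OF z x y] x y by simp_all
qed

lemma resolvent_op_bound:
  assumes "z \<in> resolvent_set T"
  obtains c where "c > 0" "\<And>y. norm (resolvent_op T z y) \<le> c * norm y"
proof -
  obtain c where c: "\<And>y. norm (resolvent_op T z y) \<le> c * norm y"
    using assms by (auto simp: resolvent_set_def resolvent_set_in_def resolvent_op_def)
  have "norm (resolvent_op T z y) \<le> (\<bar>c\<bar> + 1) * norm y" for y
    by (rule order_trans[OF c]) (simp add: mult_right_mono)
  then show ?thesis using that[of "\<bar>c\<bar> + 1"] by simp
qed

lemma resolvent_op_add:
  assumes T: "linear_op T" and z: "z \<in> resolvent_set T"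
  shows "resolvent_op T z (x + y) = resolvent_op T z x + resolvent_op T z y"
proof (rule resolvent_op_eqI[OF z])
  note R = resolvent_op[OF z]
  show "resolvent_op T z x + resolvent_op T z y \<in> dom T"
    using linear_op_add[OF T R(1) R(1)] by blast
  have "T \<cdot> (resolvent_op T z x + resolvent_op T z y) - z *\<^sub>C (resolvent_op T z x + resolvent_op T z y)
     = (T \<cdot> (resolvent_op T z x) - z *\<^sub>C resolvent_op T z x)
       + (T \<cdot> (resolvent_op T z y) - z *\<^sub>C resolvent_op T z y)"
    using linear_op_add[OF T R(1)[of x] R(1)[of y]] by (simp add: scaleC_add_right)
  then show "T \<cdot> (resolvent_op T z x + resolvent_op T z y)
      - z *\<^sub>C (resolvent_op T z x + resolvent_op T z y) = x + y"
    by (simp add: R(2))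
qed

lemma resolvent_op_scaleC:
  assumes T: "linear_op T" and z: "z \<in> resolvent_set T"
  shows "resolvent_op T z (c *\<^sub>C x) = c *\<^sub>C resolvent_op T z x"
proof (rule resolvent_op_eqI[OF z])
  note R = resolvent_op[OF z]
  show "c *\<^sub>C resolvent_op T z x \<in> dom T"
    using linear_op_scale[OF T R(1)] by blast
  have "T \<cdot> (c *\<^sub>C resolvent_op T z x) - z *\<^sub>C c *\<^sub>C resolvent_op T z x
     = c *\<^sub>C (T \<cdot> (resolvent_op T z x) - z *\<^sub>C resolvent_op T z x)"
    using linear_op_scale[OF T R(1)[of x], of c]
    by (simp add: cvec.scale_right_diff_distrib scaleC_scaleC mult.commute)
  then show "T \<cdot> (c *\<^sub>C resolvent_op T z x) - z *\<^sub>C c *\<^sub>C resolvent_op T z x = c *\<^sub>C x"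
    by (simp add: R(2))
qed

lemma bounded_linear_resolvent_op:
  assumes T: "linear_op T" and z: "z \<in> resolvent_set T"
  shows "bounded_linear (resolvent_op T z)"
proof -
  obtain c where c: "\<And>y. norm (resolvent_op T z y) \<le> c * norm y"
    using resolvent_op_bound[OF z] by blast
  show ?thesis
  proof (rule bounded_linear_intro)
    show "resolvent_op T z (r *\<^sub>R x) = r *\<^sub>R resolvent_op T z x" for r x
      using resolvent_op_scaleC[OF T z, of "complex_of_real r" x] by (simp add: scaleC_of_real)
    show "norm (resolvent_op T z x) \<le> norm x * c" for x
      using c[of x] by (simp add: mult.commute)
  qed (rule resolvent_op_add[OF T z])
qed

text \<open>
  \<open>x\<close> solves \<open>T x - w x = y\<close> iff it is a fixed point of \<open>x \<mapsto> (T - z)\<^sup>-\<^sup>1 (y + (w - z) x)\<close>, which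
  is a contraction for \<open>w\<close> near \<open>z\<close>.
\<close>

lemma resolvent_set_nearby:
  assumes T: "linear_op T" and z: "z \<in> resolvent_set T"
    and c: "c > 0" "\<And>y. norm (resolvent_op T z y) \<le> c * norm y"
    and w: "c * cmod (w - z) \<le> 1 / 2"
  shows "w \<in> resolvent_set T" "norm (resolvent_op T w y) \<le> 2 * c * norm y"
proof -
  note bl = bounded_linear.linear[OF bounded_linear_resolvent_op[OF T z]]
  define g where "g y x = resolvent_op T z (y + (w - z) *\<^sub>C x)" for x y
  have fixpt: "g y x = x \<longleftrightarrow> x \<in> dom T \<and> T \<cdot> x - w *\<^sub>C x = y" for x y
  proof
    assume "g y x = x"
    then show "x \<in> dom T \<and> T \<cdot> x - w *\<^sub>C x = y"
      using resolvent_op[OF z, of "y + (w - z) *\<^sub>C x"]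
      by (simp add: g_def cvec.scale_left_diff_distrib algebra_simps)
  next
    assume "x \<in> dom T \<and> T \<cdot> x - w *\<^sub>C x = y"
    then have "x \<in> dom T" "T \<cdot> x - z *\<^sub>C x = y + (w - z) *\<^sub>C x"
      by (auto simp: cvec.scale_left_diff_distrib)
    then show "g y x = x" unfolding g_def by (rule resolvent_op_eqI[OF z])
  qed
  have half: "norm (resolvent_op T z ((w - z) *\<^sub>C x)) \<le> 1 / 2 * norm x" for x
  proof -
    have "norm (resolvent_op T z ((w - z) *\<^sub>C x)) \<le> c * cmod (w - z) * norm x"
      using c(2)[of "(w - z) *\<^sub>C x"] by (simp add: norm_scaleC)
    also have "\<dots> \<le> 1 / 2 * norm x" using w by (intro mult_right_mono) auto
    finally show ?thesis .
  qed
  have contr: "dist (g y x) (g y x') \<le> 1 / 2 * dist x x'" for x x' y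
  proof -
    have "g y x - g y x' = resolvent_op T z ((w - z) *\<^sub>C (x - x'))"
      by (simp add: g_def linear_diff[OF bl, symmetric] cvec.scale_right_diff_distrib)
    then show ?thesis using half[of "x - x'"] by (simp add: dist_norm)
  qed
  have ex1: "\<exists>!x. g y x = x" for y
    using banach_fix_type[of "1/2" "g y"] contr by simp
  \<comment> \<open>The contraction contributes half of \<open>norm x\<close>; absorbing it on the
    left produces the factor 2.\<close>
  have bound: "norm x \<le> 2 * c * norm y" if "g y x = x" for x y
  proof -
    have "norm x = norm (resolvent_op T z y + resolvent_op T z ((w - z) *\<^sub>C x))"
      using that by (simp add: g_def linear_add[OF bl])
    also have "\<dots> \<le> c * norm y + 1 / 2 * norm x"
      using norm_triangle_ineq c(2)[of y] half[of x] by (meson add_mono order_trans)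
    finally show ?thesis by simp
  qed
  have inj: "injective_op (shift T w)"
    unfolding injective_op_def
  proof (rule inj_onI)
    fix x x' assume d: "x \<in> dom (shift T w)" "x' \<in> dom (shift T w)"
      and "shift T w \<cdot> x = shift T w \<cdot> x'"
    then have "T \<cdot> x - w *\<^sub>C x = T \<cdot> x' - w *\<^sub>C x'"
      using shift_app[of x T w] shift_app[of x' T w] by simp
    then have "g (T \<cdot> x - w *\<^sub>C x) x = x" "g (T \<cdot> x - w *\<^sub>C x) x' = x'"
      unfolding fixpt using d by auto
    then show "x = x'" using ex1 by blast
  qed
  have surj: "ran (shift T w) = UNIV"
  proof -
    have "y \<in> ran (shift T w)" for y
    proof -
      obtain x where "g y x = x" using ex1 by blast
      then have "x \<in> dom T" "T \<cdot> x - w *\<^sub>C x = y" unfolding fixpt by auto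
      then have "shift T w x = Some y" using shift_app[of x T w] by simp
      then show ?thesis by (rule ranI)
    qed
    then show ?thesis by blast
  qed
  have inv: "norm (inverse_op (shift T w) \<cdot> y) \<le> 2 * c * norm y" for y
  proof -
    obtain x where x: "g y x = x" using ex1 by blast
    then have "x \<in> dom T" "T \<cdot> x - w *\<^sub>C x = y" unfolding fixpt by auto
    then have sx: "shift T w x = Some y" using shift_app[of x T w] by simp
    have uniq: "x' = x" if "shift T w x' = Some y" for x'
      using inj that sx by (rule injective_opD)
    have "(THE x. shift T w x = Some y) = x" using sx uniq by (rule the_equality)
    then show ?thesis using bound[OF x] surj by (simp add: inverse_op_def)
  qed
  show "w \<in> resolvent_set T"
    using inj surj inv by (auto simp: resolvent_set_def resolvent_set_in_def)
  show "norm (resolvent_op T w y) \<le> 2 * c * norm y"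
    using inv by (simp add: resolvent_op_def)
qed

lemma open_resolvent_set:
  assumes T: "linear_op T"
  shows "open (resolvent_set T)"
  unfolding open_dist
proof
  fix z assume z: "z \<in> resolvent_set T"
  obtain c where c: "c > 0" "\<And>y. norm (resolvent_op T z y) \<le> c * norm y"
    using resolvent_op_bound[OF z] by blast
  have "w \<in> resolvent_set T" if "dist w z < 1 / (2 * c)" for w
    using that c(1) by (intro resolvent_set_nearby(1)[OF T z c]) (auto simp: dist_norm field_simps)
  then show "\<exists>e>0. \<forall>y. dist y z < e \<longrightarrow> y \<in> resolvent_set T"
    using c(1) by (intro exI[of _ "1 / (2 * c)"]) simp
qed

lemma resolvent_identity:
  assumes T: "linear_op T" and z: "z \<in> resolvent_set T" and w: "w \<in> resolvent_set T"
  shows "resolvent_op T w x - resolvent_op T z x = (w - z) *\<^sub>C resolvent_op T w (resolvent_op T z x)"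
proof -
  let ?r = "resolvent_op T z x"
  have "T \<cdot> ?r - w *\<^sub>C ?r = x - (w - z) *\<^sub>C ?r"
    using resolvent_op(2)[OF z, of x] by (simp add: cvec.scale_left_diff_distrib algebra_simps)
  then have "resolvent_op T w (x - (w - z) *\<^sub>C ?r) = ?r"
    by (intro resolvent_op_eqI[OF w] resolvent_op[OF z])
  then show ?thesis
    unfolding linear_diff[OF bounded_linear.linear[OF bounded_linear_resolvent_op[OF T w]]]
      resolvent_op_scaleC[OF T w] by (metis diff_diff_eq2 diff_eq_eq add.commute)
qed

lemma resolvent_tendsto:
  assumes T: "linear_op T" and z: "z \<in> resolvent_set T"
  shows "((\<lambda>w. resolvent_op T w x) \<longlongrightarrow> resolvent_op T z x) (at z)"
proof -
  obtain c where c: "c > 0" "\<And>y. norm (resolvent_op T z y) \<le> c * norm y"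
    using resolvent_op_bound[OF z] by blast
  have "\<forall>\<^sub>F w in at z. norm (resolvent_op T w x - resolvent_op T z x)
      \<le> cmod (w - z) * (2 * c * norm (resolvent_op T z x))"
    unfolding eventually_at
  proof (intro exI[of _ "1 / (2 * c)"] conjI ballI impI)
    fix w assume "w \<noteq> z \<and> dist w z < 1 / (2 * c)"
    then have w: "c * cmod (w - z) \<le> 1 / 2" using c(1) by (simp add: dist_norm field_simps)
    note near = resolvent_set_nearby[OF T z c w]
    show "norm (resolvent_op T w x - resolvent_op T z x)
      \<le> cmod (w - z) * (2 * c * norm (resolvent_op T z x))"
      unfolding resolvent_identity[OF T z near(1)] norm_scaleC
      by (intro mult_left_mono near(2)) auto
  qed (use c(1) in simp)
  moreover have "((\<lambda>w. cmod (w - z) * (2 * c * norm (resolvent_op T z x))) \<longlongrightarrow> 0) (at z)"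
    by (auto intro!: tendsto_eq_intros)
  ultimately have "((\<lambda>w. resolvent_op T w x - resolvent_op T z x) \<longlongrightarrow> 0) (at z)"
    by (rule Lim_null_comparison)
  then show ?thesis by (rule Lim_null[THEN iffD2])
qed

text \<open>By the resolvent identity the difference quotient at \<open>z\<close> is the resolvent
  at \<open>w\<close> applied to the resolvent at \<open>z\<close>, so strong continuity already
  gives the derivative.\<close>

lemma holomorphic_resolvent:
  assumes T: "linear_op T"
  shows "(\<lambda>z. cinner (resolvent_op T z x) v) holomorphic_on resolvent_set T"
proof -
  have "((\<lambda>z. cinner (resolvent_op T z x) v) has_field_derivative
      cinner (resolvent_op T z (resolvent_op T z x)) v) (at z)"
    if z: "z \<in> resolvent_set T" for z
    unfolding has_field_derivative_iff
  proof (rule Lim_transform_eventually)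
    show "((\<lambda>w. cinner (resolvent_op T w (resolvent_op T z x)) v)
        \<longlongrightarrow> cinner (resolvent_op T z (resolvent_op T z x)) v) (at z)"
      by (intro tendsto_cinner resolvent_tendsto[OF T z] tendsto_const)
    have "\<forall>\<^sub>F w in at z. w \<in> resolvent_set T \<and> w \<noteq> z"
      using open_resolvent_set[OF T] z
      by (simp add: eventually_at_topological) (use open_resolvent_set[OF T] in blast)
    then show "\<forall>\<^sub>F w in at z. cinner (resolvent_op T w (resolvent_op T z x)) v =
        (cinner (resolvent_op T w x) v - cinner (resolvent_op T z x) v) / (w - z)"
    proof eventually_elim
      case (elim w)
      then show ?case
        using resolvent_identity[OF T z, of w x]
        by (simp add: cinner_diff_left[symmetric] cinner_scaleC_left)
    qed
  qed
  then show ?thesis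
    by (metis DERIV_subset field_differentiable_def holomorphic_on_def subset_UNIV)
qed

section \<open>Decaying trajectories\<close>

lemma exp_power_tendsto_0:
  assumes a: "(a::real) < 0"
  shows "((\<lambda>t. exp (a * t) * t ^ j) \<longlongrightarrow> 0) at_top"
proof -
  have "((\<lambda>t. (1 / (- a)) ^ j * ((- a * t) ^ j / exp (- a * t))) \<longlongrightarrow> (1 / (- a)) ^ j * 0) at_top"
    using a by (intro tendsto_mult tendsto_const filterlim_compose[OF tendsto_power_div_exp_0]
        filterlim_tendsto_pos_mult_at_top[OF tendsto_const _ filterlim_ident]) auto
  moreover have "(1 / (- a)) ^ j * ((- a * t) ^ j / exp (- a * t)) = exp (a * t) * t ^ j" for t
  proof -
    have "(1 / (- a)) ^ j * (- a * t) ^ j = (1 / (- a) * (- a * t)) ^ j"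
      by (rule power_mult_distrib[symmetric])
    also have "1 / (- a) * (- a * t) = t" using a by simp
    finally show ?thesis by (simp add: exp_minus field_simps)
  qed
  ultimately show ?thesis by simp
qed

text \<open>The trajectory is \<open>exp (s t T) x\<close>, given by the exponential series of \<open>T - z\<close> at \<open>x\<close>.\<close>

lemma root_space_trajectory:
  assumes T: "linear_op T" and x: "x \<in> root_space T z k" and s: "s * Re z < 0"
  shows "\<exists>y. y 0 = x \<and> (\<forall>t. y t \<in> dom T \<and> (y has_vector_derivative s *\<^sub>R (T \<cdot> y t)) (at t))
    \<and> (y \<longlongrightarrow> 0) at_top"
proof -
  define N where "N x = T \<cdot> x - z *\<^sub>C x" for x
  define w where "w j = (N ^^ j) x" for j
  define a where "a = complex_of_real s"
  \<comment> \<open>\<open>c j\<close> is the coefficient of the \<open>j\<close>-th power of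
    \<open>T - z\<close> at \<open>x\<close> in the exponential series. It is a function of a
    complex variable so that the rules for field derivatives apply; it is restricted to real times
    afterwards.\<close>
  define c where "c j \<tau> = exp (z * a * \<tau>) * ((a * \<tau>) ^ j / fact j)" for j :: nat and \<tau> :: complex
  define y where "y t = (\<Sum>j<k. c j (complex_of_real t) *\<^sub>C w j)" for t
  have w_Suc: "w (Suc j) = T \<cdot> w j - z *\<^sub>C w j" for j by (simp add: w_def N_def)
  have wroot: "w j \<in> root_space T z (k - j)" if "j \<le> k" for j
    using that
  proof (induction j)
    case (Suc j)
    then have "w j \<in> root_space T z (Suc (k - Suc j))" by (simp add: Suc_diff_Suc)
    then show ?case by (simp add: w_Suc)
  qed (simp add: w_def x)
  have wk: "w k = 0" using wroot[of k] by simp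
  have wd: "w j \<in> dom T" if "j < k" for j
    using wroot[of j] that root_subspace_dom[OF T, of z] by (auto simp: root_subspace_eq)
  have yT: "y t \<in> dom T \<and> T \<cdot> y t = (\<Sum>j<k. c j (complex_of_real t) *\<^sub>C (T \<cdot> w j))" for t
  proof -
    have "(\<Sum>j<n. b j *\<^sub>C w j) \<in> dom T \<and> T \<cdot> (\<Sum>j<n. b j *\<^sub>C w j) = (\<Sum>j<n. b j *\<^sub>C (T \<cdot> w j))"
      if "n \<le> k" for n b
      using that
    proof (induction n)
      case (Suc n)
      then show ?case
        using linear_op_add[OF T, of "\<Sum>j<n. b j *\<^sub>C w j" "b n *\<^sub>C w n"] linear_op_scale[OF T wd, of n "b n"]
        by simp
    qed (use linear_op_zero[OF T] in simp)
    from this[OF order_refl] show ?thesis unfolding y_def .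
  qed
  have c0: "(c 0 has_field_derivative a * (z * c 0 \<tau>)) (at \<tau>)" for \<tau>
    unfolding c_def by (auto intro!: derivative_eq_intros)
  have cSuc: "(c (Suc j) has_field_derivative a * (z * c (Suc j) \<tau> + c j \<tau>)) (at \<tau>)" for j \<tau>
  proof -
    have "((\<lambda>\<tau>. (a * \<tau>) ^ Suc j) has_field_derivative (1 + of_nat j) * (a * (a * \<tau>) ^ j)) (at \<tau>)"
      by (rule DERIV_power_Suc) (auto intro!: derivative_eq_intros)
    then have p: "((\<lambda>\<tau>. (a * \<tau>) ^ Suc j / fact (Suc j)) has_field_derivative
        (1 + of_nat j) * (a * (a * \<tau>) ^ j) / fact (Suc j)) (at \<tau>)"
      by (rule DERIV_cdivide)
    have eq: "(1 + of_nat j) * (a * (a * \<tau>) ^ j) / fact (Suc j) = a * (a * \<tau>) ^ j / fact j"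
      unfolding fact_Suc of_nat_Suc by (rule mult_divide_mult_cancel_left) (metis of_nat_Suc of_nat_neq_0)
    have "((\<lambda>\<tau>. exp (z * a * \<tau>)) has_field_derivative exp (z * a * \<tau>) * (z * a)) (at \<tau>)"
      by (auto intro!: derivative_eq_intros)
    from DERIV_mult[OF this p, unfolded eq] show ?thesis
      unfolding c_def by (rule DERIV_cong) (simp add: algebra_simps)
  qed
  \<comment> \<open>Differentiating \<open>c j\<close> yields a multiple of \<open>c j\<close> and
    one of its predecessor; \<open>d j\<close> is that predecessor, with 0 standing in for the
    missing one at \<open>j = 0\<close>.\<close>
  define d where "d j t = (case j of 0 \<Rightarrow> 0 | Suc i \<Rightarrow> c i (complex_of_real t))" for j t
  have deriv: "(y has_vector_derivative
      (\<Sum>j<k. (a * (z * c j (complex_of_real t) + d j t)) *\<^sub>C w j)) (at t)" for t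
    unfolding y_def
  proof (rule has_vector_derivative_sum)
    fix j
    have "(c j has_field_derivative a * (z * c j (complex_of_real t) + d j t)) (at (complex_of_real t))"
      using c0 cSuc by (cases j) (auto simp: d_def)
    then have "((\<lambda>t. c j (complex_of_real t)) has_vector_derivative
        a * (z * c j (complex_of_real t) + d j t)) (at t)"
      by (rule has_vector_derivative_real_field)
    moreover have "bounded_linear (\<lambda>c. c *\<^sub>C w j)"
    proof (rule bounded_linear_intro)
      show "norm (c *\<^sub>C w j) \<le> norm c * norm (w j)" for c by (simp add: norm_scaleC)
      show "(r *\<^sub>R c) *\<^sub>C w j = r *\<^sub>R (c *\<^sub>C w j)" for r c
        unfolding scaleR_conv_of_real scaleC_scaleC[symmetric] scaleC_of_real ..
    qed (rule scaleC_add_left)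
    ultimately show "((\<lambda>t. c j (complex_of_real t) *\<^sub>C w j) has_vector_derivative
        (a * (z * c j (complex_of_real t) + d j t)) *\<^sub>C w j) (at t)"
      using bounded_linear.has_vector_derivative by blast
  qed
  \<comment> \<open>The index shift gains the top term \<open>w k\<close> and loses nothing:
    \<open>w k = 0\<close>, since the chain has ended.\<close>
  have shift_sum: "(\<Sum>j<k. d j t *\<^sub>C w j) = (\<Sum>j<k. c j (complex_of_real t) *\<^sub>C w (Suc j))" for t
  proof (cases k)
    case (Suc n)
    have "(\<Sum>j<Suc n. d j t *\<^sub>C w j) = (\<Sum>j<n. c j (complex_of_real t) *\<^sub>C w (Suc j))"
      by (subst sum.lessThan_Suc_shift) (simp add: d_def)
    then show ?thesis using wk Suc by simp
  qed simp
  have "(\<Sum>j<k. (a * (z * c j (complex_of_real t) + d j t)) *\<^sub>C w j) = s *\<^sub>R (T \<cdot> y t)" for t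
  proof -
    have "(\<Sum>j<k. (a * (z * c j (complex_of_real t) + d j t)) *\<^sub>C w j) =
        a *\<^sub>C ((\<Sum>j<k. (z * c j (complex_of_real t)) *\<^sub>C w j) + (\<Sum>j<k. d j t *\<^sub>C w j))"
      unfolding sum.distrib[symmetric] cvec.scale_sum_right
      by (rule sum.cong[OF refl]) (simp add: scaleC_scaleC flip: scaleC_add_left)
    also have "\<dots> = a *\<^sub>C (T \<cdot> y t)"
      unfolding shift_sum by (simp add: w_Suc yT cvec.scale_right_diff_distrib sum_subtractf scaleC_scaleC mult.commute)
    finally show ?thesis by (simp add: a_def scaleC_of_real)
  qed
  then have ode: "(y has_vector_derivative s *\<^sub>R (T \<cdot> y t)) (at t)" for t
    using deriv by simp
  have y0: "y 0 = x"
  proof (cases k)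
    case 0
    then show ?thesis using x by (simp add: y_def)
  next
    case (Suc n)
    have "c (Suc j) 0 = 0" for j by (simp add: c_def)
    moreover have "c 0 0 = 1" by (simp add: c_def)
    ultimately show ?thesis
      using sum.lessThan_Suc_shift[of "\<lambda>j. c j 0 *\<^sub>C w j" n]
      by (simp add: y_def Suc w_def scaleC_one)
  qed
  have "((\<lambda>t. c j (complex_of_real t) *\<^sub>C w j) \<longlongrightarrow> 0) at_top" for j
  proof (rule tendsto_norm_zero_cancel)
    have "((\<lambda>t. \<bar>s\<bar> ^ j / fact j * norm (w j) * \<bar>exp (s * Re z * t) * t ^ j\<bar>)
        \<longlongrightarrow> \<bar>s\<bar> ^ j / fact j * norm (w j) * 0) at_top"
      by (intro tendsto_mult tendsto_const tendsto_rabs_zero exp_power_tendsto_0 s)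
    moreover have "norm (c j (complex_of_real t) *\<^sub>C w j) =
        \<bar>s\<bar> ^ j / fact j * norm (w j) * \<bar>exp (s * Re z * t) * t ^ j\<bar>" for t
      by (simp add: norm_scaleC c_def a_def norm_mult norm_divide norm_power norm_exp_eq_Re abs_mult
          power_mult_distrib power_abs mult_ac)
    ultimately show "((\<lambda>t. norm (c j (complex_of_real t) *\<^sub>C w j)) \<longlongrightarrow> 0) at_top"
      by simp
  qed
  then have "(y \<longlongrightarrow> (\<Sum>j<k. 0)) at_top"
    unfolding y_def by (intro tendsto_sum)
  then have "(y \<longlongrightarrow> 0) at_top" by simp
  then show ?thesis using y0 ode yT by blast
qed

text \<open>The factor \<open>s\<close> selects the direction of time: 1 for eigenvalues in the left
  half-plane, -1 for those in the right one. Linearity adds up the trajectories of the single root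
  vectors.\<close>

lemma root_span_trajectory:
  assumes T: "linear_op T" and s: "\<And>z. z \<in> \<sigma> \<Longrightarrow> s * Re z < 0"
    and x: "x \<in> algebraic_sum \<sigma> (root_subspace T)"
  shows "\<exists>y. y 0 = x \<and> (\<forall>t. y t \<in> dom T \<and> (y has_vector_derivative s *\<^sub>R (T \<cdot> y t)) (at t))
    \<and> (y \<longlongrightarrow> 0) at_top"
  using x unfolding algebraic_sum_def
proof (induction rule: cvec.span_induct_alt)
  case base
  show ?case
    using linear_op_zero[OF T] by (intro exI[of _ "\<lambda>t. 0"]) auto
next
  case (step c x w)
  then obtain z k where "z \<in> \<sigma>" "x \<in> root_space T z k" by (auto simp: root_subspace_eq)
  then obtain f where f: "f 0 = x" "\<And>t. f t \<in> dom T"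
      "\<And>t. (f has_vector_derivative s *\<^sub>R (T \<cdot> f t)) (at t)" "(f \<longlongrightarrow> 0) at_top"
    using root_space_trajectory[OF T _ s] by metis
  obtain g where g: "g 0 = w" "\<And>t. g t \<in> dom T"
      "\<And>t. (g has_vector_derivative s *\<^sub>R (T \<cdot> g t)) (at t)" "(g \<longlongrightarrow> 0) at_top"
    using step.IH by blast
  let ?y = "\<lambda>t. c *\<^sub>C f t + g t"
  have Ty: "?y t \<in> dom T \<and> T \<cdot> ?y t = c *\<^sub>C (T \<cdot> f t) + T \<cdot> g t" for t
    using linear_op_scale[OF T f(2)[of t], of c] linear_op_add[OF T, of "c *\<^sub>C f t" "g t"] g(2) by simp
  have "(?y has_vector_derivative c *\<^sub>C (s *\<^sub>R (T \<cdot> f t)) + s *\<^sub>R (T \<cdot> g t)) (at t)" for t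
    using bounded_linear.has_vector_derivative[OF bounded_linear_scaleC f(3)] g(3)
    by (intro has_vector_derivative_add) auto
  moreover have "c *\<^sub>C (s *\<^sub>R (T \<cdot> f t)) + s *\<^sub>R (T \<cdot> g t) = s *\<^sub>R (T \<cdot> ?y t)" for t
    by (simp only: Ty scaleC_of_real[symmetric] scaleC_scaleC scaleC_add_right mult.commute)
  moreover have "(?y \<longlongrightarrow> c *\<^sub>C 0 + 0) at_top"
    by (intro tendsto_add tendsto_scaleC f g)
  ultimately show ?case
    using f(1) g(1) Ty by (intro exI[of _ ?y]) auto
qed

section \<open>The indefinite scalar product\<close>

lemma cinner_J1: "cinner (J1 x) y = \<i> * (cinner (fst x) (snd y) - cinner (snd x) (fst y))"
  by (simp add: J1_def cinner_prod_def cinner_algebra algebra_simps)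

lemma bounded_linear_J1: "bounded_linear (J1 :: 'h::complex_hilbert \<times> 'h \<Rightarrow> _)"
  unfolding J1_def
  by (intro bounded_linear_Pair bounded_linear_minus bounded_linear_compose[OF bounded_linear_scaleC]
      bounded_linear_fst bounded_linear_snd)

lemma J1_hermitian: "cinner (J1 x) y = cnj (cinner (J1 y) x)"
  unfolding cinner_J1 using cinner_commute[of "fst x" "snd y"] cinner_commute[of "snd x" "fst y"]
  by (simp add: algebra_simps)

lemma J1_zero_commute: "cinner (J1 x) y = 0 \<longleftrightarrow> cinner (J1 y) x = 0"
  by (metis J1_hermitian complex_cnj_zero)

lemma cinner_J1_left:
  "cinner (J1 (x + y)) w = cinner (J1 x) w + cinner (J1 y) w"
  "cinner (J1 (x - y)) w = cinner (J1 x) w - cinner (J1 y) w"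
  "cinner (J1 (c *\<^sub>C x)) w = c * cinner (J1 x) w"
  by (simp_all add: cinner_J1 cinner_algebra scaleC_prod_def algebra_simps)

lemma J1_eq_zero: "J1 x = 0 \<Longrightarrow> x = 0"
  by (cases x) (auto simp: J1_def zero_prod_def)

definition J1_perp :: "('h::complex_hilbert \<times> 'h) set \<Rightarrow> ('h \<times> 'h) set" where
  "J1_perp U = {x. \<forall>y\<in>U. cinner (J1 x) y = 0}"

lemma J1_perp_iff: "x \<in> J1_perp U \<longleftrightarrow> (\<forall>y\<in>U. cinner (J1 x) y = 0)"
  by (simp add: J1_perp_def)

lemma hypermaximal_J1_neutral_iff: "hypermaximal_J1_neutral U \<longleftrightarrow> U = J1_perp U"
  by (simp add: hypermaximal_J1_neutral_def J1_perp_def)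

lemma closed_subspace_J1_perp: "closed_subspace (J1_perp U)"
  unfolding closed_subspace_def
proof
  show "cvec.subspace (J1_perp U)"
    by (simp add: cvec.subspace_def J1_perp_iff cinner_J1_left) (simp add: cinner_J1)
  have "J1_perp U = (\<Inter>y\<in>U. (\<lambda>x. cinner (J1 x) y) -` {0})"
    by (auto simp: J1_perp_def)
  moreover have "closed ((\<lambda>x. cinner (J1 x) y) -` {0})" for y
    by (intro closed_vimage continuous_on_cinner continuous_on_const closed_singleton
        linear_continuous_on bounded_linear_J1)
  ultimately show "closed (J1_perp U)" using closed_INT by metis
qed

lemma J1_perp_mono: "U \<subseteq> W \<Longrightarrow> J1_perp W \<subseteq> J1_perp U"
  by (auto simp: J1_perp_def)

text \<open>The form is hermitian, so orthogonality is a symmetric relation. This allows an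
  inclusion in a complement to be reduced to generators in one argument and then in the
  other.\<close>

lemma J1_perp_galois: "U \<subseteq> J1_perp W \<longleftrightarrow> W \<subseteq> J1_perp U"
  unfolding J1_perp_def using J1_zero_commute by blast

lemma J1_perp_dense:
  assumes "closure S = UNIV" "S \<subseteq> J1_perp {x}" shows "x = 0"
proof -
  have "cinner (J1 x) y = 0" if "y \<in> S" for y
    using assms(2) that J1_zero_commute unfolding J1_perp_def by blast
  then show ?thesis using orthogonal_dense assms(1) J1_eq_zero by blast
qed

section \<open>Operators with a given graph\<close>

text \<open>The choice of the second component is harmless exactly when it is unique; for a subspace
  this means that \<open>(0, v)\<close> belongs to it only for \<open>v = 0\<close>.\<close>

definition graph_op :: "('a \<times> 'b) set \<Rightarrow> ('a, 'b) operator" where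
  "graph_op U = (\<lambda>u. if \<exists>v. (u, v) \<in> U then Some (SOME v. (u, v) \<in> U) else None)"

lemma graph_graph_op:
  assumes "cvec.subspace (U :: ('a::complex_hilbert \<times> 'b::complex_hilbert) set)"
    and "\<And>v. (0, v) \<in> U \<Longrightarrow> v = 0"
  shows "Map.graph (graph_op U) = U"
proof -
  have uniq: "v = w" if "(u, v) \<in> U" "(u, w) \<in> U" for u v w
    using assms(2)[of "v - w"] cvec.subspace_diff[OF assms(1) that] by simp
  have "graph_op U u = Some v \<longleftrightarrow> (u, v) \<in> U" for u v
    using someI[of "\<lambda>v. (u, v) \<in> U"] uniq[of u] by (auto simp: graph_op_def)
  then show ?thesis by (auto simp: Map.graph_def)
qed

lemma graph_eq_Some: "Map.graph X = U \<Longrightarrow> X u = Some v \<longleftrightarrow> (u, v) \<in> U"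
  by (auto simp: Map.graph_def)

lemma graph_inj: "Map.graph X = Map.graph Y \<Longrightarrow> X = Y"
  using graph_eq_Some[of X "Map.graph Y"] graph_eq_Some[of Y "Map.graph Y"]
  by (intro ext) (metis option.exhaust)

lemma linear_op_if_graph_subspace:
  assumes "cvec.subspace (Map.graph X)" shows "linear_op X"
proof -
  have zero: "0 \<in> dom X"
    using cvec.subspace_0[OF assms] by (simp add: zero_prod_def mem_graph_iff)
  have add: "x + y \<in> dom X \<and> X \<cdot> (x + y) = X \<cdot> x + X \<cdot> y" if "x \<in> dom X" "y \<in> dom X" for x y
    using cvec.subspace_add[OF assms, of "(x, X \<cdot> x)" "(y, X \<cdot> y)"] that by (simp add: mem_graph_iff)
  have scale: "c *\<^sub>C x \<in> dom X \<and> X \<cdot> (c *\<^sub>C x) = c *\<^sub>C (X \<cdot> x)" if "x \<in> dom X" for x c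
    using cvec.subspace_scale[OF assms, of "(x, X \<cdot> x)" c] that
    by (simp add: mem_graph_iff scaleC_prod_def)
  show ?thesis unfolding linear_op_def cvec.subspace_def using zero add scale by blast
qed

lemma ball_graph: "(\<forall>x\<in>Map.graph X. Q x) \<longleftrightarrow> (\<forall>u\<in>dom X. Q (u, X \<cdot> u))"
  unfolding Map.graph_def dom_def by fastforce

text \<open>The \<open>J1\<close>-complement of a graph is the adjoint relation, which makes sense
  even before \<open>X\<close> is known to be densely defined. Selfadjointness thereby becomes
  hypermaximal neutrality of the graph.\<close>

lemma J1_perp_graph_iff:
  "(v, w) \<in> J1_perp (Map.graph X) \<longleftrightarrow> (\<forall>u\<in>dom X. cinner (X \<cdot> u) v = cinner u w)"
proof -
  have "(v, w) \<in> J1_perp (Map.graph X) \<longleftrightarrow> (\<forall>u\<in>dom X. cinner v (X \<cdot> u) = cinner w u)"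
    unfolding J1_perp_iff ball_graph by (simp add: cinner_J1)
  also have "\<dots> \<longleftrightarrow> (\<forall>u\<in>dom X. cinner (X \<cdot> u) v = cinner u w)"
    by (metis cinner_commute)
  finally show ?thesis .
qed

lemma selfadjoint_imp_hypermaximal:
  assumes "selfadjoint X"
  shows "hypermaximal_J1_neutral (Map.graph X)"
proof -
  have dense: "densely_defined X" and adj: "adj X = X" using assms by (auto simp: selfadjoint_def)
  have "(v, w) \<in> Map.graph X \<longleftrightarrow> (v, w) \<in> J1_perp (Map.graph X)" for v w
  proof
    assume "(v, w) \<in> Map.graph X"
    then show "(v, w) \<in> J1_perp (Map.graph X)"
      unfolding J1_perp_graph_iff mem_graph_iff using adj_cinner[OF dense, of v] adj by simp
  next
    assume "(v, w) \<in> J1_perp (Map.graph X)"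
    then have "adj X v = Some w"
      unfolding J1_perp_graph_iff by (intro adj_eq_SomeI[OF dense]) blast
    then show "(v, w) \<in> Map.graph X" using adj by (simp add: in_graphI)
  qed
  then show ?thesis by (auto simp: hypermaximal_J1_neutral_iff)
qed

lemma hypermaximal_imp_selfadjoint:
  assumes "hypermaximal_J1_neutral (Map.graph X)"
  shows "selfadjoint X"
proof -
  have perp: "J1_perp (Map.graph X) = Map.graph X"
    using assms by (simp add: hypermaximal_J1_neutral_iff)
  then have "cvec.subspace (Map.graph X)"
    using closed_subspace_J1_perp[of "Map.graph X"] by (simp add: closed_subspace_def)
  then have lin: "linear_op X" by (rule linear_op_if_graph_subspace)
  \<comment> \<open>A vector \<open>w\<close> orthogonal to the domain puts \<open>(0, w)\<close>
    into the complement of the graph, that is into the graph itself, so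
    \<open>w = 0\<close>.\<close>
  have dense: "densely_defined X"
    unfolding densely_defined_def
  proof (rule dense_if_orthogonal_trivial[OF linear_op_subspace[OF lin]])
    fix w assume "\<forall>u\<in>dom X. cinner w u = 0"
    then have "(0, w) \<in> J1_perp (Map.graph X)"
      unfolding J1_perp_graph_iff using cinner_eq_zero_commute by auto
    then show "w = 0" using perp linear_op_zero[OF lin] by (simp add: mem_graph_iff)
  qed
  have "adj X v = X v" for v
  proof (cases "v \<in> dom (adj X)")
    case True
    then have "(v, adj X \<cdot> v) \<in> J1_perp (Map.graph X)"
      unfolding J1_perp_graph_iff using adj_cinner[OF dense] by blast
    then have "X v = Some (adj X \<cdot> v)" using perp by (auto simp: mem_graph_iff)
    then show ?thesis using True by auto
  next
    case False
    have "v \<notin> dom X"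
    proof
      assume "v \<in> dom X"
      then have "(v, X \<cdot> v) \<in> J1_perp (Map.graph X)" using perp by (simp add: mem_graph_iff)
      then have "adj X v = Some (X \<cdot> v)"
        unfolding J1_perp_graph_iff by (intro adj_eq_SomeI[OF dense]) blast
      then show False using False by blast
    qed
    with False show ?thesis by (metis domIff)
  qed
  then show ?thesis using lin dense by (auto simp: selfadjoint_def)
qed

section \<open>Hamiltonian operator matrices\<close>

locale dominant_hamiltonian =
  fixes A B C :: "('h::complex_hilbert, 'h) operator"
    and T :: "('h \<times> 'h, 'h \<times> 'h) operator"
  assumes ham: "hamiltonian A B C"
    and T_eq: "T = ham_matrix A B C"
    and nonneg: "nonnegative_op B" "nonnegative_op C"
    and dominant: "diagonally_dominant A B C"
begin

lemma linA: "linear_op A" and linB: "linear_op B" and linC: "linear_op C"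
  and denseA: "densely_defined A" and denseB: "densely_defined B" and denseC: "densely_defined C"
  and symB: "symmetric_op B" and symC: "symmetric_op C"
  using ham by (auto simp: hamiltonian_def)

lemma linA': "linear_op (adj A)"
  by (rule linear_op_adj[OF denseA])

lemma domA: "u \<in> dom A \<Longrightarrow> u \<in> dom C" and domA': "v \<in> dom (adj A) \<Longrightarrow> v \<in> dom B"
  using dominant by (auto simp: diagonally_dominant_def relatively_bounded_def)

lemma dom_T: "(u, v) \<in> dom T \<longleftrightarrow> u \<in> dom A \<and> v \<in> dom (adj A)"
proof -
  have "(u, v) \<in> dom T \<longleftrightarrow> u \<in> dom A \<inter> dom C \<and> v \<in> dom (adj A) \<inter> dom B"
    by (simp add: T_eq ham_matrix_def domIff)
  then show ?thesis using domA domA' by blast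
qed

lemma T_app:
  "u \<in> dom A \<Longrightarrow> v \<in> dom (adj A) \<Longrightarrow> T \<cdot> (u, v) = (A \<cdot> u + B \<cdot> v, C \<cdot> u - adj A \<cdot> v)"
  using domA domA' by (auto simp: T_eq ham_matrix_def)

lemma linT: "linear_op T"
  unfolding linear_op_def
proof (intro conjI ballI allI)
  have add: "x + y \<in> dom T \<and> T \<cdot> (x + y) = T \<cdot> x + T \<cdot> y" if "x \<in> dom T" "y \<in> dom T" for x y
  proof -
    obtain u v u' v' where xy: "x = (u, v)" "y = (u', v')" by (cases x, cases y)
    then have d: "u \<in> dom A" "v \<in> dom (adj A)" "u' \<in> dom A" "v' \<in> dom (adj A)"
      using that by (simp_all add: dom_T)
    show ?thesis
      using linear_op_add[OF linA d(1,3)] linear_op_add[OF linA' d(2,4)]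
        linear_op_add[OF linC domA[OF d(1)] domA[OF d(3)]]
        linear_op_add[OF linB domA'[OF d(2)] domA'[OF d(4)]] d
      by (simp add: xy dom_T T_app)
  qed
  have scale: "c *\<^sub>C x \<in> dom T \<and> T \<cdot> (c *\<^sub>C x) = c *\<^sub>C (T \<cdot> x)" if "x \<in> dom T" for x c
  proof -
    obtain u v where xy: "x = (u, v)" by (cases x)
    then have d: "u \<in> dom A" "v \<in> dom (adj A)"
      using that by (simp_all add: dom_T)
    show ?thesis
      using linear_op_scale[OF linA d(1)] linear_op_scale[OF linA' d(2)]
        linear_op_scale[OF linC domA[OF d(1)]] linear_op_scale[OF linB domA'[OF d(2)]] d
      by (simp add: xy dom_T T_app scaleC_prod_def scaleC_add_right cvec.scale_right_diff_distrib)
  qed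
  have "0 \<in> dom T"
    using linear_op_zero[OF linA] linear_op_zero[OF linA'] by (simp add: zero_prod_def dom_T)
  then show "cvec.subspace (dom T)" using add scale by (simp add: cvec.subspace_def)
  show "T \<cdot> (x + y) = T \<cdot> x + T \<cdot> y" if "x \<in> dom T" "y \<in> dom T" for x y using add that by blast
  show "T \<cdot> (c *\<^sub>C x) = c *\<^sub>C (T \<cdot> x)" if "x \<in> dom T" for c x using scale that by blast
qed

lemma J1_skew:
  assumes "x \<in> dom T" "y \<in> dom T"
  shows "cinner (J1 (T \<cdot> x)) y = - cinner (J1 x) (T \<cdot> y)"
proof -
  obtain u v u' v' where xy: "x = (u, v)" "y = (u', v')" by (cases x, cases y)
  then have d: "u \<in> dom A" "v \<in> dom (adj A)" "u' \<in> dom A" "v' \<in> dom (adj A)"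
    using assms by (simp_all add: dom_T)
  have "cinner (B \<cdot> v) v' = cinner v (B \<cdot> v')" "cinner (C \<cdot> u) u' = cinner u (C \<cdot> u')"
    using symB symC d domA domA' by (simp_all add: symmetric_op_def)
  then show ?thesis
    using adj_cinner[OF denseA d(4,1)] adj_cinner_swap[OF denseA d(2,3)] d
    by (simp add: xy T_app cinner_J1 cinner_algebra algebra_simps)
qed

text \<open>The left-hand side is \<open>Re [T x|x]\<close> for \<open>x = (u, v)\<close>.\<close>

lemma J2_accretive:
  assumes "u \<in> dom A" "v \<in> dom (adj A)"
  shows "Re (cinner (snd (T \<cdot> (u, v))) u + cinner v (fst (T \<cdot> (u, v)))) =
    Re (cinner (B \<cdot> v) v) + Re (cinner (C \<cdot> u) u)"
proof -
  have "Re (cinner v (B \<cdot> v)) = Re (cinner (B \<cdot> v) v)"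
    using cinner_commute[of v "B \<cdot> v"] by simp
  then show ?thesis
    using adj_cinner_swap[OF denseA assms(2,1)] assms
    by (simp add: T_app cinner_algebra)
qed

lemma B_nonneg: "v \<in> dom (adj A) \<Longrightarrow> 0 \<le> Re (cinner (B \<cdot> v) v)"
  using nonneg(1)[unfolded nonnegative_op_def, rule_format, OF domA']
  by (simp add: less_eq_complex_def)

lemma C_nonneg: "u \<in> dom A \<Longrightarrow> 0 \<le> Re (cinner (C \<cdot> u) u)"
  using nonneg(2)[unfolded nonnegative_op_def, rule_format, OF domA]
  by (simp add: less_eq_complex_def)

lemma form_zero:
  assumes "u \<in> dom A" "v \<in> dom (adj A)" "Re (cinner (B \<cdot> v) v) + Re (cinner (C \<cdot> u) u) \<le> 0"
  shows "B \<cdot> v = 0" "C \<cdot> u = 0"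
proof -
  have "Re (cinner (B \<cdot> v) v) = 0" "Re (cinner (C \<cdot> u) u) = 0"
    using assms B_nonneg[of v] C_nonneg[of u] by auto
  then show "B \<cdot> v = 0" "C \<cdot> u = 0"
    using nonnegative_op_zero[OF linB denseB symB nonneg(1) domA'[OF assms(2)]]
      nonnegative_op_zero[OF linC denseC symC nonneg(2) domA[OF assms(1)]] by auto
qed

lemma positive_op_kernel:
  assumes "positive_op D" "v \<in> dom D" "D \<cdot> v = 0"
  shows "v = 0"
  using assms unfolding positive_op_def by (metis DiffI cinner_zero_left less_irrefl singletonD)

text \<open>For an eigenvalue \<open>z\<close> the real part of \<open>[T x|x]\<close> is
  \<open>2 * Re z * Re (cinner v u)\<close>, which vanishes on the imaginary axis. Both nonnegative
  forms then vanish, so \<open>B v\<close> and \<open>C u\<close> are 0 and the two rows of the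
  eigenvalue equation decouple.\<close>

lemma imaginary_eigenvector:
  assumes uv: "(u, v) \<in> dom T" and eig: "T \<cdot> (u, v) = (\<i> * complex_of_real t) *\<^sub>C (u, v)"
  shows "B \<cdot> v = 0" "C \<cdot> u = 0" "A \<cdot> u = (\<i> * complex_of_real t) *\<^sub>C u"
    "adj A \<cdot> v = - ((\<i> * complex_of_real t) *\<^sub>C v)"
proof -
  have d: "u \<in> dom A" "v \<in> dom (adj A)" using uv by (simp_all add: dom_T)
  let ?z = "\<i> * complex_of_real t"
  have eqs: "A \<cdot> u + B \<cdot> v = ?z *\<^sub>C u" "C \<cdot> u - adj A \<cdot> v = ?z *\<^sub>C v"
    using eig d by (simp_all add: T_app scaleC_prod_def)
  have "Re (cinner (B \<cdot> v) v) + Re (cinner (C \<cdot> u) u) = Re (?z * cinner v u + cnj ?z * cinner v u)"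
    using J2_accretive[OF d] eqs d by (simp add: T_app cinner_algebra)
  also have "\<dots> = 0" by simp
  finally show B0: "B \<cdot> v = 0" and C0: "C \<cdot> u = 0" using form_zero[OF d] by simp_all
  then show "A \<cdot> u = ?z *\<^sub>C u" "adj A \<cdot> v = - (?z *\<^sub>C v)"
    using eqs by (simp_all flip: eqs(2))
qed

section \<open>\<open>J1\<close>-orthogonality of root and spectral subspaces\<close>

text \<open>Double induction on the two chain lengths. Modulo shorter chains \<open>T\<close> acts
  as \<open>z\<close> on \<open>x\<close> and as \<open>w\<close> on \<open>y\<close>, so
  skew-symmetry turns into \<open>(z + cnj w) * cinner (J1 x) y = 0\<close>.\<close>

lemma root_subspaces_J1_orthogonal:
  assumes ne: "z + cnj w \<noteq> 0" and xy: "x \<in> root_subspace T z" "y \<in> root_subspace T w"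
  shows "cinner (J1 x) y = 0"
proof -
  have "cinner (J1 x) y = 0" if "x \<in> root_space T z k" "y \<in> root_space T w m" for k m x y
    using that
  proof (induction k arbitrary: x y m)
    case 0
    then show ?case by (simp add: cinner_J1)
  next
    case (Suc k)
    note outer = Suc.IH
    from Suc.prems(2,1) show ?case
    proof (induction m arbitrary: x y)
      case 0
      then show ?case by (simp add: cinner_J1)
    next
      case (Suc m)
      have d: "x \<in> dom T" "y \<in> dom T" using Suc.prems by auto
      have "T \<cdot> x - z *\<^sub>C x \<in> root_space T z k" using Suc.prems by simp
      then have 1: "cinner (J1 (T \<cdot> x - z *\<^sub>C x)) y = 0" using outer Suc.prems(1) by blast
      have 2: "cinner (J1 x) (T \<cdot> y - w *\<^sub>C y) = 0" using Suc.IH[OF _ Suc.prems(2)] Suc.prems(1) by simp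
      have "cinner (J1 (T \<cdot> x)) y = z * cinner (J1 x) y" "cinner (J1 x) (T \<cdot> y) = cnj w * cinner (J1 x) y"
        using 1 2 by (simp_all add: cinner_J1_left cinner_algebra)
      then have "z * cinner (J1 x) y = - (cnj w * cinner (J1 x) y)"
        using J1_skew[OF d] by simp
      then have "(z + cnj w) * cinner (J1 x) y = 0"
        unfolding distrib_right by simp
      then show ?case using ne by simp
    qed
  qed
  then show ?thesis using xy unfolding root_subspace_eq by blast
qed

lemma spectral_subspaces_J1_orthogonal:
  assumes "\<And>z w. z \<in> \<sigma> \<Longrightarrow> w \<in> \<tau> \<Longrightarrow> z + cnj w \<noteq> 0"
  shows "spectral_subspace T \<sigma> \<subseteq> J1_perp (spectral_subspace T \<tau>)"
  unfolding spectral_subspace_def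
proof (rule hilbert_sum_minimal[OF closed_subspace_J1_perp])
  fix z assume z: "z \<in> \<sigma>"
  have "hilbert_sum \<tau> (root_subspace T) \<subseteq> J1_perp (root_subspace T z)"
  proof (rule hilbert_sum_minimal[OF closed_subspace_J1_perp])
    fix w assume "w \<in> \<tau>"
    then have "root_subspace T z \<subseteq> J1_perp (root_subspace T w)"
      using root_subspaces_J1_orthogonal[OF assms[OF z]] by (auto simp: J1_perp_iff)
    then show "root_subspace T w \<subseteq> J1_perp (root_subspace T z)" by (simp only: J1_perp_galois)
  qed
  then show "root_subspace T z \<subseteq> J1_perp (hilbert_sum \<tau> (root_subspace T))"
    by (simp only: J1_perp_galois)
qed

lemma root_subspace_upper: "z \<in> \<sigma> \<Longrightarrow> root_subspace T z \<subseteq> spectral_subspace T \<sigma>"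
  unfolding spectral_subspace_def by (rule hilbert_sum_upper)

lemma closed_subspace_spectral: "closed_subspace (spectral_subspace T \<sigma>)"
  unfolding spectral_subspace_def by (rule closed_subspace_hilbert_sum)

end

locale spectral_hamiltonian = dominant_hamiltonian A B C T
  for A B C :: "('h::complex_hilbert, 'h) operator" and T +
  fixes V :: "nat \<Rightarrow> ('h \<times> 'h) set"
  assumes basis: "finitely_spectral T V"
begin

section \<open>Completeness of the root subspaces and hypermaximal neutrality\<close>

lemma dense_induct:
  assumes "closed_subspace U" "\<And>z. root_subspace T z \<subseteq> U"
  shows "x \<in> U"
proof -
  have "closure (cvec.span (\<Union>z. root_subspace T z)) \<subseteq> U"
    using assms unfolding closed_subspace_def by (intro closure_minimal cvec.span_minimal) auto
  then show ?thesis using root_subspaces_dense[OF linT basis] by blast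
qed

lemma J1_perp_root_subspaces:
  assumes "\<And>z. root_subspace T z \<subseteq> J1_perp {x}"
  shows "x = 0"
proof -
  have "UNIV \<subseteq> J1_perp {x}" using dense_induct[OF closed_subspace_J1_perp assms] by blast
  then show ?thesis using J1_perp_dense[of UNIV x] by simp
qed

text \<open>If \<open>- cnj z\<close> were no eigenvalue, an eigenvector for \<open>z\<close> would
  be \<open>J1\<close>-orthogonal to every root subspace, hence 0 by completeness and
  nondegeneracy.\<close>

lemma point_spectrum_symmetric:
  assumes z: "z \<in> point_spectrum T"
  shows "- cnj z \<in> point_spectrum T"
proof (rule ccontr)
  assume no: "- cnj z \<notin> point_spectrum T"
  obtain x where x: "x \<in> dom T" "x \<noteq> 0" "T \<cdot> x = z *\<^sub>C x"
    using z by (auto simp: point_spectrum_iff)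
  then have "x \<in> root_space T z (Suc 0)" by simp
  then have xr: "x \<in> root_subspace T z" unfolding root_subspace_eq by blast
  have "root_subspace T w \<subseteq> J1_perp {x}" for w
  proof (cases "w + cnj z = 0")
    case True
    then have "w = - cnj z" by (simp add: add_eq_0_iff2)
    then show ?thesis
      using root_subspace_trivial[OF linT no] by (simp add: J1_perp_iff cinner_J1)
  next
    case False
    then show ?thesis
      using root_subspaces_J1_orthogonal[OF _ _ xr] unfolding J1_perp_def by blast
  qed
  then show False using J1_perp_root_subspaces x(2) by blast
qed

context
  assumes no_imag: "point_spectrum T \<inter> imaginary_axis = {}"
begin

lemma sc_set_right: "sc_set T (point_spectrum_right T)"
  and sc_set_left: "sc_set T (point_spectrum_left T)"
  using point_spectrum_symmetric no_imag
  unfolding sc_set_def point_spectrum_right_def point_spectrum_left_def imaginary_axis_def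
  by auto

lemma spectral_subspace_neutral:
  assumes "sc_set T \<sigma>"
  shows "spectral_subspace T \<sigma> \<subseteq> J1_perp (spectral_subspace T \<sigma>)"
proof (rule spectral_subspaces_J1_orthogonal)
  fix z w assume zw: "z \<in> \<sigma>" "w \<in> \<sigma>"
  show "z + cnj w \<noteq> 0"
  proof
    assume "z + cnj w = 0"
    then have "z = - cnj w" by (simp add: add_eq_0_iff2)
    then show False using assms zw by (auto simp: sc_set_def)
  qed
qed

text \<open>Without imaginary eigenvalues the complement of an sc-set in the point spectrum again
  contains no pair \<open>z\<close>, \<open>- cnj z\<close>.\<close>

lemma spectral_complement_neutral:
  assumes "sc_set T \<sigma>"
  shows "spectral_subspace T (point_spectrum T - \<sigma>) \<subseteq>
    J1_perp (spectral_subspace T (point_spectrum T - \<sigma>))"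
proof (rule spectral_subspaces_J1_orthogonal)
  fix z w assume zw: "z \<in> point_spectrum T - \<sigma>" "w \<in> point_spectrum T - \<sigma>"
  show "z + cnj w \<noteq> 0"
  proof
    assume "z + cnj w = 0"
    then have "z = - cnj w" by (simp add: add_eq_0_iff2)
    then show False using assms zw no_imag by (auto simp: sc_set_def)
  qed
qed

lemma spectral_subspace_hypermaximal:
  assumes sc: "sc_set T \<sigma>"
  shows "hypermaximal_J1_neutral (spectral_subspace T \<sigma>)"
  unfolding hypermaximal_J1_neutral_iff
proof
  let ?U = "spectral_subspace T \<sigma>" and ?\<tau> = "point_spectrum T - \<sigma>"
  let ?W = "spectral_subspace T ?\<tau>"
  show "?U \<subseteq> J1_perp ?U" by (rule spectral_subspace_neutral[OF sc])
  obtain P where P: "riesz_projections V P" using finitely_spectral_projections[OF basis] by blast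
  note P_linear = riesz_projections_linear[OF P]
  have P_scale: "P k (c *\<^sub>C x) = c *\<^sub>C P k x" for k c x
    using P unfolding riesz_projections_def by blast
  \<comment> \<open>These sets are where an identity between \<open>x\<close> and
    \<open>P k x\<close>, verified on root vectors, is extended to all \<open>x\<close> by
    \<open>dense_induct\<close>.\<close>
  have P_closed: "closed_subspace {x. cinner (J1 (c *\<^sub>C x - P k x)) y = 0}" for c k y
    unfolding closed_subspace_def
  proof
    have "bounded_linear (P k)" using P by (simp add: riesz_projections_def)
    then have "closed ((\<lambda>x. cinner (J1 (c *\<^sub>C x - P k x)) y) -` {0})"
      by (intro closed_vimage continuous_on_cinner continuous_on_const closed_singleton
          bounded_linear.continuous_on[OF bounded_linear_J1] continuous_on_diff continuous_on_scaleC
          continuous_on_id linear_continuous_on)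
    then show "closed {x. cinner (J1 (c *\<^sub>C x - P k x)) y = 0}" by (simp add: vimage_def)
    show "cvec.subspace {x. cinner (J1 (c *\<^sub>C x - P k x)) y = 0}"
      by (simp add: cvec.subspace_def linear_0[OF P_linear] linear_add[OF P_linear] P_scale
          cinner_J1_left) (simp add: cinner_J1 algebra_simps)
  qed
  show "J1_perp ?U \<subseteq> ?U"
  proof
    fix x assume x: "x \<in> J1_perp ?U"
    show "x \<in> ?U"
    proof (rule riesz_projections_expand[OF P closed_subspace_spectral])
      fix k
      let ?S = "\<lambda>\<rho>. cvec.span (\<Union>z\<in>\<rho>. root_subspace T z \<inter> V k)"
      have sub: "?S \<rho> \<subseteq> spectral_subspace T \<rho>" for \<rho>
        using closed_subspace_spectral[of \<rho>] root_subspace_upper[of _ \<rho>]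
        by (intro cvec.span_minimal) (auto simp: closed_subspace_def)
      \<comment> \<open>Values that are not eigenvalues contribute only the zero vector, which
        accounts for the inserted 0.\<close>
      have incl: "(\<Union>z. root_subspace T z \<inter> V k) \<subseteq>
          insert 0 ((\<Union>z\<in>\<sigma>. root_subspace T z \<inter> V k) \<union> (\<Union>z\<in>?\<tau>. root_subspace T z \<inter> V k))"
        using root_subspace_trivial[OF linT] by blast
      have "V k \<subseteq> cvec.span (insert 0
          ((\<Union>z\<in>\<sigma>. root_subspace T z \<inter> V k) \<union> (\<Union>z\<in>?\<tau>. root_subspace T z \<inter> V k)))"
        by (rule order_trans[OF finitely_spectral_root_span[OF linT basis
                finitely_spectral_invariant[OF basis] order_refl] cvec.span_mono[OF incl]])
      then have "P k x \<in> cvec.span ((\<Union>z\<in>\<sigma>. root_subspace T z \<inter> V k) \<union> (\<Union>z\<in>?\<tau>. root_subspace T z \<inter> V k))"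
        using riesz_projections_in[OF P] by (simp only: cvec.span_insert_0) blast
      then obtain a b where ab: "a \<in> ?S \<sigma>" "b \<in> ?S ?\<tau>" "P k x = a + b"
        unfolding cvec.span_Un by blast
      have aU: "a \<in> ?U" and bW: "b \<in> ?W" using ab sub by blast+
      \<comment> \<open>\<open>b\<close> is the part of \<open>P k x\<close> in the complementary
        spectral subspace. It is tested against all root subspaces: those in the complement of
        \<sigma> by neutrality, those in \<sigma> by comparing \<open>P k x\<close> with
        \<open>x\<close>.\<close>
      have "b = 0"
      proof (rule J1_perp_root_subspaces)
        fix w
        have "cinner (J1 b) y = 0" if y: "y \<in> root_subspace T w" for y
        proof -
          consider "w \<in> \<sigma>" | "w \<in> ?\<tau>" | "w \<notin> point_spectrum T" by blast
          then show ?thesis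
          proof cases
            case 1
            then have yU: "y \<in> ?U" using root_subspace_upper y by blast
            obtain j where j: "root_subspace T (- cnj w) \<subseteq> V j"
              using root_subspace_subset_summand[OF linT basis] by blast
            \<comment> \<open>Only root vectors of \<open>- cnj w\<close> can pair nontrivially with
              \<open>y\<close>. They all lie in \<open>V j\<close>, where \<open>P k\<close> is the
              identity or 0; \<open>c\<close> is this factor, so
              \<open>c *\<^sub>C x - P k x\<close> is orthogonal to \<open>y\<close> for every
              \<open>x\<close>.\<close>
            define c :: complex where "c = (if j = k then 1 else 0)"
            have "root_subspace T z \<subseteq> {x. cinner (J1 (c *\<^sub>C x - P k x)) y = 0}" for z
            proof (cases "z = - cnj w")
              case True
              then show ?thesis
                using j riesz_projections_on_summand[OF P, of _ j k]
                by (auto simp: c_def scaleC_one cinner_J1)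
            next
              case False
              then have "z + cnj w \<noteq> 0" by (simp add: add_eq_0_iff2)
              then have "cinner (J1 x) y = 0" if "x \<in> root_subspace T z" for x
                using root_subspaces_J1_orthogonal[OF _ that y] by blast
              then have "cinner (J1 (c *\<^sub>C x - P k x)) y = 0" if "x \<in> root_subspace T z" for x
                using root_subspace_projection[OF linT basis P that, of k] that
                by (simp add: cinner_J1_left)
              then show ?thesis by blast
            qed
            then have "x \<in> {x. cinner (J1 (c *\<^sub>C x - P k x)) y = 0}"
              by (rule dense_induct[OF P_closed])
            moreover have "cinner (J1 x) y = 0" using x yU by (simp add: J1_perp_iff)
            moreover have "cinner (J1 a) y = 0"
              using spectral_subspace_neutral[OF sc] aU yU by (auto simp: J1_perp_iff)
            ultimately show ?thesis by (simp add: ab(3) cinner_J1_left)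
          next
            case 2
            then have "y \<in> ?W" using root_subspace_upper y by blast
            then show ?thesis using spectral_complement_neutral[OF sc] bW by (auto simp: J1_perp_iff)
          next
            case 3
            then show ?thesis using y root_subspace_trivial[OF linT] by auto
          qed
        qed
        then show "root_subspace T w \<subseteq> J1_perp {b}"
          using J1_zero_commute unfolding J1_perp_def by blast
      qed
      then show "P k x \<in> ?U" using ab aU by simp
    qed
  qed
qed

end

end

context dominant_hamiltonian
begin

section \<open>Resolvent-invariant neutral subspaces: graph property and injectivity\<close>

text \<open>On a root subspace for \<open>w \<noteq> z\<close> the operator \<open>T - z\<close> is
  onto, so its inverse maps that subspace into itself; continuity of the resolvent extends this to
  the closed sum.\<close>

lemma resolvent_spectral_subspace:
  assumes z: "z \<in> resolvent_set T" "z \<notin> \<sigma>" and x: "x \<in> spectral_subspace T \<sigma>"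
  shows "resolvent_op T z x \<in> spectral_subspace T \<sigma>"
proof -
  let ?U = "spectral_subspace T \<sigma>"
  note bl = bounded_linear_resolvent_op[OF linT z(1)]
  have U: "cvec.subspace ?U" "closed ?U"
    using closed_subspace_spectral by (simp_all add: closed_subspace_def)
  have "spectral_subspace T \<sigma> \<subseteq> resolvent_op T z -` ?U"
    unfolding spectral_subspace_def
  proof (rule hilbert_sum_minimal, unfold spectral_subspace_def[symmetric])
    show "closed_subspace (resolvent_op T z -` ?U)"
      unfolding closed_subspace_def
    proof
      show "closed (resolvent_op T z -` ?U)"
        using U(2) linear_continuous_on[OF bl] by (intro closed_vimage) auto
      show "cvec.subspace (resolvent_op T z -` ?U)"
        using U(1) linear_0[OF bounded_linear.linear[OF bl]]
        by (simp add: cvec.subspace_def resolvent_op_add[OF linT z(1)] resolvent_op_scaleC[OF linT z(1)])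
    qed
    fix w assume w: "w \<in> \<sigma>"
    show "root_subspace T w \<subseteq> resolvent_op T z -` ?U"
    proof
      fix x assume x: "x \<in> root_subspace T w"
      have "z \<noteq> w" using w z(2) by blast
      then obtain y where y: "y \<in> root_subspace T w" "T \<cdot> y - z *\<^sub>C y = x"
        using root_subspace_surj[OF linT invariant_subspace_root_subspace[OF linT] x x] by blast
      then have "resolvent_op T z x = y"
        using root_subspace_dom[OF linT] by (intro resolvent_op_eqI[OF z(1)]) auto
      then show "x \<in> resolvent_op T z -` ?U" using y(1) root_subspace_upper[OF w] by auto
    qed
  qed
  then show ?thesis using x by blast
qed

text \<open>The shift by an imaginary number contributes nothing to the real part of the form, so
  \<open>Re [T x|x]\<close> at the solution \<open>x = (a, b)\<close> only involves the right-hand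
  side \<open>(p, q)\<close>.\<close>

lemma resolvent_form:
  assumes z: "\<i> * complex_of_real t \<in> resolvent_set T"
    and ab: "resolvent_op T (\<i> * complex_of_real t) (p, q) = (a, b)"
  shows "a \<in> dom A" "b \<in> dom (adj A)"
    "A \<cdot> a + B \<cdot> b - (\<i> * complex_of_real t) *\<^sub>C a = p"
    "C \<cdot> a - adj A \<cdot> b - (\<i> * complex_of_real t) *\<^sub>C b = q"
    "Re (cinner (B \<cdot> b) b) + Re (cinner (C \<cdot> a) a) = Re (cinner q a + cinner b p)"
proof -
  let ?z = "\<i> * complex_of_real t"
  have "(a, b) \<in> dom T" and eq: "T \<cdot> (a, b) - ?z *\<^sub>C (a, b) = (p, q)"
    using resolvent_op[OF z, of "(p, q)"] ab by simp_all
  then show d: "a \<in> dom A" "b \<in> dom (adj A)" by (simp_all add: dom_T)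
  show p: "A \<cdot> a + B \<cdot> b - ?z *\<^sub>C a = p" and q: "C \<cdot> a - adj A \<cdot> b - ?z *\<^sub>C b = q"
    using eq d by (simp_all add: T_app scaleC_prod_def)
  have "fst (T \<cdot> (a, b)) = p + ?z *\<^sub>C a" "snd (T \<cdot> (a, b)) = q + ?z *\<^sub>C b"
    using d by (simp_all add: T_app p[symmetric] q[symmetric])
  then have "Re (cinner (B \<cdot> b) b) + Re (cinner (C \<cdot> a) a) =
      Re (cinner q a + ?z * cinner b a + (cinner b p + cnj ?z * cinner b a))"
    using J2_accretive[OF d] by (simp only: cinner_algebra)
  then show "Re (cinner (B \<cdot> b) b) + Re (cinner (C \<cdot> a) a) = Re (cinner q a + cinner b p)"
    by simp
qed

lemma neutral_second_component:
  assumes z: "\<i> * complex_of_real t \<in> resolvent_set T"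
    and U: "U \<subseteq> J1_perp U" "(0, v) \<in> U" "resolvent_op T (\<i> * complex_of_real t) (0, v) \<in> U"
  obtains b where "b \<in> dom (adj A)" "B \<cdot> b = 0" "v = - (adj A \<cdot> b + (\<i> * complex_of_real t) *\<^sub>C b)"
proof -
  let ?z = "\<i> * complex_of_real t"
  obtain a b where ab: "resolvent_op T ?z (0, v) = (a, b)" by (cases "resolvent_op T ?z (0, v)")
  note res = resolvent_form[OF z ab]
  have "cinner (J1 (a, b)) (0, v) = 0" using U ab unfolding J1_perp_def by auto
  \<comment> \<open>Neutrality removes the remaining term on the right of the form identity, so both
    nonnegative forms vanish.\<close>
  then have "cinner v a = 0" by (simp add: cinner_J1 cinner_eq_zero_commute[of v a])
  then have B0: "B \<cdot> b = 0" and C0: "C \<cdot> a = 0" using form_zero[OF res(1,2)] res(5) by simp_all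
  have 0: "0 \<in> dom (adj A)" "adj A \<cdot> 0 = 0" "B \<cdot> 0 = 0"
    using linear_op_zero[OF linA'] linear_op_zero[OF linB] by auto
  \<comment> \<open>With \<open>B b = 0\<close> and \<open>C a = 0\<close> the first component alone
    solves the homogeneous equation; as \<open>it\<close> is in the resolvent set,
    \<open>a = 0\<close>, and the second row expresses \<open>v\<close> through
    \<open>b\<close>.\<close>
  have "T \<cdot> (a, 0) - ?z *\<^sub>C (a, 0) = 0"
    using res(1,3) 0 B0 C0 by (simp add: T_app scaleC_prod_def zero_prod_def)
  then have "resolvent_op T ?z 0 = (a, 0)"
    using res(1) 0 by (intro resolvent_op_eqI[OF z]) (simp_all add: dom_T)
  moreover have "resolvent_op T ?z 0 = 0"
    using linear_0[OF bounded_linear.linear[OF bounded_linear_resolvent_op[OF linT z]]] .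
  ultimately have "a = 0" by (simp add: zero_prod_def)
  then have "v = - (adj A \<cdot> b + ?z *\<^sub>C b)" using res(4) C0 by (simp add: eq_neg_iff_add_eq_0 flip: res(4))
  then show ?thesis using that res(2) B0 by blast
qed

text \<open>
  In the second case \<open>v\<close> is orthogonal to \<open>(A - it)\<^sup>-\<^sup>1 B\<^sup>* u\<close> for all \<open>it\<close> near the given point of
  the imaginary axis, hence by analytic continuation to \<open>(A - z)\<^sup>-\<^sup>1 B\<^sup>* u\<close> for all \<open>z \<in> M\<close>.
\<close>

lemma neutral_invariant_angular:
  assumes ab: "positive_op B \<or>
      (\<exists>M\<in>components (resolvent_set A).
         M \<inter> resolvent_set T \<inter> imaginary_axis \<noteq> {} \<and>
         closure (cvec.span
           {inverse_op (shift A z) \<cdot> (adj B \<cdot> u) | z u. z \<in> M \<and> u \<in> dom (adj B)}) = UNIV)"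
    and ne: "resolvent_set T \<inter> imaginary_axis \<noteq> {}"
    and U: "U \<subseteq> J1_perp U" "(0, v) \<in> U"
    and inv: "\<And>z x. z \<in> resolvent_set T \<inter> imaginary_axis \<Longrightarrow> x \<in> U \<Longrightarrow> resolvent_op T z x \<in> U"
  shows "v = 0"
proof -
  have imag: "\<exists>t. z = \<i> * complex_of_real t" if "z \<in> imaginary_axis" for z
    using that by (intro exI[of _ "Im z"]) (simp add: imaginary_axis_def complex_eq_iff)
  have imag': "\<i> * complex_of_real t \<in> imaginary_axis" for t by (simp add: imaginary_axis_def)
  have second: "\<exists>b\<in>dom (adj A). B \<cdot> b = 0 \<and> v = - (adj A \<cdot> b + (\<i> * complex_of_real t) *\<^sub>C b)"
    if "\<i> * complex_of_real t \<in> resolvent_set T" for t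
    using neutral_second_component[OF that U inv[OF IntI[OF that imag'] U(2)]] by blast
  from ab show ?thesis
  proof
    assume pos: "positive_op B"
    obtain t where "\<i> * complex_of_real t \<in> resolvent_set T" using ne imag by blast
    then obtain b where b: "b \<in> dom (adj A)" "B \<cdot> b = 0"
        "v = - (adj A \<cdot> b + (\<i> * complex_of_real t) *\<^sub>C b)"
      using second by blast
    have "b = 0" using positive_op_kernel[OF pos domA'[OF b(1)] b(2)] .
    then show "v = 0" using b(3) linear_op_zero[OF linA'] by simp
  next
    assume "\<exists>M\<in>components (resolvent_set A).
         M \<inter> resolvent_set T \<inter> imaginary_axis \<noteq> {} \<and>
         closure (cvec.span
           {inverse_op (shift A z) \<cdot> (adj B \<cdot> u) | z u. z \<in> M \<and> u \<in> dom (adj B)}) = UNIV"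
    then obtain M where M: "M \<in> components (resolvent_set A)"
        "M \<inter> resolvent_set T \<inter> imaginary_axis \<noteq> {}"
      and dense: "closure (cvec.span
           {inverse_op (shift A z) \<cdot> (adj B \<cdot> u) | z u. z \<in> M \<and> u \<in> dom (adj B)}) = UNIV"
      by blast
    have MA: "M \<subseteq> resolvent_set A" "connected M" "open M"
      using M(1) open_resolvent_set[OF linA] by (auto dest: in_components_subset in_components_connected open_components)
    obtain t0 where t0: "\<i> * complex_of_real t0 \<in> M \<inter> resolvent_set T" using M(2) imag by blast
    have openMT: "open (M \<inter> resolvent_set T)" using MA(3) open_resolvent_set[OF linT] by blast
    have orth: "cinner (resolvent_op A z (adj B \<cdot> u)) v = 0" if z: "z \<in> M" and u: "u \<in> dom (adj B)" for z u
    proof (rule analytic_continuation[where U = "M \<inter> resolvent_set T \<inter> imaginary_axis"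
          and f = "\<lambda>z. cinner (resolvent_op A z (adj B \<cdot> u)) v" and S = M and \<xi> = "\<i> * complex_of_real t0"])
      show "(\<lambda>z. cinner (resolvent_op A z (adj B \<cdot> u)) v) holomorphic_on M"
        using holomorphic_resolvent[OF linA] MA(1) holomorphic_on_subset by blast
      \<comment> \<open>The points \<open>i (t0 + r)\<close> with small \<open>r > 0\<close> lie on
        the axis and in the open set \<open>M \<inter> resolvent_set T\<close>.\<close>
      show "\<i> * complex_of_real t0 islimpt M \<inter> resolvent_set T \<inter> imaginary_axis"
        unfolding islimpt_approachable
      proof (intro allI impI)
        fix e :: real assume e: "e > 0"
        obtain d where d: "d > 0" "ball (\<i> * complex_of_real t0) d \<subseteq> M \<inter> resolvent_set T"
          using openMT t0 open_contains_ball by blast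
        define r where "r = min d e / 2"
        have r: "r > 0" "r < d" "r < e" using d e by (auto simp: r_def)
        have dist: "dist (\<i> * complex_of_real (t0 + r)) (\<i> * complex_of_real t0) = r"
          using r by (simp add: dist_norm algebra_simps norm_mult)
        then have "\<i> * complex_of_real (t0 + r) \<in> ball (\<i> * complex_of_real t0) d"
          using r by (simp add: dist_commute)
        then have "\<i> * complex_of_real (t0 + r) \<in> M \<inter> resolvent_set T \<inter> imaginary_axis"
          using d(2) imag' by blast
        moreover have "\<i> * complex_of_real (t0 + r) \<noteq> \<i> * complex_of_real t0" using r dist by force
        ultimately show "\<exists>x'\<in>M \<inter> resolvent_set T \<inter> imaginary_axis.
            x' \<noteq> \<i> * complex_of_real t0 \<and> dist x' (\<i> * complex_of_real t0) < e"
          using dist r(3) by (intro bexI[of _ "\<i> * complex_of_real (t0 + r)"]) auto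
      qed
      fix w assume w: "w \<in> M \<inter> resolvent_set T \<inter> imaginary_axis"
      then obtain t where t: "w = \<i> * complex_of_real t" using imag by blast
      then obtain b where b: "b \<in> dom (adj A)" "B \<cdot> b = 0" "v = - (adj A \<cdot> b + w *\<^sub>C b)"
        using second w by blast
      let ?r = "resolvent_op A w (adj B \<cdot> u)"
      have wA: "w \<in> resolvent_set A" using w MA(1) by blast
      have cw: "cnj w = - w" by (simp add: t)
      have "cinner ?r v = - (cinner ?r (adj A \<cdot> b) + cnj w * cinner ?r b)"
        by (simp add: b(3) cinner_algebra)
      \<comment> \<open>On the axis \<open>cnj w = - w\<close>, so \<open>adj A + w\<close> is moved
        to the other side as \<open>A - w\<close>, which cancels the resolvent; what remains is a
        pairing with \<open>B b = 0\<close>.\<close>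
      also have "\<dots> = - (cinner (A \<cdot> ?r - w *\<^sub>C ?r) b)"
        using adj_cinner[OF denseA b(1) resolvent_op(1)[OF wA]] by (simp add: cinner_algebra cw)
      also have "\<dots> = - (cinner u (B \<cdot> b))"
        using resolvent_op(2)[OF wA] adj_cinner_swap[OF denseB u domA'[OF b(1)]] by simp
      finally show "cinner ?r v = 0" by (simp add: b(2))
    qed (use MA t0 z in auto)
    have "cinner v y = 0"
      if "y \<in> cvec.span {inverse_op (shift A z) \<cdot> (adj B \<cdot> u) | z u. z \<in> M \<and> u \<in> dom (adj B)}" for y
    proof (rule orthogonal_span[OF _ that])
      fix y assume "y \<in> {inverse_op (shift A z) \<cdot> (adj B \<cdot> u) | z u. z \<in> M \<and> u \<in> dom (adj B)}"
      then obtain z u where "z \<in> M" "u \<in> dom (adj B)" "y = resolvent_op A z (adj B \<cdot> u)"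
        unfolding resolvent_op_def by blast
      then show "cinner v y = 0" using orth cinner_eq_zero_commute by blast
    qed
    then show "v = 0" using orthogonal_dense dense by blast
  qed
qed

text \<open>The mirror image of the graph argument: neutrality gives \<open>C a = 0\<close>,
  positivity of \<open>C\<close> gives \<open>a = 0\<close>, and with \<open>B b = 0\<close> the
  first row reads \<open>u = 0\<close>.\<close>

lemma neutral_invariant_injective:
  assumes pos: "positive_op C" and z: "\<i> * complex_of_real t \<in> resolvent_set T"
    and U: "U \<subseteq> J1_perp U" "(u, 0) \<in> U" "resolvent_op T (\<i> * complex_of_real t) (u, 0) \<in> U"
  shows "u = 0"
proof -
  let ?z = "\<i> * complex_of_real t"
  obtain a b where ab: "resolvent_op T ?z (u, 0) = (a, b)" by (cases "resolvent_op T ?z (u, 0)")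
  note res = resolvent_form[OF z ab]
  have "cinner (J1 (a, b)) (u, 0) = 0" using U ab unfolding J1_perp_def by auto
  then have "cinner b u = 0" by (simp add: cinner_J1)
  then have B0: "B \<cdot> b = 0" and C0: "C \<cdot> a = 0" using form_zero[OF res(1,2)] res(5) by simp_all
  then have "a = 0" using positive_op_kernel[OF pos domA[OF res(1)]] by blast
  then show "u = 0" using res(3) B0 linear_op_zero[OF linA] by simp
qed

text \<open>The factor \<open>s\<close> enters once through the direction of time and once through
  \<open>g\<close>, so the derivative of \<open>g\<close> carries \<open>s * s\<close> and
  \<open>g\<close> increases to its limit 0. Trajectories are available for finite sums of root
  vectors; the inequality is closed and so survives the closure.\<close>

lemma spectral_subspace_sign:
  assumes s: "\<And>z. z \<in> \<sigma> \<Longrightarrow> s * Re z < 0" and x: "x \<in> spectral_subspace T \<sigma>"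
  shows "s * Re (cinner (snd x) (fst x)) \<le> 0"
proof -
  have alg: "s * Re (cinner (snd x) (fst x)) \<le> 0" if "x \<in> algebraic_sum \<sigma> (root_subspace T)" for x
  proof -
    have "\<exists>y. y 0 = x \<and> (\<forall>t. y t \<in> dom T \<and> (y has_vector_derivative s *\<^sub>R (T \<cdot> y t)) (at t))
        \<and> (y \<longlongrightarrow> 0) at_top"
      by (rule root_span_trajectory[OF linT s that])
    then obtain y where y0: "y 0 = x" and yd: "\<And>t. y t \<in> dom T"
      and ode: "\<And>t. (y has_vector_derivative s *\<^sub>R (T \<cdot> y t)) (at t)" and lim: "(y \<longlongrightarrow> 0) at_top"
      by blast
    define g where "g t = s * Re (cinner (snd (y t)) (fst (y t)))" for t
    have "\<exists>d\<ge>0. (g has_real_derivative d) (at t)" for t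
    proof -
      define f where "f = Re (cinner (snd (T \<cdot> y t)) (fst (y t)) + cinner (snd (y t)) (fst (T \<cdot> y t)))"
      obtain u v where uv: "y t = (u, v)" by (cases "y t")
      then have d: "u \<in> dom A" "v \<in> dom (adj A)" using yd[of t] by (simp_all add: dom_T)
      have "f = Re (cinner (B \<cdot> v) v) + Re (cinner (C \<cdot> u) u)"
        using J2_accretive[OF d] by (simp only: f_def uv fst_conv snd_conv)
      then have f: "f \<ge> 0" using B_nonneg[OF d(2)] C_nonneg[OF d(1)] by simp
      have "((\<lambda>t. Re (cinner (snd (y t)) (fst (y t)))) has_vector_derivative
          Re (cinner (snd (y t)) (fst (s *\<^sub>R (T \<cdot> y t))) + cinner (snd (s *\<^sub>R (T \<cdot> y t))) (fst (y t)))) (at t)"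
        by (intro bounded_linear.has_vector_derivative[OF bounded_linear_Re]
            bounded_bilinear.has_vector_derivative[OF bounded_bilinear_cinner]
            bounded_linear.has_vector_derivative[OF bounded_linear_fst]
            bounded_linear.has_vector_derivative[OF bounded_linear_snd] ode)
      also have "Re (cinner (snd (y t)) (fst (s *\<^sub>R (T \<cdot> y t))) + cinner (snd (s *\<^sub>R (T \<cdot> y t))) (fst (y t)))
          = s * f"
        by (simp add: f_def scaleC_of_real[symmetric] cinner_algebra scaleC_prod_def algebra_simps)
      finally have "(g has_real_derivative s * (s * f)) (at t)"
        unfolding g_def has_real_derivative_iff_has_vector_derivative[symmetric]
        by (rule DERIV_cmult)
      moreover have "s * (s * f) \<ge> 0" using f by (simp flip: mult.assoc)
      ultimately show ?thesis by blast
    qed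
    then have "g 0 \<le> g t" if "t \<ge> 0" for t
      using DERIV_nonneg_imp_nondecreasing[OF that, of g] by blast
    then have ev: "\<forall>\<^sub>F t in at_top. g 0 \<le> g t"
      using eventually_at_top_linorder by blast
    have "(g \<longlongrightarrow> s * Re (cinner (snd (0 :: 'h \<times> 'h)) (fst (0 :: 'h \<times> 'h)))) at_top"
      unfolding g_def by (intro tendsto_intros tendsto_cinner lim)
    then have "(g \<longlongrightarrow> 0) at_top" by simp
    then have "g 0 \<le> 0" using ev by (rule tendsto_lowerbound) simp
    then show ?thesis by (simp add: g_def y0)
  qed
  have "closed {x. s * Re (cinner (snd x) (fst x)) \<le> (0::real)}"
    by (intro closed_Collect_le continuous_intros)
  then have "closure (algebraic_sum \<sigma> (root_subspace T)) \<subseteq> {x. s * Re (cinner (snd x) (fst x)) \<le> 0}"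
    using alg by (intro closure_minimal) auto
  then show ?thesis using x unfolding spectral_subspace_def hilbert_sum_def by blast
qed

text \<open>The equation says that \<open>T\<close> maps \<open>(u, X u)\<close> back into the
  graph. As the graph is its own complement, this is checked by pairing with root vectors
  \<open>y\<close>: skew-symmetry moves \<open>T\<close> onto \<open>y\<close>, and
  \<open>T y\<close> stays in the subspace.\<close>

lemma riccati_if_graph_hypermaximal:
  assumes X: "Map.graph X = spectral_subspace T \<sigma>"
    and hyper: "hypermaximal_J1_neutral (spectral_subspace T \<sigma>)"
  shows "riccati_solution A B C X"
  unfolding riccati_solution_def
proof
  let ?U = "spectral_subspace T \<sigma>"
  fix u assume "u \<in> dom A \<inter> {u \<in> dom X. X \<cdot> u \<in> dom (adj A)}"
  then have u: "u \<in> dom A" "u \<in> dom X" "X \<cdot> u \<in> dom (adj A)" by auto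
  let ?x = "(u, X \<cdot> u)"
  have xd: "?x \<in> dom T" using u by (simp add: dom_T)
  have xU: "?x \<in> ?U" using u(2) unfolding X[symmetric] by (simp add: mem_graph_iff)
  have "?U \<subseteq> J1_perp {T \<cdot> ?x}"
    unfolding spectral_subspace_def
  proof (rule hilbert_sum_minimal[OF closed_subspace_J1_perp])
    fix w assume w: "w \<in> \<sigma>"
    show "root_subspace T w \<subseteq> J1_perp {T \<cdot> ?x}"
    proof
      fix y assume y: "y \<in> root_subspace T w"
      then have yd: "y \<in> dom T" using root_subspace_dom[OF linT] by blast
      have "T \<cdot> y \<in> ?U" using root_subspace_invariant[OF linT y] root_subspace_upper[OF w] by blast
      then have "cinner (J1 (T \<cdot> y)) ?x = 0"
        using hyper xU unfolding hypermaximal_J1_neutral_iff J1_perp_def by blast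
      then show "y \<in> J1_perp {T \<cdot> ?x}" using J1_skew[OF yd xd] by (simp add: J1_perp_iff)
    qed
  qed
  then have "T \<cdot> ?x \<in> ?U"
    using hyper unfolding hypermaximal_J1_neutral_iff J1_perp_galois[of ?U] by blast
  then have "(A \<cdot> u + B \<cdot> (X \<cdot> u), C \<cdot> u - adj A \<cdot> (X \<cdot> u)) \<in> Map.graph X"
    using u by (simp add: X T_app)
  then show "A \<cdot> u + B \<cdot> (X \<cdot> u) \<in> dom X \<and>
      X \<cdot> (A \<cdot> u + B \<cdot> (X \<cdot> u)) = C \<cdot> u - adj A \<cdot> (X \<cdot> u)"
    by (simp add: mem_graph_iff)
qed

section \<open>Eigenvalues on the imaginary axis\<close>

text \<open>The first component of an imaginary eigenvector lies in the two kernels and is 0. The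
  second satisfies \<open>B v = 0\<close> and \<open>adj A v = - z v\<close>, and is excluded by (a)
  or (b).\<close>

lemma nonimaginary_if_kernels_trivial:
  assumes ab: "positive_op B \<or>
      (\<exists>M\<in>components (resolvent_set A).
         closure (cvec.span
           {inverse_op (shift A z) \<cdot> (adj B \<cdot> u) | z u. z \<in> M \<and> u \<in> dom (adj B)}) = UNIV)"
    and ker: "\<And>t. op_kernel (shift A (\<i> * complex_of_real t)) \<inter> op_kernel C = {0}"
  shows "point_spectrum T \<inter> imaginary_axis = {}"
proof (rule ccontr)
  assume "point_spectrum T \<inter> imaginary_axis \<noteq> {}"
  then obtain z where "z \<in> point_spectrum T" and zi: "z \<in> imaginary_axis" by blast
  then obtain x where x: "x \<in> dom T" "x \<noteq> 0" "T \<cdot> x = z *\<^sub>C x"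
    unfolding point_spectrum_iff by blast
  define t where "t = Im z"
  have z: "z = \<i> * complex_of_real t" using zi by (simp add: t_def imaginary_axis_def complex_eq_iff)
  obtain u v where uv: "x = (u, v)" by (cases x)
  have d: "u \<in> dom A" "v \<in> dom (adj A)" using x(1) by (simp_all add: uv dom_T)
  note eig = imaginary_eigenvector[OF x(1)[unfolded uv] x(3)[unfolded uv z], folded z]
  have "u \<in> op_kernel (shift A (\<i> * complex_of_real t)) \<inter> op_kernel C"
    using eig d domA by (simp add: op_kernel_shift_iff op_kernel_iff[of _ C] z[symmetric])
  then have u0: "u = 0" using ker by blast
  from ab have "v = 0"
  proof
    assume "positive_op B"
    then show "v = 0" using positive_op_kernel domA'[OF d(2)] eig(1) by blast
  next
    assume "\<exists>M\<in>components (resolvent_set A).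
         closure (cvec.span
           {inverse_op (shift A z) \<cdot> (adj B \<cdot> u) | z u. z \<in> M \<and> u \<in> dom (adj B)}) = UNIV"
    then obtain M where M: "M \<subseteq> resolvent_set A"
      and dense: "closure (cvec.span
           {inverse_op (shift A z) \<cdot> (adj B \<cdot> u) | z u. z \<in> M \<and> u \<in> dom (adj B)}) = UNIV"
      using in_components_subset by blast
    \<comment> \<open>For imaginary \<open>z\<close> the vector \<open>v\<close> acts like a left
      eigenvector of \<open>A\<close>, so pairing with it turns the resolvent at \<open>w\<close>
      into division by \<open>z - w\<close>.\<close>
    have range_orth: "(z - w) * cinner (resolvent_op A w y) v = cinner y v" if w: "w \<in> resolvent_set A" for w y
    proof -
      let ?r = "resolvent_op A w y"
      have cz: "cnj z = - z" by (simp add: z)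
      have "cinner (A \<cdot> ?r) v = z * cinner ?r v"
        using adj_cinner[OF denseA d(2) resolvent_op(1)[OF w]] eig(4) by (simp add: cinner_algebra cz)
      moreover have "cinner y v = cinner (A \<cdot> ?r - w *\<^sub>C ?r) v"
        using resolvent_op(2)[OF w, of y] by simp
      ultimately show ?thesis by (simp add: cinner_algebra left_diff_distrib)
    qed
    show "v = 0"
    \<comment> \<open>If \<open>z\<close> itself is in \<open>M\<close>, then \<open>w = z\<close>
      makes \<open>v\<close> orthogonal to everything. Otherwise \<open>z - w\<close> can be
      cancelled and \<open>B v = 0\<close> makes \<open>v\<close> orthogonal to the dense
      span.\<close>
    proof (cases "z \<in> M")
      case True
      then show ?thesis
        using range_orth[of z v] M by (auto simp: cinner_self_eq_zero_iff)
    next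
      case False
      have "cinner v y = 0"
        if "y \<in> cvec.span {inverse_op (shift A z) \<cdot> (adj B \<cdot> u) | z u. z \<in> M \<and> u \<in> dom (adj B)}" for y
      proof (rule orthogonal_span[OF _ that])
        fix y assume "y \<in> {inverse_op (shift A z) \<cdot> (adj B \<cdot> u) | z u. z \<in> M \<and> u \<in> dom (adj B)}"
        then obtain w u where wu: "w \<in> M" "u \<in> dom (adj B)" "y = resolvent_op A w (adj B \<cdot> u)"
          unfolding resolvent_op_def by blast
        have "(z - w) * cinner y v = cinner (adj B \<cdot> u) v"
          using range_orth[of w "adj B \<cdot> u"] M wu by blast
        also have "\<dots> = 0"
          using adj_cinner_swap[OF denseB wu(2) domA'[OF d(2)]] eig(1) by simp
        finally have "cinner y v = 0" using False wu(1) by auto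
        then show "cinner v y = 0" using cinner_eq_zero_commute by blast
      qed
      then show ?thesis using orthogonal_dense dense by blast
    qed
  qed
  with u0 uv x(2) show False by (simp add: zero_prod_def)
qed

text \<open>A vector \<open>u\<close> in both kernels yields the eigenvector \<open>(u, 0)\<close>
  of \<open>T\<close>.\<close>

lemma kernels_trivial_if_nonimaginary:
  assumes "point_spectrum T \<inter> imaginary_axis = {}"
  shows "op_kernel (shift A (\<i> * complex_of_real t)) \<inter> op_kernel C = {0}"
proof -
  let ?z = "\<i> * complex_of_real t"
  have 0: "0 \<in> dom (adj A)" "adj A \<cdot> 0 = 0" "B \<cdot> 0 = 0"
    using linear_op_zero[OF linA'] linear_op_zero[OF linB] by auto
  have zero: "u = 0" if u: "u \<in> dom A" "A \<cdot> u = ?z *\<^sub>C u" "C \<cdot> u = 0" for u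
  proof (rule ccontr)
    assume "u \<noteq> 0"
    moreover have "(u, 0) \<in> dom T" "T \<cdot> (u, 0) = ?z *\<^sub>C (u, 0)"
      using u 0 by (simp_all add: dom_T T_app scaleC_prod_def)
    ultimately have "?z \<in> point_spectrum T"
      unfolding point_spectrum_iff by (intro bexI[of _ "(u, 0)"]) (auto simp: zero_prod_def)
    then show False using assms by (auto simp: imaginary_axis_def)
  qed
  have "0 \<in> op_kernel (shift A ?z)" "0 \<in> op_kernel C"
    using linear_op_zero[OF linA] linear_op_zero[OF linC]
    by (simp_all add: op_kernel_shift_iff op_kernel_iff[of _ C])
  moreover have "u = 0" if "u \<in> op_kernel (shift A ?z)" "u \<in> op_kernel C" for u
    using that zero[of u] by (simp add: op_kernel_shift_iff op_kernel_iff[of _ C])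
  ultimately show ?thesis by blast
qed

end

context spectral_hamiltonian
begin

section \<open>Uniqueness of signed solutions with compatible graph\<close>

text \<open>The Riccati equation makes each \<open>V k \<inter> Map.graph Y\<close> invariant under
  \<open>T\<close>, hence a span of root vectors whose eigenvalues also have eigenvectors in the
  graph. For such an eigenvector \<open>(u, v)\<close> the form identity relates the signs of
  \<open>Re z\<close> and \<open>Re (cinner v u)\<close>; positivity of \<open>C\<close> excludes 0
  and forces \<open>z\<close> into the required half-plane.\<close>

lemma compatible_solution_unique:
  assumes no_imag: "point_spectrum T \<inter> imaginary_axis = {}"
    and pos: "positive_op C" and s: "s \<noteq> 0"
    and Y: "selfadjoint Y" "riccati_solution A B C Y" "compatible V (Map.graph Y)"
    and sign: "\<And>u. u \<in> dom Y \<Longrightarrow> s * Re (cinner (Y \<cdot> u) u) \<le> 0"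
    and \<sigma>: "\<sigma> = {z \<in> point_spectrum T. s * Re z < 0}" "sc_set T \<sigma>"
  shows "Map.graph Y = spectral_subspace T \<sigma>"
proof
  let ?U = "spectral_subspace T \<sigma>" and ?G = "Map.graph Y"
  have linY: "linear_op Y" using Y(1) by (simp add: selfadjoint_def)
  have W: "invariant_subspace T (V k \<inter> ?G)" for k
    unfolding invariant_subspace_def
  proof (intro conjI ballI)
    have V: "cvec.subspace (V k)" "V k \<subseteq> dom T" "\<And>x. x \<in> V k \<Longrightarrow> T \<cdot> x \<in> V k"
      using finitely_spectral_invariant[OF basis, of k] by (auto simp: invariant_subspace_def)
    show "cvec.subspace (V k \<inter> ?G)"
      using V(1) linear_op_graph_subspace[OF linY] by (rule cvec.subspace_inter)
    show "V k \<inter> ?G \<subseteq> dom T" using V(2) by blast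
    fix x assume x: "x \<in> V k \<inter> ?G"
    obtain u v where uv: "x = (u, v)" by (cases x)
    have d: "u \<in> dom A" "v \<in> dom (adj A)" using x V(2) dom_T[of u v] unfolding uv by blast+
    have Yu: "u \<in> dom Y" "v = Y \<cdot> u" using x by (simp_all add: uv mem_graph_iff)
    have "T \<cdot> x \<in> ?G"
      using Y(2) d Yu unfolding riccati_solution_def by (simp add: uv T_app mem_graph_iff)
    then show "T \<cdot> x \<in> V k \<inter> ?G" using V(3) x by blast
  qed
  have root: "root_subspace T z \<inter> (V k \<inter> ?G) \<subseteq> ?U" for z k
  proof
    fix x assume x: "x \<in> root_subspace T z \<inter> (V k \<inter> ?G)"
    show "x \<in> ?U"
    proof (cases "x = 0")
      case True
      then show ?thesis using closed_subspace_spectral by (simp add: closed_subspace_def cvec.subspace_0)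
    next
      case False
      then obtain y where y: "y \<in> V k \<inter> ?G" "y \<noteq> 0" "T \<cdot> y = z *\<^sub>C y"
        using root_subspace_eigenvector[OF linT W] x by blast
      have yd: "y \<in> dom T" using y(1) W by (auto simp: invariant_subspace_def)
      then have zp: "z \<in> point_spectrum T" using y by (auto simp: point_spectrum_iff)
      obtain u v where uv: "y = (u, v)" by (cases y)
      have d: "u \<in> dom A" "v \<in> dom (adj A)" using yd by (simp_all add: uv dom_T)
      have Yu: "u \<in> dom Y" "v = Y \<cdot> u" using y by (simp_all add: uv mem_graph_iff)
      define c where "c = cinner v u"
      have Ty: "T \<cdot> (u, v) = z *\<^sub>C (u, v)" using y(3) by (simp only: uv)
      have form: "Re (cinner (B \<cdot> v) v) + Re (cinner (C \<cdot> u) u) = 2 * (Re z * Re c)"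
        using J2_accretive[OF d] unfolding Ty
        by (simp add: scaleC_prod_def cinner_algebra c_def)
      have "s * Re z < 0"
      proof (rule ccontr)
        assume "\<not> s * Re z < 0"
        then have "0 \<le> s * Re z" by simp
        moreover have "s * Re c \<le> 0" using sign[OF Yu(1)] by (simp add: c_def Yu(2))
        ultimately have "(s * Re z) * (s * Re c) \<le> 0" by (rule mult_nonneg_nonpos)
        then have "(s * s) * (Re z * Re c) \<le> 0" by (simp add: mult_ac)
        moreover have "s * s > 0" using s by (simp add: zero_less_mult_iff) linarith
        ultimately have "Re z * Re c \<le> 0" by (metis mult_le_0_iff not_le)
        then have "Re (cinner (B \<cdot> v) v) + Re (cinner (C \<cdot> u) u) \<le> 0" using form by linarith
        then have "C \<cdot> u = 0" by (rule form_zero[OF d])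
        then have "u = 0" using positive_op_kernel[OF pos domA[OF d(1)]] by blast
        moreover from this have "v = 0" using Yu(2) linear_op_zero[OF linY] by simp
        ultimately show False using y(2) uv by (simp add: zero_prod_def)
      qed
      then have "z \<in> \<sigma>" using zp by (simp add: \<sigma>(1))
      then show ?thesis using root_subspace_upper x by blast
    qed
  qed
  have "V k \<inter> ?G \<subseteq> ?U" for k
  proof -
    have "cvec.span (\<Union>z. root_subspace T z \<inter> (V k \<inter> ?G)) \<subseteq> ?U"
      using root closed_subspace_spectral[of \<sigma>]
      by (intro cvec.span_minimal) (auto simp: closed_subspace_def)
    then show ?thesis using finitely_spectral_root_span[OF linT basis W, of k k] by blast
  qed
  then have "hilbert_sum UNIV (\<lambda>k. V k \<inter> ?G) \<subseteq> ?U"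
    by (intro hilbert_sum_minimal closed_subspace_spectral)
  moreover have "?G = hilbert_sum UNIV (\<lambda>k. V k \<inter> ?G)"
    by (rule compatible_eq[OF Y(3)])
  ultimately show GU: "?G \<subseteq> ?U" by simp
  \<comment> \<open>Taking complements reverses the inclusion already proved, and the selfadjoint
    graph is its own complement.\<close>
  have "?U \<subseteq> J1_perp ?U" by (rule spectral_subspace_neutral[OF no_imag \<sigma>(2)])
  also have "\<dots> \<subseteq> J1_perp ?G" by (rule J1_perp_mono[OF GU])
  also have "\<dots> = ?G"
    using selfadjoint_imp_hypermaximal[OF Y(1)] by (simp add: hypermaximal_J1_neutral_iff)
  finally show "?U \<subseteq> ?G" .
qed

end

text \<open>The sign estimate concerns real parts only, whereas the order used in
  \<open>nonnegative_op\<close> and \<open>nonpositive_op\<close> also demands a real value.\<close>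

lemma selfadjoint_form_real:
  assumes "selfadjoint X" "u \<in> dom X"
  shows "Im (cinner (X \<cdot> u) u) = 0"
proof -
  have "cinner (X \<cdot> u) u = cinner u (X \<cdot> u)"
    using assms adj_cinner[of X u u] by (simp add: selfadjoint_def)
  then have "cinner (X \<cdot> u) u = cnj (cinner (X \<cdot> u) u)"
    by (metis cinner_commute)
  then show ?thesis by (metis Reals_cnj_iff complex_is_Real_iff)
qed

theorem corollary6p6:
  fixes A B C :: "('h::complex_hilbert, 'h) operator"
    and T :: "('h \<times> 'h, 'h \<times> 'h) operator"
    and V :: "nat \<Rightarrow> ('h \<times> 'h) set"
  assumes separable: "separable_space (euclidean :: 'h topology)"
    and ham: "hamiltonian A B C"
    and T_eq: "T = ham_matrix A B C"
    and nonneg: "nonnegative_op B" "nonnegative_op C"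
    and dominant: "diagonally_dominant A B C"
    and resolvent: "resolvent_set T \<inter> imaginary_axis \<noteq> {}"
    and basis: "finitely_spectral T V"
    and ab: "positive_op B \<or>
      (\<exists>M\<in>components (resolvent_set A).
         M \<inter> resolvent_set T \<inter> imaginary_axis \<noteq> {} \<and>
         closure (cvec.span
           {inverse_op (shift A z) \<cdot> (adj B \<cdot> u) | z u. z \<in> M \<and> u \<in> dom (adj B)}) = UNIV)"
  shows
    "(point_spectrum T \<inter> imaginary_axis = {} \<longleftrightarrow>
        (\<forall>t::real. op_kernel (shift A (\<i> * of_real t)) \<inter> op_kernel C = {0}))
     \<and>
     (point_spectrum T \<inter> imaginary_axis = {} \<longrightarrow>
        sc_set T (point_spectrum_right T) \<and> sc_set T (point_spectrum_left T) \<and>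
        (\<exists>X :: complex set \<Rightarrow> ('h, 'h) operator.
          (\<forall>\<sigma>. sc_set T \<sigma> \<longrightarrow>
             compatible V (spectral_subspace T \<sigma>) \<and>
             hypermaximal_J1_neutral (spectral_subspace T \<sigma>) \<and>
             spectral_subspace T \<sigma> = Map.graph (X \<sigma>) \<and>
             selfadjoint (X \<sigma>) \<and> riccati_solution A B C (X \<sigma>)) \<and>
          nonnegative_op (X (point_spectrum_right T)) \<and>
          nonpositive_op (X (point_spectrum_left T)) \<and>
          (positive_op C \<longrightarrow>
             (\<forall>\<sigma>. sc_set T \<sigma> \<longrightarrow> injective_op (X \<sigma>)) \<and>
             (\<forall>Y. selfadjoint Y \<and> nonnegative_op Y \<and> riccati_solution A B C Y \<and>
                  compatible V (Map.graph Y) \<longrightarrow> Y = X (point_spectrum_right T)) \<and>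
             (\<forall>Y. selfadjoint Y \<and> nonpositive_op Y \<and> riccati_solution A B C Y \<and>
                  compatible V (Map.graph Y) \<longrightarrow> Y = X (point_spectrum_left T)))))"
proof -
  interpret spectral_hamiltonian A B C T V
    using ham T_eq nonneg dominant basis by unfold_locales
  have iff: "point_spectrum T \<inter> imaginary_axis = {} \<longleftrightarrow>
      (\<forall>t::real. op_kernel (shift A (\<i> * of_real t)) \<inter> op_kernel C = {0})"
  proof
    assume "point_spectrum T \<inter> imaginary_axis = {}"
    then show "\<forall>t::real. op_kernel (shift A (\<i> * of_real t)) \<inter> op_kernel C = {0}"
      using kernels_trivial_if_nonimaginary by blast
  next
    assume "\<forall>t::real. op_kernel (shift A (\<i> * of_real t)) \<inter> op_kernel C = {0}"
    then show "point_spectrum T \<inter> imaginary_axis = {}"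
      using ab by (intro nonimaginary_if_kernels_trivial) blast+
  qed
  let ?U = "spectral_subspace T"
  \<comment> \<open>One function of \<sigma> supplies all solutions, so the two special ones are its
    values at the right and left point spectrum.\<close>
  define X where "X \<sigma> = graph_op (?U \<sigma>)" for \<sigma>
  let ?R = "point_spectrum_right T" and ?L = "point_spectrum_left T"
  have main: "sc_set T ?R \<and> sc_set T ?L \<and>
      (\<forall>\<sigma>. sc_set T \<sigma> \<longrightarrow> compatible V (?U \<sigma>) \<and> hypermaximal_J1_neutral (?U \<sigma>) \<and>
         ?U \<sigma> = Map.graph (X \<sigma>) \<and> selfadjoint (X \<sigma>) \<and> riccati_solution A B C (X \<sigma>)) \<and>
      nonnegative_op (X ?R) \<and> nonpositive_op (X ?L) \<and>
      (positive_op C \<longrightarrow>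
         (\<forall>\<sigma>. sc_set T \<sigma> \<longrightarrow> injective_op (X \<sigma>)) \<and>
         (\<forall>Y. selfadjoint Y \<and> nonnegative_op Y \<and> riccati_solution A B C Y \<and>
              compatible V (Map.graph Y) \<longrightarrow> Y = X ?R) \<and>
         (\<forall>Y. selfadjoint Y \<and> nonpositive_op Y \<and> riccati_solution A B C Y \<and>
              compatible V (Map.graph Y) \<longrightarrow> Y = X ?L))"
    if no_imag: "point_spectrum T \<inter> imaginary_axis = {}"
  proof -
    note scR = sc_set_right[OF no_imag] and scL = sc_set_left[OF no_imag]
    have inv: "resolvent_op T z x \<in> ?U \<sigma>"
      if "sc_set T \<sigma>" "z \<in> resolvent_set T \<inter> imaginary_axis" "x \<in> ?U \<sigma>" for \<sigma> z x
      using that by (intro resolvent_spectral_subspace) (auto simp: sc_set_def)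
    have graph: "Map.graph (X \<sigma>) = ?U \<sigma>" if sc: "sc_set T \<sigma>" for \<sigma>
      unfolding X_def
    proof (rule graph_graph_op)
      show "cvec.subspace (?U \<sigma>)" using closed_subspace_spectral by (simp add: closed_subspace_def)
      show "v = 0" if "(0, v) \<in> ?U \<sigma>" for v
        using neutral_invariant_angular[OF ab resolvent spectral_subspace_neutral[OF no_imag sc] that
            inv[OF sc]] by blast
    qed
    have hyper: "hypermaximal_J1_neutral (?U \<sigma>)" if "sc_set T \<sigma>" for \<sigma>
      by (rule spectral_subspace_hypermaximal[OF no_imag that])
    have sa: "selfadjoint (X \<sigma>)" if "sc_set T \<sigma>" for \<sigma>
      using hyper[OF that] by (intro hypermaximal_imp_selfadjoint) (simp add: graph[OF that])
    have sign: "s * Re (cinner (X \<sigma> \<cdot> u) u) \<le> 0"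
      if "sc_set T \<sigma>" "\<And>z. z \<in> \<sigma> \<Longrightarrow> s * Re z < 0" "u \<in> dom (X \<sigma>)" for \<sigma> s u
    proof -
      have "(u, X \<sigma> \<cdot> u) \<in> ?U \<sigma>" using that(3) unfolding graph[OF that(1), symmetric] by (simp add: mem_graph_iff)
      then show ?thesis using spectral_subspace_sign[OF that(2)] by fastforce
    qed
    have Xpos: "nonnegative_op (X ?R)"
      using sign[OF scR, of "-1"] selfadjoint_form_real[OF sa[OF scR]]
      by (simp add: nonnegative_op_def less_eq_complex_def point_spectrum_right_def)
    have Xneg: "nonpositive_op (X ?L)"
      using sign[OF scL, of 1] selfadjoint_form_real[OF sa[OF scL]]
      by (simp add: nonpositive_op_def less_eq_complex_def point_spectrum_left_def)
    have inj: "injective_op (X \<sigma>)" if pos: "positive_op C" and sc: "sc_set T \<sigma>" for \<sigma>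
      unfolding injective_op_def
    proof (rule inj_onI)
      fix u u' assume u: "u \<in> dom (X \<sigma>)" "u' \<in> dom (X \<sigma>)" "X \<sigma> \<cdot> u = X \<sigma> \<cdot> u'"
      have lin: "linear_op (X \<sigma>)" using sa[OF sc] by (simp add: selfadjoint_def)
      have "(u - u', 0) \<in> Map.graph (X \<sigma>)"
        using linear_op_diff[OF lin u(1,2)] u(3) by (simp add: mem_graph_iff)
      then have uU: "(u - u', 0) \<in> ?U \<sigma>" by (simp add: graph[OF sc])
      obtain z where z: "z \<in> resolvent_set T \<inter> imaginary_axis" using resolvent by blast
      then have zt: "z = \<i> * complex_of_real (Im z)" by (simp add: imaginary_axis_def complex_eq_iff)
      have "u - u' = 0"
        using neutral_invariant_injective[OF pos, of "Im z" "?U \<sigma>" "u - u'"] z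
          spectral_subspace_neutral[OF no_imag sc] uU inv[OF sc z uU]
        unfolding zt[symmetric] by blast
      then show "u = u'" by simp
    qed
    have uniqR: "Y = X ?R"
      if "positive_op C" "selfadjoint Y" "nonnegative_op Y" "riccati_solution A B C Y"
        "compatible V (Map.graph Y)" for Y
    proof (rule graph_inj)
      have "Map.graph Y = ?U ?R"
        using that scR by (intro compatible_solution_unique[OF no_imag, where s = "-1"])
          (auto simp: nonnegative_op_def less_eq_complex_def point_spectrum_right_def)
      then show "Map.graph Y = Map.graph (X ?R)" by (simp add: graph[OF scR])
    qed
    have uniqL: "Y = X ?L"
      if "positive_op C" "selfadjoint Y" "nonpositive_op Y" "riccati_solution A B C Y"
        "compatible V (Map.graph Y)" for Y
    proof (rule graph_inj)
      have "Map.graph Y = ?U ?L"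
        using that scL by (intro compatible_solution_unique[OF no_imag, where s = 1])
          (auto simp: nonpositive_op_def less_eq_complex_def point_spectrum_left_def)
      then show "Map.graph Y = Map.graph (X ?L)" by (simp add: graph[OF scL])
    qed
    have "compatible V (?U \<sigma>)" for \<sigma>
      by (rule spectral_subspace_compatible[OF linT basis])
    then show ?thesis
      using scR scL graph hyper sa riccati_if_graph_hypermaximal Xpos Xneg inj uniqR uniqL
      by simp
  qed
  show ?thesis
    by (rule conjI[OF iff], rule impI, drule main, elim conjE, intro conjI exI[of _ X]) assumption+
qed

end
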